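(* Let $m,n$ be integers, let $p>-2$ and $q>-2$ be real numbers, and let $f(re^{i\theta})=r^pe^{im\theta}$ and $g(re^{i\theta})=r^qe^{in\theta}$ (these belong to $L^1(\mathbb{D},dA)$). Then the following statements are equivalent. (a) There exists $h\in L^1(\mathbb{D},dA)$ such that $T_fT_g-T_h$ is of finite rank. (b) One of the following conditions holds true: (1) $q-m+2>0$ and $p+n+2>0$; (2) $m+p=0$ and $q-m+2>0$; (3) $n-q=0$ and $p+n+2>0$. If one of the statements, hence both, hold true, then $h=f\diamond g$.
   Context: $\mathbb{D}$ is the open unit disk in $\mathbb{C}$, $dA$ is normalized Lebesgue area measure on $\mathbb{D}$, and $A^2$ is the Bergman space of holomorphic functions on $\mathbb{D}$ that are square integrable with respect to $dA$. Toeplitz operators. For $f\in L^1(\mathbb{D},dA)$, the Toeplitz operator $T_f$ is defined (at least) on holomorphic polynomials $h$ by $T_f(h)(z)=\int_{\mathbb{D}}\frac{f(w)h(w)}{(1-\bar w z)^2}\,dA(w)$, $z\in\mathbb{D}$. Toeplitz operators with integrable symbols of the form $\phi(r)e^{im\theta}$ ($m\in\mathbb{Z}$) map holomorphic polynomials to holomorphic polynomials, so products of two such operators are defined on holomorphic polynomials. An operator obtained as a finite sum of products of such (possibly unbounded) operators, whose domain contains the holomorphic polynomials, is said to have finite rank if the image of the space of holomorphic polynomials is finite dimensional. Convolution $\diamond$. For a measurable function $\varphi$ on $(0,1)$, its Mellin transform is $\widehat{\varphi}(\zeta)=\int_0^1\varphi(r)r^{\zeta-1}\,dr$ for all $\zeta\in\mathbb{C}$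 for which the integral exists. A measurable function $\varphi$ on $(0,1)$ is nearly integrable if $\varphi\in L^1((0,1),r^{\alpha}dr)$ for some $\alpha>0$. For $f(re^{i\theta})=\phi(r)e^{im\theta}$ and $g(re^{i\theta})=\psi(r)e^{in\theta}$ with $\phi,\psi$ nearly integrable, if there is a nearly integrable function $\omega$ on $(0,1)$ with $\widehat{\omega}(\zeta)=(\zeta-m+n)\,\widehat{\phi}(\zeta+n)\,\widehat{\psi}(\zeta-m)$ on some right half-plane in $\mathbb{C}$, then $f\diamond g$ is defined as $(f\diamond g)(re^{i\theta})=\omega(r)e^{i(m+n)\theta}$. For the functions $f,g$ of the claim, $f\diamond g$ always exists. *)

theory Defs
  imports "HOL-Analysis.Analysis" "HOL-Computational_Algebra.Polynomial"
begin

definition dA :: "complex measure" where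
  "dA = density (lebesgue_on (ball 0 1)) (\<lambda>_. ennreal (1 / pi))"

text \<open>For an integrable symbol \<open>f\<close> the integral below converges at every point \<open>z\<close> of the disk
  whenever \<open>u\<close> is bounded, in particular whenever \<open>u\<close> agrees with a polynomial on the disk. Only the
  values of \<open>u\<close> on the disk enter, and only \<open>z\<close> in the disk is meaningful.\<close>

definition toeplitz :: "(complex \<Rightarrow> complex) \<Rightarrow> (complex \<Rightarrow> complex) \<Rightarrow> complex \<Rightarrow> complex" where
  "toeplitz f u z = (LINT w|dA. f w * u w / (1 - cnj w * z)\<^sup>2)"

text \<open>The image of the holomorphic polynomials, as functions on the disk, is finite dimensional:
  it lies in the linear span of a finite set of functions.\<close>

definition finite_rank :: "((complex \<Rightarrow> complex) \<Rightarrow> complex \<Rightarrow> complex) \<Rightarrow> bool" where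
  "finite_rank T \<longleftrightarrow>
     (\<exists>B :: (complex \<Rightarrow> complex) set. finite B \<and>
        (\<forall>u :: complex poly. \<exists>c. \<forall>z\<in>ball 0 1. T (poly u) z = (\<Sum>b\<in>B. c b * b z)))"

definition mellin_exists :: "(real \<Rightarrow> complex) \<Rightarrow> complex \<Rightarrow> bool" where
  "mellin_exists \<phi> \<zeta> \<longleftrightarrow>
     integrable (lebesgue_on {0<..<1}) (\<lambda>r. \<phi> r * complex_of_real r powr (\<zeta> - 1))"

definition mellin :: "(real \<Rightarrow> complex) \<Rightarrow> complex \<Rightarrow> complex" where
  "mellin \<phi> \<zeta> = (LINT r|lebesgue_on {0<..<1}. \<phi> r * complex_of_real r powr (\<zeta> - 1))"

definition nearly_integrable :: "(real \<Rightarrow> complex) \<Rightarrow> bool" where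
  "nearly_integrable \<phi> \<longleftrightarrow>
     \<phi> \<in> borel_measurable (lebesgue_on {0<..<1}) \<and>
     (\<exists>\<alpha>>0. integrable (lebesgue_on {0<..<1}) (\<lambda>r. \<phi> r * complex_of_real (r powr \<alpha>)))"

definition quasihomogeneous :: "(complex \<Rightarrow> complex) \<Rightarrow> (real \<Rightarrow> complex) \<Rightarrow> int \<Rightarrow> bool" where
  "quasihomogeneous f \<phi> m \<longleftrightarrow>
     (\<forall>r \<theta>. 0 < r \<and> r < 1 \<longrightarrow> f (rcis r \<theta>) = \<phi> r * cis (of_int m * \<theta>))"

text \<open>\<open>is_diamond f g k\<close> says that the convolution of \<open>f\<close> and \<open>g\<close> exists and is represented by \<open>k\<close>. It is a relation
  because the radial part \<open>\<omega>\<close> is determined by its Mellin transform only up to null sets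
  (and \<open>k\<close> is unconstrained at the origin and off the disk).\<close>

definition is_diamond :: "(complex \<Rightarrow> complex) \<Rightarrow> (complex \<Rightarrow> complex) \<Rightarrow> (complex \<Rightarrow> complex) \<Rightarrow> bool" where
  "is_diamond f g k \<longleftrightarrow>
     (\<exists>m n \<phi> \<psi> \<omega>.
        quasihomogeneous f \<phi> m \<and> nearly_integrable \<phi> \<and>
        quasihomogeneous g \<psi> n \<and> nearly_integrable \<psi> \<and>
        quasihomogeneous k \<omega> (m + n) \<and> nearly_integrable \<omega> \<and>
        (\<exists>c::real. \<forall>\<zeta>. c < Re \<zeta> \<longrightarrow>
           mellin_exists \<phi> (\<zeta> + of_int n) \<and> mellin_exists \<psi> (\<zeta> - of_int m) \<and> mellin_exists \<omega> \<zeta> \<and>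
           mellin \<omega> \<zeta> = (\<zeta> - of_int m + of_int n)
              * mellin \<phi> (\<zeta> + of_int n) * mellin \<psi> (\<zeta> - of_int m)))"

end

theory Submission
  imports Defs "HOL-Complex_Analysis.Cauchy_Integral_Formula" "Jordan_Normal_Form.Determinant"
    "HOL-Real_Asymp.Real_Asymp"
begin

text \<open>The idea is to compare matrices with respect to the monomials. The operator with symbol \<open>h\<close> sends
\<open>w ^ i\<close> to the power series with coefficients \<open>(j + 1) * moment h i j\<close>
(\<open>toeplitz_monomial_sums\<close>). The product of the operators with symbols \<open>f\<close> and \<open>g\<close> is a weighted
shift, and by the definition of \<open>f \<diamond> g\<close> through Mellin transforms, its coefficients for
large \<open>i\<close> are the numbers \<open>(j + 1) * moment k i j\<close> of any representative \<open>k\<close> of \<open>f \<diamond> g\<close>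
(\<open>moment_diamond\<close>).

Suppose the product differs from the operator with integrable symbol \<open>h\<close> by finite rank. Multiplying
\<open>h - k\<close> by a high even power of \<open>norm w\<close> makes it integrable and shifts its moments by the same amount in
rows and columns, so a moment matrix of finite rank arises. Such a matrix forces the function to vanish
almost everywhere (Luecking's theorem, \<open>finite_rank_moment_matrix_imp_zero\<close>), which gives \<open>h = k\<close>.
For functions, in contrast to measures, there is a short proof: the moments of \<open>F\<close> times the character
\<open>exp (2 i Im (\<zeta> w))\<close> tend to 0 as \<open>\<zeta>\<close> tends to infinity by the Riemann--Lebesgue lemma, while
finite rank lets a suitable determinant of them factor into an entire and a conjugate entire function.
By Liouville's theorem the determinant is 0 for all \<open>\<zeta>\<close>, whereas at \<open>\<zeta> = 0\<close> it is a nonzero minor,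
unless the rank is 0.

So (a) holds if and only if \<open>f \<diamond> g\<close> is integrable over the disk: if it is, the difference annihilates
all but finitely many monomials. The radial part of \<open>f \<diamond> g\<close> has the Mellin transform
\<open>(\<zeta> - m + n) / ((\<zeta> + n + p) * (\<zeta> - m + q))\<close>. By partial fractions it is a combination of the powers
\<open>r powr (p + n)\<close> and \<open>r powr (q - m)\<close> with coefficients proportional to \<open>m + p\<close> and \<open>n - q\<close>, or
\<open>r powr (p + n) * (1 + (m + p) * ln r)\<close> when the exponents coincide. Integrability against \<open>r dr\<close> requires
an exponent greater than \<open>-2\<close> for every power that occurs with nonzero coefficient, and this is
condition (b) (\<open>integrable_diamond_radial_iff\<close>).\<close>

section \<open>The Riemann--Lebesgue lemma in the plane\<close>

text \<open>For positive \<open>b\<close> the nearest-point retraction onto the closed disk of radius \<open>b\<close>, written without a case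
distinction so that its continuity is visible.\<close>

definition radial_clamp :: "real \<Rightarrow> complex \<Rightarrow> complex" where
  "radial_clamp b z = z / of_real (max 1 (norm z / b))"

lemma continuous_radial_clamp [continuous_intros]:
  assumes "continuous_on S g"
  shows "continuous_on S (\<lambda>x. radial_clamp b (g x))"
  unfolding radial_clamp_def divide_inverse[of "norm _"]
  by (intro continuous_intros assms) auto

lemma norm_radial_clamp:
  assumes "b > 0"
  shows "norm (radial_clamp b z) \<le> b"
proof -
  have "norm z / b \<le> max 1 (norm z / b)" by simp
  then have "norm z \<le> b * max 1 (norm z / b)"
    using assms by (simp only: pos_divide_le_eq mult.commute)
  moreover have "norm (radial_clamp b z) = norm z / max 1 (norm z / b)"
    by (simp add: radial_clamp_def norm_divide abs_of_pos)
  moreover have "max 1 (norm z / b) > 0" by (simp add: less_max_iff_disj)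
  ultimately show ?thesis by (simp add: pos_divide_le_eq)
qed

lemma radial_clamp_id:
  assumes "b > 0" "norm z \<le> b"
  shows "radial_clamp b z = z"
proof -
  have "max 1 (norm z / b) = 1" using assms by (simp add: max_def)
  then show ?thesis by (simp add: radial_clamp_def)
qed

lemma norm_radial_clamp_le: "norm (radial_clamp b z) \<le> norm z"
proof -
  have "norm (radial_clamp b z) = norm z / max 1 (norm z / b)"
    by (simp add: radial_clamp_def norm_divide abs_of_pos)
  also have "\<dots> \<le> norm z / 1"
    by (rule divide_left_mono) (auto simp: less_max_iff_disj)
  finally show ?thesis by simp
qed

text \<open>A measurable function is an almost everywhere limit of continuous functions; clamping those to the
disk that contains the range of \<open>f\<close> does not disturb the limit and gives a uniform bound, as
dominated convergence requires.\<close>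

lemma bounded_measurable_ae_limit_continuous:
  fixes f :: "complex \<Rightarrow> complex"
  assumes f: "f \<in> borel_measurable lebesgue" and b: "b > 0" and le: "\<And>x. norm (f x) \<le> b"
  obtains g where "\<And>n::nat. continuous_on UNIV (g n)" "\<And>n x. norm (g n x) \<le> b"
    "AE x in lebesgue. (\<lambda>n. g n x) \<longlonglongrightarrow> f x"
proof -
  have "f measurable_on UNIV"
    using f by (intro lebesgue_measurable_imp_measurable_on) auto
  then obtain N g where N: "negligible N" and g: "\<And>n::nat. continuous_on UNIV (g n)"
    and lim: "\<And>x. x \<notin> N \<Longrightarrow> (\<lambda>n. g n x) \<longlonglongrightarrow> f x"
    unfolding measurable_on_def by auto
  show thesis
  proof (rule that[of "\<lambda>n x. radial_clamp b (g n x)"])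
    show "continuous_on UNIV (\<lambda>x. radial_clamp b (g n x))" for n
      by (intro continuous_intros g)
    show "norm (radial_clamp b (g n x)) \<le> b" for n x
      by (rule norm_radial_clamp[OF b])
    have "(\<lambda>n. radial_clamp b (g n x)) \<longlonglongrightarrow> f x" if "x \<notin> N" for x
    proof -
      have "isCont (radial_clamp b) (f x)"
        using continuous_radial_clamp[OF continuous_on_id, of UNIV b]
        by (simp add: continuous_on_eq_continuous_at)
      from isCont_tendsto_compose[OF this lim[OF that]]
      show ?thesis using radial_clamp_id[OF b le] by simp
    qed
    then show "AE x in lebesgue. (\<lambda>n. radial_clamp b (g n x)) \<longlonglongrightarrow> f x"
      using N by (intro AE_I'[of N]) (auto simp: negligible_iff_null_sets)
  qed
qed

definition cutoff :: "nat \<Rightarrow> complex \<Rightarrow> real" where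
  "cutoff k w = max 0 (min 1 (real k + 1 - norm w))"

lemma cutoff_bounds: "0 \<le> cutoff k w" "cutoff k w \<le> 1"
  by (auto simp: cutoff_def)

lemma cutoff_outside: "norm w \<ge> real k + 1 \<Longrightarrow> cutoff k w = 0"
  by (auto simp: cutoff_def)

lemma continuous_cutoff [continuous_intros]: "continuous_on S (cutoff k)"
  unfolding cutoff_def[abs_def] by (intro continuous_intros)

lemma measurable_cont_lebesgue:
  fixes f :: "complex \<Rightarrow> 'b::{real_normed_vector}"
  assumes "continuous_on UNIV f" shows "f \<in> borel_measurable lebesgue"
  using borel_measurable_continuous_onI[OF assms] measurable_completion
  by (metis measurable_lborel2)

text \<open>Density of compactly supported continuous functions in $L^1$. The function is first cut off at level
\<open>k\<close> in size and in space, which costs little by dominated convergence; the cut-off function is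
bounded and lives on a bounded set, so its continuous almost everywhere approximations converge in
$L^1$ as well.\<close>

lemma L1_approx_by_compact_support:
  fixes F :: "complex \<Rightarrow> complex"
  assumes F: "integrable lebesgue F" and e: "e > 0"
  obtains G R where "continuous_on UNIV G" "\<And>w. norm w \<ge> R \<Longrightarrow> G w = 0"
    "integrable lebesgue G" "(LINT w|lebesgue. norm (F w - G w)) < e"
proof -
  have meas[measurable]: "F \<in> borel_measurable lebesgue" using F by auto
  have [measurable]: "cutoff k \<in> borel_measurable lebesgue" for k
    by (intro measurable_cont_lebesgue continuous_intros)
  have [measurable]: "radial_clamp b \<in> borel_measurable borel" for b
    using continuous_radial_clamp[OF continuous_on_id, of UNIV b]
    by (intro borel_measurable_continuous_onI) auto
  define Fk where "Fk k w = radial_clamp (real k) (F w) * of_real (cutoff k w)" for k w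
  have Fkm[measurable]: "Fk k \<in> borel_measurable lebesgue" for k
    unfolding Fk_def by measurable
  have Fk_le: "norm (Fk k w) \<le> norm (F w)" for k w
  proof -
    have "norm (Fk k w) \<le> norm (radial_clamp (real k) (F w)) * 1"
      unfolding Fk_def norm_mult using cutoff_bounds[of k w] by (intro mult_left_mono) auto
    then show ?thesis using norm_radial_clamp_le[of "real k" "F w"] by linarith
  qed
  have "(\<lambda>k. LINT w|lebesgue. norm (F w - Fk k w)) \<longlonglongrightarrow> (LINT w|(lebesgue :: complex measure). 0)"
  proof (rule integral_dominated_convergence[where w = "\<lambda>w. 2 * norm (F w)"])
    show "integrable lebesgue (\<lambda>w. 2 * norm (F w))" using F by auto
    show "AE w in lebesgue. (\<lambda>k. norm (F w - Fk k w)) \<longlonglongrightarrow> 0"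
    proof (rule AE_I2)
      fix w :: complex
      obtain k0 :: nat where k0: "norm w + norm (F w) + 1 < real k0"
        using reals_Archimedean2 by blast
      have "norm (F w - Fk k w) = 0" if "k \<ge> k0" for k
      proof -
        have kk: "norm w + norm (F w) + 1 < real k" using k0 that by linarith
        have "cutoff k w = 1" using kk norm_ge_zero[of "F w"] unfolding cutoff_def by linarith
        moreover have "radial_clamp (real k) (F w) = F w"
          using kk norm_ge_zero[of w] norm_ge_zero[of "F w"] by (intro radial_clamp_id) linarith+
        ultimately show ?thesis by (simp add: Fk_def)
      qed
      then show "(\<lambda>k. norm (F w - Fk k w)) \<longlonglongrightarrow> 0"
        by (intro tendsto_eventually) (auto simp: eventually_sequentially)
    qed
    show "AE w in lebesgue. norm (norm (F w - Fk k w)) \<le> 2 * norm (F w)" for k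
    proof (intro AE_I2)
      fix w :: complex
      show "norm (norm (F w - Fk k w)) \<le> 2 * norm (F w)"
        using norm_triangle_ineq4[of "F w" "Fk k w"] Fk_le[of k w] by simp
    qed
  qed auto
  then have "(\<lambda>k. LINT w|lebesgue. norm (F w - Fk k w)) \<longlonglongrightarrow> 0" by simp
  then have "\<forall>\<^sub>F k in sequentially. (LINT w|lebesgue. norm (F w - Fk k w)) < e / 2"
    using e by (intro order_tendstoD) auto
  then have "\<forall>\<^sub>F k in sequentially. (LINT w|lebesgue. norm (F w - Fk k w)) < e / 2 \<and> k > 0"
    using eventually_gt_at_top by (rule eventually_conj)
  then obtain k where k: "(LINT w|lebesgue. norm (F w - Fk k w)) < e / 2" "k > 0"
    by (auto simp: eventually_sequentially)
  have kpos: "real k > 0" using k by simp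
  obtain g where g: "\<And>n::nat. continuous_on UNIV (g n)" "\<And>n x. norm (g n x) \<le> real k"
    "AE x in lebesgue. (\<lambda>n. g n x) \<longlonglongrightarrow> radial_clamp (real k) (F x)"
    by (rule bounded_measurable_ae_limit_continuous[of "\<lambda>x. radial_clamp (real k) (F x)" "real k"])
       (use kpos norm_radial_clamp[OF kpos] in auto)
  define G where "G n w = g n w * of_real (cutoff k w)" for n w
  have Gc: "continuous_on UNIV (G n)" for n
    unfolding G_def by (intro continuous_intros g)
  have [measurable]: "G n \<in> borel_measurable lebesgue" for n
    by (intro measurable_cont_lebesgue Gc)
  have Fkb: "norm (Fk k w) \<le> real k * indicator (cball 0 (real k + 1)) w" for w
    using norm_radial_clamp[OF kpos, of "F w"] cutoff_bounds[of k w] cutoff_outside[of k w] kpos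
      mult_mono[of "norm (radial_clamp (real k) (F w))" "real k" "\<bar>cutoff k w\<bar>" 1]
    by (auto simp: Fk_def norm_mult indicator_def)
  have Gb: "norm (G n w) \<le> real k * indicator (cball 0 (real k + 1)) w" for n w
    using g(2)[of n w] cutoff_bounds[of k w] cutoff_outside[of k w] kpos
      mult_mono[of "norm (g n w)" "real k" "\<bar>cutoff k w\<bar>" 1]
    by (auto simp: G_def norm_mult indicator_def)
  have ind: "integrable lebesgue (\<lambda>w. real k * indicator (cball (0::complex) (real k + 1)) w :: real)"
    by (intro integrable_mult_right integrable_real_indicator) (auto simp: emeasure_cball)
  have Fki: "integrable lebesgue (Fk k)"
    by (rule Bochner_Integration.integrable_bound[OF F]) (use Fk_le in auto)
  have Gi: "integrable lebesgue (G n)" for n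
    by (rule Bochner_Integration.integrable_bound[OF ind])
       (use Gb[of n] in \<open>auto intro!: AE_I2 simp: kpos less_imp_le\<close>)
  have "(\<lambda>n. LINT w|lebesgue. norm (Fk k w - G n w)) \<longlonglongrightarrow> (LINT w|(lebesgue :: complex measure). 0)"
  proof (rule integral_dominated_convergence[where w = "\<lambda>w. 2 * (real k * indicator (cball 0 (real k + 1)) w)"])
    show "integrable lebesgue (\<lambda>w. 2 * (real k * indicator (cball (0::complex) (real k + 1)) w) :: real)"
      using ind by (rule integrable_mult_right)
    show "AE w in lebesgue. (\<lambda>n. norm (Fk k w - G n w)) \<longlonglongrightarrow> 0"
      using g(3)
    proof eventually_elim
      case (elim w)
      have "(\<lambda>n. norm (Fk k w - G n w)) \<longlonglongrightarrow> norm (Fk k w - radial_clamp (real k) (F w) * of_real (cutoff k w))"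
        unfolding G_def by (intro tendsto_intros elim)
      then show ?case by (simp add: Fk_def)
    qed
    show "AE w in lebesgue. norm (norm (Fk k w - G n w)) \<le> 2 * (real k * indicator (cball 0 (real k + 1)) w)" for n
    proof (intro AE_I2)
      fix w :: complex
      show "norm (norm (Fk k w - G n w)) \<le> 2 * (real k * indicator (cball 0 (real k + 1)) w)"
        using norm_triangle_ineq4[of "Fk k w" "G n w"] Fkb[of w] Gb[of n w] by simp
    qed
  qed auto
  then have "(\<lambda>n. LINT w|lebesgue. norm (Fk k w - G n w)) \<longlonglongrightarrow> 0" by simp
  then have "\<forall>\<^sub>F n in sequentially. (LINT w|lebesgue. norm (Fk k w - G n w)) < e / 2"
    using e by (intro order_tendstoD) auto
  then obtain n where n: "(LINT w|lebesgue. norm (Fk k w - G n w)) < e / 2"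
    by (auto simp: eventually_sequentially)
  show thesis
  proof (rule that[of "G n" "real k + 1"])
    show "G n w = 0" if "norm w \<ge> real k + 1" for w
      using cutoff_outside[OF that] by (simp add: G_def)
    have "(LINT w|lebesgue. norm (F w - G n w))
        \<le> (LINT w|lebesgue. norm (F w - Fk k w) + norm (Fk k w - G n w))"
      using F Fki Gi[of n]
      by (intro integral_mono) (auto intro: norm_diff_triangle_le)
    also have "\<dots> < e"
      using F Fki Gi[of n] k n by (subst Bochner_Integration.integral_add) auto
    finally show "(LINT w|lebesgue. norm (F w - G n w)) < e" .
  qed (auto intro: Gc Gi)
qed

text \<open>The character \<open>w \<mapsto> exp (2 i Im (\<zeta> w))\<close> of the plane. In this form it factors into a part that
is entire in \<open>\<zeta>\<close> and a part that is conjugate entire in \<open>\<zeta>\<close>.\<close>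

definition osc :: "complex \<Rightarrow> complex \<Rightarrow> complex" where
  "osc \<zeta> w = exp (\<zeta> * w - cnj (\<zeta> * w))"

lemma norm_osc [simp]: "norm (osc \<zeta> w) = 1"
  by (simp add: osc_def)

lemma continuous_osc [continuous_intros]: "continuous_on S (osc \<zeta>)"
  unfolding osc_def[abs_def] by (intro continuous_intros)

text \<open>Translation by half a period changes the sign of the character. Averaging an integral with its
translate therefore produces cancellation, and the half period shrinks as \<open>\<zeta>\<close> grows.\<close>

lemma osc_half_period:
  assumes "\<zeta> \<noteq> 0"
  shows "osc \<zeta> (w + \<i> * of_real pi / (2 * \<zeta>)) = - osc \<zeta> w"
proof -
  have "\<zeta> * (w + \<i> * of_real pi / (2 * \<zeta>)) = \<zeta> * w + \<i> * of_real pi / 2"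
    using assms by (simp add: field_simps)
  then have "osc \<zeta> (w + \<i> * of_real pi / (2 * \<zeta>))
      = exp (\<zeta> * w + \<i> * of_real pi / 2 - cnj (\<zeta> * w + \<i> * of_real pi / 2))"
    unfolding osc_def by (simp only:)
  moreover have eq: "\<zeta> * w + \<i> * of_real pi / 2 - cnj (\<zeta> * w + \<i> * of_real pi / 2)
      = (\<zeta> * w - cnj (\<zeta> * w)) + \<i> * of_real pi"
    by (simp add: algebra_simps)
  moreover have "exp ((\<zeta> * w - cnj (\<zeta> * w)) + \<i> * of_real pi) = - osc \<zeta> w"
    unfolding osc_def by (subst exp_add) (simp add: mult.commute)
  ultimately show ?thesis by (simp only:)
qed

lemma integral_lborel_shift:
  fixes f :: "complex \<Rightarrow> complex"
  assumes "f \<in> borel_measurable borel"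
  shows "(LINT w|lborel. f (c + w)) = (LINT w|lborel. f w)"
  using integral_distr[of "(+) c" lborel borel f] assms lborel_distr_plus[of c] by simp

text \<open>For a continuous \<open>G\<close> of compact support, twice the integral equals the integral of
\<open>G w - G (\<tau> + w)\<close> against the character, where \<open>\<tau>\<close> is the half period; this is small by uniform
continuity. The general case follows by approximation in $L^1$.\<close>

lemma Riemann_Lebesgue:
  fixes F :: "complex \<Rightarrow> complex"
  assumes F: "integrable lebesgue F"
  shows "((\<lambda>\<zeta>. LINT w|lebesgue. F w * osc \<zeta> w) \<longlongrightarrow> 0) at_infinity"
  unfolding Lim_at_infinity
proof (intro allI impI)
  fix e :: real assume e: "e > 0"
  then have e2: "e / 2 > 0" by simp
  obtain G R where Gc: "continuous_on UNIV G" and G0: "\<And>w. norm w \<ge> R \<Longrightarrow> G w = 0"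
    and Gi: "integrable lebesgue G" and FG: "(LINT w|lebesgue. norm (F w - G w)) < e / 2"
    using L1_approx_by_compact_support[OF F e2] by blast
  define S where "S = cball (0::complex) (\<bar>R\<bar> + 1)"
  have uc: "uniformly_continuous_on (cball (0::complex) (\<bar>R\<bar> + 2)) G"
    using Gc by (intro compact_uniformly_continuous) (auto intro: continuous_on_subset)
  define d where "d = e / (2 * measure lborel S + 1)"
  have d: "d > 0" unfolding d_def using e by (intro divide_pos_pos add_nonneg_pos) auto
  obtain \<delta> where \<delta>: "\<delta> > 0" and uc\<delta>: "\<And>x y. x \<in> cball 0 (\<bar>R\<bar> + 2) \<Longrightarrow> y \<in> cball 0 (\<bar>R\<bar> + 2) \<Longrightarrow>
       dist x y < \<delta> \<Longrightarrow> dist (G x) (G y) < d"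
    using uc d unfolding uniformly_continuous_on_def by metis
  \<comment> \<open>The bound 1 keeps the translated support inside the larger disk.\<close>
  define \<eta> where "\<eta> = min 1 \<delta>"
  have \<eta>: "\<eta> > 0" using \<delta> by (simp add: \<eta>_def)
  have Gm[measurable]: "G \<in> borel_measurable borel"
    using Gc by (rule borel_measurable_continuous_onI)
  have oscm[measurable]: "osc \<zeta> \<in> borel_measurable borel" for \<zeta>
    by (intro borel_measurable_continuous_onI continuous_intros)
  have osclm[measurable]: "osc \<zeta> \<in> borel_measurable lebesgue" for \<zeta>
    by (intro measurable_cont_lebesgue continuous_intros)
  have Gil: "integrable lborel G"
    using Gi by (simp add: integrable_completion)
  show "\<exists>B. \<forall>\<zeta>. B \<le> norm \<zeta> \<longrightarrow> dist (LINT w|lebesgue. F w * osc \<zeta> w) 0 < e"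
  proof (intro exI[of _ "pi / \<eta>"] allI impI)
    fix \<zeta> :: complex assume z: "pi / \<eta> \<le> norm \<zeta>"
    have "0 < pi / \<eta>" using \<eta> by simp
    then have z0: "\<zeta> \<noteq> 0" using z by auto
    define \<tau> where "\<tau> = \<i> * of_real pi / (2 * \<zeta>)"
    have "norm \<tau> = pi / (2 * norm \<zeta>)" by (simp add: \<tau>_def norm_divide norm_mult)
    also have "\<dots> < \<eta>" 
    proof -
      have "pi \<le> norm \<zeta> * \<eta>" using z \<eta> by (simp add: field_simps)
      moreover have "0 < norm \<zeta> * \<eta>" using z0 \<eta> by simp
      ultimately have "pi < 2 * (norm \<zeta> * \<eta>)" by linarith
      then show ?thesis using z0 by (simp add: field_simps)
    qed
    finally have \<tau>: "norm \<tau> < \<eta>" .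
    have shift_i: "integrable lborel (\<lambda>w. G (\<tau> + w))"
      using integrable_distr_eq[of "(+) \<tau>" lborel borel G] Gil lborel_distr_plus[of \<tau>] by simp
    have Gz: "integrable lborel (\<lambda>w. G w * osc \<zeta> w)"
      by (rule Bochner_Integration.integrable_bound[OF Gil]) (auto simp: norm_mult)
    have Gz': "integrable lborel (\<lambda>w. G (\<tau> + w) * osc \<zeta> w)"
      by (rule Bochner_Integration.integrable_bound[OF shift_i]) (auto simp: norm_mult)
    have "(LINT w|lborel. G w * osc \<zeta> w) = (LINT w|lborel. G (\<tau> + w) * osc \<zeta> (\<tau> + w))"
      by (rule integral_lborel_shift[symmetric]) simp
    also have "\<dots> = - (LINT w|lborel. G (\<tau> + w) * osc \<zeta> w)"
      using osc_half_period[OF z0] by (simp add: \<tau>_def add.commute)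
    finally have "2 * (LINT w|lborel. G w * osc \<zeta> w)
        = (LINT w|lborel. G w * osc \<zeta> w) - (LINT w|lborel. G (\<tau> + w) * osc \<zeta> w)" by simp
    also have "\<dots> = (LINT w|lborel. (G w - G (\<tau> + w)) * osc \<zeta> w)"
      using Gz Gz' by (simp add: left_diff_distrib)
    finally have two: "2 * (LINT w|lborel. G w * osc \<zeta> w) = (LINT w|lborel. (G w - G (\<tau> + w)) * osc \<zeta> w)" .
    have pw: "norm ((G w - G (\<tau> + w)) * osc \<zeta> w) \<le> d * indicator S w" for w
    proof (cases "w \<in> S")
      case True
      have "norm (\<tau> + w) \<le> \<bar>R\<bar> + 2"
        using True \<tau> norm_triangle_ineq[of \<tau> w] by (auto simp: S_def \<eta>_def)
      moreover have "norm (- \<tau> - w) = norm (\<tau> + w)"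
        using norm_minus_cancel[of "\<tau> + w"] by simp
      ultimately have "dist (G w) (G (\<tau> + w)) < d"
        using True \<tau> by (intro uc\<delta>) (simp_all add: S_def dist_norm \<eta>_def)
      then show ?thesis using True by (simp add: dist_norm norm_mult)
    next
      case False
      then have w: "norm w > \<bar>R\<bar> + 1" by (simp add: S_def)
      have "norm w \<le> norm (\<tau> + w) + norm \<tau>"
        using norm_triangle_ineq4[of "\<tau> + w" \<tau>] by simp
      moreover have "norm \<tau> < 1" using \<tau> by (simp add: \<eta>_def)
      ultimately have "norm (\<tau> + w) \<ge> R" using w by linarith
      moreover have "norm w \<ge> R" using w by linarith
      ultimately show ?thesis using G0 d by simp
    qed
    have indS: "integrable lborel (\<lambda>w. d * indicator S w :: real)"
      by (intro integrable_mult_right integrable_real_indicator) (auto simp: S_def emeasure_cball)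
    have "norm (LINT w|lborel. (G w - G (\<tau> + w)) * osc \<zeta> w) \<le> (LINT w|lborel. d * indicator S w)"
      using pw by (intro Bochner_Integration.integral_norm_bound_integral[OF _ indS])
         (auto intro!: Bochner_Integration.integrable_bound[OF indS] AE_I2 simp: d less_imp_le)
    also have "\<dots> = d * measure lborel S" by simp
    also have "\<dots> \<le> e / 2 * 1"
    proof -
      have "2 * measure lborel S / (2 * measure lborel S + 1) \<le> 1"
        by (subst pos_divide_le_eq) (auto intro: add_nonneg_pos)
      then have "e / 2 * (2 * measure lborel S / (2 * measure lborel S + 1)) \<le> e / 2 * 1"
        using e by (intro mult_left_mono) auto
      then show ?thesis by (simp add: d_def field_simps)
    qed
    finally have "norm (2 * (LINT w|lborel. G w * osc \<zeta> w)) \<le> e / 2" using two by simp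
    then have Gs: "norm (LINT w|lborel. G w * osc \<zeta> w) \<le> e / 4" by (simp add: norm_mult)
    have Fz: "integrable lebesgue (\<lambda>w. F w * osc \<zeta> w)"
      by (rule Bochner_Integration.integrable_bound[OF F]) (use F in \<open>auto simp: norm_mult\<close>)
    have Gzl: "integrable lebesgue (\<lambda>w. G w * osc \<zeta> w)"
      using Gz by (simp add: integrable_completion)
    have "(LINT w|lebesgue. F w * osc \<zeta> w) = (LINT w|lebesgue. (F w - G w) * osc \<zeta> w) + (LINT w|lebesgue. G w * osc \<zeta> w)"
      using Fz Gzl by (simp add: left_diff_distrib)
    moreover have "norm (LINT w|lebesgue. (F w - G w) * osc \<zeta> w) \<le> (LINT w|lebesgue. norm (F w - G w))"
      by (rule order_trans[OF integral_norm_bound]) (simp add: norm_mult)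
    moreover have "(LINT w|lebesgue. G w * osc \<zeta> w) = (LINT w|lborel. G w * osc \<zeta> w)"
      by (simp add: integral_completion)
    ultimately have "norm (LINT w|lebesgue. F w * osc \<zeta> w) < e"
      using Gs FG e norm_triangle_ineq[of "LINT w|lebesgue. (F w - G w) * osc \<zeta> w" "LINT w|lebesgue. G w * osc \<zeta> w"]
      by simp
    then show "dist (LINT w|lebesgue. F w * osc \<zeta> w) 0 < e" by simp
  qed
qed

section \<open>Normalized area measure and moments\<close>

lemma space_dA [simp]: "space dA = ball 0 1"
  by (simp add: dA_def)

lemma borel_measurable_dA_iff: "f \<in> borel_measurable dA \<longleftrightarrow> f \<in> borel_measurable (lebesgue_on (ball 0 1))"
  by (simp add: dA_def)

lemma ball_lebesgue: "ball (0::complex) 1 \<in> sets lebesgue" "ball (0::complex) 1 \<inter> space lebesgue \<in> sets lebesgue"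
  by auto

lemma borel_measurable_dA_if_borel [measurable (raw)]:
  fixes f :: "complex \<Rightarrow> 'b::real_normed_vector"
  assumes "f \<in> borel_measurable borel"
  shows "f \<in> borel_measurable dA"
proof -
  have "f \<in> borel_measurable lebesgue"
    using assms measurable_completion measurable_lborel2 by blast
  then show ?thesis
    unfolding borel_measurable_dA_iff by (rule measurable_restrict_space1)
qed

lemma borel_measurable_dA_if_continuous:
  fixes f :: "complex \<Rightarrow> 'b::real_normed_vector"
  assumes "continuous_on UNIV f"
  shows "f \<in> borel_measurable dA"
  by (rule borel_measurable_dA_if_borel) (rule borel_measurable_continuous_onI[OF assms])

lemma integrable_dA_iff:
  fixes f :: "complex \<Rightarrow> 'b::{banach, second_countable_topology}"
  shows "integrable dA f \<longleftrightarrow> integrable lebesgue (\<lambda>w. indicator (ball 0 1) w *\<^sub>R f w)"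
proof (cases "f \<in> borel_measurable (lebesgue_on (ball 0 1))")
  case True
  have "integrable dA f \<longleftrightarrow> integrable (lebesgue_on (ball 0 1)) (\<lambda>w. (1 / pi) *\<^sub>R f w)"
    unfolding dA_def by (rule integrable_density[OF True]) auto
  also have "\<dots> \<longleftrightarrow> integrable (lebesgue_on (ball 0 1)) f"
  proof
    assume "integrable (lebesgue_on (ball 0 1)) (\<lambda>w. (1 / pi) *\<^sub>R f w)"
    then have "integrable (lebesgue_on (ball 0 1)) (\<lambda>w. pi *\<^sub>R (1 / pi) *\<^sub>R f w)"
      by (rule integrable_scaleR_right)
    then show "integrable (lebesgue_on (ball 0 1)) f" by simp
  qed (rule integrable_scaleR_right)
  also have "\<dots> \<longleftrightarrow> integrable lebesgue (\<lambda>w. indicator (ball 0 1) w *\<^sub>R f w)"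
    using integrable_restrict_space[OF ball_lebesgue(2), of f] .
  finally show ?thesis .
next
  case False
  then have "\<not> integrable dA f"
    using borel_measurable_dA_iff borel_measurable_integrable by metis
  moreover have "\<not> integrable (lebesgue_on (ball 0 1)) f"
    using False borel_measurable_integrable by metis
  ultimately show ?thesis
    by (simp add: integrable_restrict_space[OF ball_lebesgue(2), of f])
qed

lemma integral_dA:
  fixes f :: "complex \<Rightarrow> 'b::{banach, second_countable_topology}"
  assumes "integrable dA f"
  shows "(LINT w|dA. f w) = (1 / pi) *\<^sub>R (LINT w|lebesgue. indicator (ball 0 1) w *\<^sub>R f w)"
proof -
  have m: "f \<in> borel_measurable (lebesgue_on (ball 0 1))"
    using assms borel_measurable_dA_iff borel_measurable_integrable by metis
  have "(LINT w|dA. f w) = (LINT w|lebesgue_on (ball 0 1). (1 / pi) *\<^sub>R f w)"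
    unfolding dA_def by (rule integral_density[OF m]) auto
  then show ?thesis
    using integral_restrict_space[OF ball_lebesgue(2), of f] by simp
qed

lemma AE_dA: "(AE w in dA. P w) \<longleftrightarrow> (AE w in lebesgue. w \<in> ball 0 1 \<longrightarrow> P w)"
proof -
  have "(AE w in dA. P w) \<longleftrightarrow> (AE w in lebesgue_on (ball 0 1). P w)"
    unfolding dA_def by (subst AE_density) auto
  then show ?thesis by (simp add: AE_restrict_space_iff)
qed

lemma AE_dA_I: "(\<And>w. norm w < 1 \<Longrightarrow> P w) \<Longrightarrow> AE w in dA. P w"
  by (rule AE_I2) simp

lemma integrable_dA_mult_bounded:
  fixes F g :: "complex \<Rightarrow> complex"
  assumes F: "integrable dA F" and g: "g \<in> borel_measurable dA" and b: "\<And>w. norm w < 1 \<Longrightarrow> norm (g w) \<le> b"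
  shows "integrable dA (\<lambda>w. F w * g w)"
proof (rule Bochner_Integration.integrable_bound)
  show "integrable dA (\<lambda>w. b * norm (F w))" using F by auto
  show "(\<lambda>w. F w * g w) \<in> borel_measurable dA" using F g by auto
  show "AE w in dA. norm (F w * g w) \<le> norm (b * norm (F w))"
  proof (rule AE_dA_I)
    fix w :: complex assume "norm w < 1"
    then have "norm (F w) * norm (g w) \<le> norm (F w) * b" by (intro mult_left_mono b) auto
    also have "\<dots> \<le> norm (b * norm (F w))" by (simp add: abs_mult mult.commute mult_right_mono)
    finally show "norm (F w * g w) \<le> norm (b * norm (F w))" by (simp add: norm_mult)
  qed
qed

text \<open>Continuous functions are bounded on the closed disk, hence multipliers of $L^1$.\<close>

lemma integrable_dA_mult_continuous:
  fixes F g :: "complex \<Rightarrow> complex"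
  assumes F: "integrable dA F" and g: "continuous_on UNIV g"
  shows "integrable dA (\<lambda>w. F w * g w)"
proof -
  have "compact (g ` cball 0 1)"
    by (intro compact_continuous_image) (auto intro: continuous_on_subset[OF g])
  then obtain b where "\<And>x. x \<in> g ` cball 0 1 \<Longrightarrow> norm x \<le> b"
    using compact_imp_bounded bounded_iff by metis
  then show ?thesis
    by (intro integrable_dA_mult_bounded[OF F, of _ b] borel_measurable_dA_if_continuous g) auto
qed

definition moment :: "(complex \<Rightarrow> complex) \<Rightarrow> nat \<Rightarrow> nat \<Rightarrow> complex" where
  "moment F i j = (LINT w|dA. F w * w ^ i * cnj w ^ j)"

lemma integrable_moment:
  assumes "integrable dA F"
  shows "integrable dA (\<lambda>w. F w * w ^ i * cnj w ^ j)"
  unfolding mult.assoc by (intro integrable_dA_mult_continuous assms continuous_intros)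

lemma continuous_of_real_polynomial:
  "real_polynomial_function p \<Longrightarrow> continuous_on S (\<lambda>w. complex_of_real (p w))"
  unfolding real_polynomial_function_eq
  by (intro continuous_on_of_real continuous_on_polymonial_function)

text \<open>If all moments of \<open>F\<close> vanish, then so do all moments of \<open>F\<close> times a polynomial in the two real
coordinates. The claim is proved for all such \<open>F\<close> simultaneously: then the case of a product of two
polynomials is the claim for one factor applied to \<open>F\<close> times the other, and only linear forms, which
are combinations of \<open>w\<close> and \<open>cnj w\<close>, need a computation.\<close>

lemma moments_zero_mult_real_polynomial:
  assumes "real_polynomial_function \<phi>"
  shows "integrable dA F \<Longrightarrow> (\<And>i j. moment F i j = 0) \<Longrightarrow> moment (\<lambda>w. F w * of_real (\<phi> w)) i j = 0"
  using assms
proof (induction \<phi> arbitrary: F i j rule: real_polynomial_function.induct)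
  case (linear \<phi>)
  note prems = linear.prems
  define \<alpha> \<beta> :: complex where "\<alpha> = (of_real (\<phi> 1) - \<i> * of_real (\<phi> \<i>)) / 2"
    and "\<beta> = (of_real (\<phi> 1) + \<i> * of_real (\<phi> \<i>)) / 2"
  interpret bounded_linear \<phi> by fact
  have \<phi>_eq: "\<phi> w = Re w * \<phi> 1 + Im w * \<phi> \<i>" for w
  proof -
    have "w = Re w *\<^sub>R 1 + Im w *\<^sub>R \<i>" by (simp add: complex_eq_iff)
    then have "\<phi> w = \<phi> (Re w *\<^sub>R 1 + Im w *\<^sub>R \<i>)" by (rule arg_cong)
    then show ?thesis by (simp only: add scaleR real_scaleR_def)
  qed
  have eq: "of_real (\<phi> w) = \<alpha> * w + \<beta> * cnj w" for w
    by (subst \<phi>_eq[of w]) (simp add: \<alpha>_def \<beta>_def complex_eq_iff field_simps)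
  have "moment (\<lambda>w. F w * of_real (\<phi> w)) i j
      = (LINT w|dA. \<alpha> * (F w * w ^ Suc i * cnj w ^ j) + \<beta> * (F w * w ^ i * cnj w ^ Suc j))"
    unfolding moment_def eq by (rule Bochner_Integration.integral_cong) (auto simp: algebra_simps)
  also have "\<dots> = \<alpha> * moment F (Suc i) j + \<beta> * moment F i (Suc j)"
    unfolding moment_def
    by (subst Bochner_Integration.integral_add)
       (simp_all only: integrable_mult_right integrable_moment[OF prems(1)] integral_mult_right_zero)
  finally show ?case by (simp only: prems(2) mult_zero_right add_0_left)
next
  case (const c)
  have "moment (\<lambda>w. F w * of_real c) i j = of_real c * moment F i j"
    unfolding moment_def by (subst integral_mult_right_zero[symmetric]) (simp add: mult_ac)
  then show ?case by (simp only: const(2) mult_zero_right)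
next
  case (add f g)
  have cf: "continuous_on UNIV (\<lambda>w. complex_of_real (f w))" "continuous_on UNIV (\<lambda>w. complex_of_real (g w))"
    using add.hyps continuous_of_real_polynomial by blast+
  have "moment (\<lambda>w. F w * of_real (f w + g w)) i j
      = (LINT w|dA. (F w * of_real (f w)) * w ^ i * cnj w ^ j + (F w * of_real (g w)) * w ^ i * cnj w ^ j)"
    unfolding moment_def by (rule Bochner_Integration.integral_cong) (auto simp: algebra_simps)
  also have "\<dots> = moment (\<lambda>w. F w * of_real (f w)) i j + moment (\<lambda>w. F w * of_real (g w)) i j"
    unfolding moment_def
    using integrable_moment[OF integrable_dA_mult_continuous[OF add.prems(1) cf(1)]]
      integrable_moment[OF integrable_dA_mult_continuous[OF add.prems(1) cf(2)]]
    by (rule Bochner_Integration.integral_add)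
  finally show ?case
    by (simp only: add.IH(1)[OF add.prems] add.IH(2)[OF add.prems] add_0_left)
next
  case (mult f g)
  have cf: "continuous_on UNIV (\<lambda>w. complex_of_real (f w))"
    using mult.hyps continuous_of_real_polynomial by blast
  have "moment (\<lambda>w. F w * of_real (f w) * of_real (g w)) i j = 0"
    by (rule mult.IH(2)[OF integrable_dA_mult_continuous[OF mult.prems(1) cf] mult.IH(1)[OF mult.prems]])
  then show ?case by (simp add: mult_ac)
qed

text \<open>Stone--Weierstrass on the closed disk, separately for the real and the imaginary part.\<close>

lemma integral_continuous_zero_if_moments_zero:
  assumes F: "integrable dA F" and m: "\<And>i j. moment F i j = 0" and g: "continuous_on UNIV g"
  shows "(LINT w|dA. F w * g w) = 0"
proof -
  have real: "(LINT w|dA. F w * of_real (\<phi> w)) = 0" if \<phi>: "continuous_on UNIV \<phi>" for \<phi> :: "complex \<Rightarrow> real"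
  proof -
    have "norm (LINT w|dA. F w * of_real (\<phi> w)) \<le> 0 + e" if e: "e > 0" for e
    proof -
      define I where "I = (LINT w|dA. norm (F w))"
      have I: "I \<ge> 0" by (simp add: I_def)
      have e': "e / (I + 1) > 0" using e I by simp
      have c: "continuous_on (cball 0 1) \<phi>" using continuous_on_subset[OF \<phi>] by blast
      obtain p where p: "real_polynomial_function p" "\<And>x. x \<in> cball 0 1 \<Longrightarrow> \<bar>\<phi> x - p x\<bar> < e / (I + 1)"
        using Stone_Weierstrass_real_polynomial_function[OF compact_cball c e'] by metis
      have pc: "continuous_on UNIV (\<lambda>w. complex_of_real (p w))"
        using p continuous_of_real_polynomial by blast
      have fc: "continuous_on UNIV (\<lambda>w. complex_of_real (\<phi> w))" by (intro continuous_intros \<phi>)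
      have "(LINT w|dA. F w * of_real (p w)) = 0"
        using moments_zero_mult_real_polynomial[OF p(1) F m, of 0 0] by (simp add: moment_def)
      then have "(LINT w|dA. F w * of_real (\<phi> w)) = (LINT w|dA. F w * of_real (\<phi> w) - F w * of_real (p w))"
        using integrable_dA_mult_continuous[OF F pc] integrable_dA_mult_continuous[OF F fc] by simp
      also have "norm \<dots> \<le> (LINT w|dA. (e / (I + 1)) * norm (F w))"
      proof (rule Bochner_Integration.integral_norm_bound_integral)
        show "integrable dA (\<lambda>w. F w * of_real (\<phi> w) - F w * of_real (p w))"
          using integrable_dA_mult_continuous[OF F pc] integrable_dA_mult_continuous[OF F fc] by auto
        show "integrable dA (\<lambda>w. (e / (I + 1)) * norm (F w))" using F by auto
        fix w assume w: "w \<in> space dA"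
        have "norm (F w * of_real (\<phi> w) - F w * of_real (p w)) = norm (F w) * \<bar>\<phi> w - p w\<bar>"
          by (simp flip: right_diff_distrib of_real_diff add: norm_mult)
        also have "\<dots> \<le> norm (F w) * (e / (I + 1))"
          using p(2)[of w] w by (intro mult_left_mono) auto
        finally show "norm (F w * of_real (\<phi> w) - F w * of_real (p w)) \<le> (e / (I + 1)) * norm (F w)"
          by (simp only: mult.commute)
      qed
      also have "\<dots> = e * (I / (I + 1))" by (simp add: I_def)
      also have "\<dots> \<le> e * 1" using I e by (intro mult_left_mono) auto
      finally show ?thesis by simp
    qed
    then have "norm (LINT w|dA. F w * of_real (\<phi> w)) \<le> 0" by (rule field_le_epsilon)
    then show ?thesis by simp
  qed
  have c: "continuous_on UNIV (\<lambda>w. Re (g w))" "continuous_on UNIV (\<lambda>w. Im (g w))"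
    by (intro continuous_intros g)+
  have i: "integrable dA (\<lambda>w. F w * of_real (Re (g w)))" "integrable dA (\<lambda>w. F w * of_real (Im (g w)))"
    by (intro integrable_dA_mult_continuous F continuous_intros c)+
  have "(LINT w|dA. F w * g w) = (LINT w|dA. F w * of_real (Re (g w)) + \<i> * (F w * of_real (Im (g w))))"
    by (rule Bochner_Integration.integral_cong) (auto simp: complex_eq_iff algebra_simps)
  also have "\<dots> = (LINT w|dA. F w * of_real (Re (g w))) + \<i> * (LINT w|dA. F w * of_real (Im (g w)))"
    using i by (subst Bochner_Integration.integral_add) auto
  finally show ?thesis using real[OF c(1)] real[OF c(2)] by simp
qed

text \<open>The integral of \<open>F\<close> against continuous approximations of \<open>cnj (sgn F)\<close> tends to the integral of
\<open>norm F\<close>.\<close>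

lemma AE_zero_if_moments_zero:
  assumes F: "integrable dA F" and m: "\<And>i j. moment F i j = 0"
  shows "AE w in dA. F w = 0"
proof -
  define s where "s w = cnj (sgn (indicator (ball 0 1) w *\<^sub>R F w))" for w
  have Fi: "(\<lambda>w. indicator (ball 0 1) w *\<^sub>R F w) \<in> borel_measurable lebesgue"
    using F unfolding integrable_dA_iff by (rule borel_measurable_integrable)
  have sm: "s \<in> borel_measurable lebesgue"
  proof -
    have "cnj \<in> borel_measurable borel"
      by (intro borel_measurable_continuous_onI continuous_intros)
    moreover have "(sgn :: complex \<Rightarrow> complex) \<in> borel_measurable borel"
      unfolding sgn_div_norm[abs_def] by measurable
    ultimately have "(\<lambda>z. cnj (sgn z)) \<in> borel_measurable borel"
      by (rule measurable_compose[rotated])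
    from measurable_compose[OF Fi this] show ?thesis by (simp add: s_def[abs_def])
  qed
  have sb: "norm (s w) \<le> 1" for w
    by (simp add: s_def norm_sgn)
  have one: "(0::real) < 1" by simp
  obtain g where g: "\<And>n::nat. continuous_on UNIV (g n)" "\<And>n x. norm (g n x) \<le> 1"
    "AE x in lebesgue. (\<lambda>n. g n x) \<longlonglongrightarrow> s x"
    using bounded_measurable_ae_limit_continuous[OF sm one sb] by blast
  have smd: "s \<in> borel_measurable dA"
    unfolding borel_measurable_dA_iff by (rule measurable_restrict_space1[OF sm])
  have gm: "g n \<in> borel_measurable dA" for n
    by (rule borel_measurable_dA_if_continuous[OF g(1)])
  have "(\<lambda>n. LINT w|dA. F w * g n w) \<longlonglongrightarrow> (LINT w|dA. F w * s w)"
  proof (rule integral_dominated_convergence[where w = "\<lambda>w. norm (F w)"])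
    show "AE x in dA. (\<lambda>n. F x * g n x) \<longlonglongrightarrow> F x * s x"
      unfolding AE_dA using g(3) by eventually_elim (intro impI tendsto_mult_left)
    show "AE x in dA. norm (F x * g n x) \<le> norm (F x)" for n
      using g(2)[of n] by (auto simp: norm_mult intro!: AE_I2 mult_right_le_one_le)
  qed (use F gm smd in auto)
  then have "(\<lambda>n::nat. 0) \<longlonglongrightarrow> (LINT w|dA. F w * s w)"
    using integral_continuous_zero_if_moments_zero[OF F m g(1)] by simp
  then have "(LINT w|dA. F w * s w) = 0" by (simp add: LIMSEQ_const_iff)
  moreover have "(LINT w|dA. F w * s w) = (LINT w|dA. of_real (norm (F w)))"
  proof (rule Bochner_Integration.integral_cong)
    fix w assume "w \<in> space dA"
    then have "s w = cnj (F w) / of_real (norm (F w))" by (simp add: s_def sgn_eq)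
    moreover have "F w * cnj (F w) = of_real (norm (F w)) * of_real (norm (F w))"
      using complex_norm_square[of "F w"] by (simp only: power2_eq_square of_real_mult)
    ultimately show "F w * s w = of_real (norm (F w))" by simp
  qed simp
  ultimately have "(LINT w|dA. norm (F w)) = 0" by simp
  then have "AE w in dA. norm (F w) = 0"
    using F by (subst (asm) integral_nonneg_eq_0_iff_AE) auto
  then show ?thesis by simp
qed

text \<open>Term by term integration, in the form needed for the expansions of \<open>exp (\<zeta> * w)\<close> and of the Bergman
kernel in powers of \<open>w\<close> or \<open>cnj w\<close>, whose absolute values are at most 1 on the disk.\<close>

lemma sums_integral_dA:
  fixes G :: "complex \<Rightarrow> complex"
  assumes G: "integrable dA G" and \<phi>: "\<And>n. continuous_on UNIV (\<phi> n)"
    and le: "\<And>n w. norm w < 1 \<Longrightarrow> norm (\<phi> n w) \<le> 1" and c: "summable (\<lambda>n. norm (c n))"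
  shows "(\<lambda>n. c n * (LINT w|dA. G w * \<phi> n w)) sums (LINT w|dA. G w * (\<Sum>n. c n * \<phi> n w))"
proof -
  have Gi: "integrable dA (\<lambda>w. G w * \<phi> n w)" for n
    by (rule integrable_dA_mult_continuous[OF G \<phi>])
  have leG: "norm (G w * \<phi> n w) \<le> norm (G w)" if "norm w < 1" for w n
    using le[OF that, of n] by (simp add: norm_mult mult_right_le_one_le)
  have "(\<lambda>n. LINT w|dA. c n * (G w * \<phi> n w)) sums (LINT w|dA. (\<Sum>n. c n * (G w * \<phi> n w)))"
  proof (rule sums_integral)
    show "integrable dA (\<lambda>w. c n * (G w * \<phi> n w))" for n using Gi by auto
    show "AE w in dA. summable (\<lambda>n. norm (c n * (G w * \<phi> n w)))"
    proof (rule AE_dA_I)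
      fix w :: complex assume w: "norm w < 1"
      show "summable (\<lambda>n. norm (c n * (G w * \<phi> n w)))"
        using leG[OF w] 
        by (intro summable_comparison_test'[OF summable_mult2[OF c, of "norm (G w)"]])
           (auto simp: norm_mult intro!: mult_left_mono)
    qed
    show "summable (\<lambda>n. LINT w|dA. norm (c n * (G w * \<phi> n w)))"
    proof (rule summable_comparison_test'[OF summable_mult2[OF c, of "LINT w|dA. norm (G w)"]])
      fix n :: nat
      have "(LINT w|dA. norm (c n * (G w * \<phi> n w))) \<le> (LINT w|dA. norm (c n) * norm (G w))"
      proof (rule integral_mono)
        show "integrable dA (\<lambda>w. norm (c n * (G w * \<phi> n w)))"
          by (intro integrable_norm integrable_mult_right Gi)
        show "integrable dA (\<lambda>w. norm (c n) * norm (G w))"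
          using G by auto
        show "norm (c n * (G w * \<phi> n w)) \<le> norm (c n) * norm (G w)" if "w \<in> space dA" for w
          using leG[of w n] that unfolding norm_mult[of "c n"] by (intro mult_left_mono) auto
      qed
      then show "norm (LINT w|dA. norm (c n * (G w * \<phi> n w))) \<le> norm (c n) * (LINT w|dA. norm (G w))"
        by simp
    qed
  qed
  moreover have "(LINT w|dA. (\<Sum>n. c n * (G w * \<phi> n w))) = (LINT w|dA. G w * (\<Sum>n. c n * \<phi> n w))"
  proof (rule Bochner_Integration.integral_cong)
    fix w assume "w \<in> space dA"
    then have w: "norm w < 1" by simp
    have "summable (\<lambda>n. c n * \<phi> n w)"
      using le[OF w] by (intro summable_comparison_test'[OF c])
        (auto simp: norm_mult intro!: mult_right_le_one_le)
    then show "(\<Sum>n. c n * (G w * \<phi> n w)) = G w * (\<Sum>n. c n * \<phi> n w)"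
      by (subst suminf_mult[symmetric]) (auto simp: mult_ac)
  qed simp
  ultimately show ?thesis by simp
qed

section \<open>Moment matrices of finite rank\<close>

text \<open>Determinants indexed by plain functions: in the argument below a submatrix is specified by
sequences of row and column indices, and its size is only known after a maximal choice.\<close>

definition det_fun :: "nat \<Rightarrow> (nat \<Rightarrow> nat \<Rightarrow> complex) \<Rightarrow> complex" where
  "det_fun r f = Determinant.det (mat r r (\<lambda>(s, t). f s t))"

lemma det_fun_expand:
  "det_fun r f = (\<Sum>p | p permutes {0..<r}. signof p * (\<Prod>i = 0..<r. f i (p i)))"
proof -
  have "p i < r" if "p permutes {0..<r}" "i < r" for p i
    using that permutes_in_image[of p "{0..<r}" i] by auto
  then show ?thesis
    unfolding det_fun_def by (subst Determinant.det_def'[of _ r]) (auto intro!: sum.cong prod.cong)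
qed

lemma det_fun_transpose: "det_fun r (\<lambda>s t. f t s) = det_fun r f"
proof -
  have "mat r r (\<lambda>(s, t). f t s) = transpose_mat (mat r r (\<lambda>(s, t). f s t))"
    by (intro eq_matI) auto
  then show ?thesis
    unfolding det_fun_def by (simp add: Determinant.det_transpose[of _ r])
qed

lemma det_fun_mult: "det_fun r (\<lambda>i j. \<Sum>t<r. f i t * g t j) = det_fun r f * det_fun r g"
proof -
  have "mat r r (\<lambda>(i, j). \<Sum>t<r. f i t * g t j) = mat r r (\<lambda>(s, t). f s t) * mat r r (\<lambda>(s, t). g s t)"
    by (intro eq_matI) (auto simp: scalar_prod_def atLeast0LessThan)
  then show ?thesis
    unfolding det_fun_def by (simp add: Determinant.det_mult[of _ r])
qed

lemma det_fun_eq_0_iff: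
  "det_fun r f = 0 \<longleftrightarrow> (\<exists>v. (\<exists>t<r. v t \<noteq> 0) \<and> (\<forall>s<r. (\<Sum>t<r. f s t * v t) = 0))"
proof -
  let ?A = "mat r r (\<lambda>(s, t). f s t)"
  have "det_fun r f = 0 \<longleftrightarrow> (\<exists>v. v \<in> carrier_vec r \<and> v \<noteq> 0\<^sub>v r \<and> ?A *\<^sub>v v = 0\<^sub>v r)"
    unfolding det_fun_def by (rule det_0_iff_vec_prod_zero) auto
  also have "\<dots> \<longleftrightarrow> (\<exists>v. (\<exists>t<r. v t \<noteq> 0) \<and> (\<forall>s<r. (\<Sum>t<r. f s t * v t) = 0))"
  proof
    assume "\<exists>v. v \<in> carrier_vec r \<and> v \<noteq> 0\<^sub>v r \<and> ?A *\<^sub>v v = 0\<^sub>v r"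
    then obtain v where v: "v \<in> carrier_vec r" "v \<noteq> 0\<^sub>v r" "?A *\<^sub>v v = 0\<^sub>v r" by blast
    have nz: "\<exists>t<r. vec_index v t \<noteq> 0"
    proof (rule ccontr)
      assume "\<not> (\<exists>t<r. vec_index v t \<noteq> 0)"
      then have "v = 0\<^sub>v r" using v(1) by (intro eq_vecI) auto
      then show False using v(2) by contradiction
    qed
    have "(\<Sum>t<r. f s t * vec_index v t) = 0" if "s < r" for s
    proof -
      have "vec_index (?A *\<^sub>v v) s = 0" using v(3) that by simp
      then show ?thesis using that v(1) by (simp add: scalar_prod_def atLeast0LessThan)
    qed
    with nz show "\<exists>v. (\<exists>t<r. v t \<noteq> 0) \<and> (\<forall>s<r. (\<Sum>t<r. f s t * v t) = 0)"
      by (intro exI[of _ "vec_index v"]) auto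
  next
    assume "\<exists>v. (\<exists>t<r. v t \<noteq> 0) \<and> (\<forall>s<r. (\<Sum>t<r. f s t * v t) = 0)"
    then obtain v t where v: "t < r" "v t \<noteq> 0" "\<forall>s<r. (\<Sum>t<r. f s t * v t) = 0" by blast
    have "vec r v \<noteq> 0\<^sub>v r"
    proof
      assume "vec r v = 0\<^sub>v r"
      then have "vec_index (vec r v) t = vec_index (0\<^sub>v r) t" by simp
      then show False using v by simp
    qed
    moreover have "?A *\<^sub>v vec r v = 0\<^sub>v r"
      using v(3) by (intro eq_vecI) (auto simp: scalar_prod_def atLeast0LessThan)
    ultimately show "\<exists>v. v \<in> carrier_vec r \<and> v \<noteq> 0\<^sub>v r \<and> ?A *\<^sub>v v = 0\<^sub>v r"
      by (intro exI[of _ "vec r v"]) auto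
  qed
  finally show ?thesis .
qed

lemma det_fun_left_inverse:
  assumes "det_fun r f \<noteq> 0"
  obtains C where "\<And>t t'. t < r \<Longrightarrow> t' < r \<Longrightarrow> (\<Sum>s<r. C t s * f s t') = (if t = t' then 1 else 0)"
proof -
  let ?A = "mat r r (\<lambda>(s, t). f s t)"
  have "?A \<in> Units (ring_mat TYPE(complex) r ())"
    using assms unfolding det_fun_def by (intro det_non_zero_imp_unit) auto
  then obtain B where B: "B \<in> carrier_mat r r" "B * ?A = 1\<^sub>m r"
    unfolding Units_def ring_mat_def by auto
  show thesis
  proof (rule that[of "\<lambda>t s. B $$ (t, s)"])
    fix t t' assume t: "t < r" "t' < r"
    have "(B * ?A) $$ (t, t') = (if t = t' then 1 else 0)" using B(2) t by simp
    then show "(\<Sum>s<r. B $$ (t, s) * f s t') = (if t = t' then 1 else 0)"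
      using t B(1) by (simp add: scalar_prod_def atLeast0LessThan)
  qed
qed

lemma tendsto_det_fun [tendsto_intros]:
  "(\<And>s t. ((\<lambda>x. f x s t) \<longlongrightarrow> g s t) F) \<Longrightarrow> ((\<lambda>x. det_fun r (f x)) \<longlongrightarrow> det_fun r g) F"
  unfolding det_fun_expand by (intro tendsto_intros)

lemma holomorphic_det_fun:
  "(\<And>s t. (\<lambda>x. f x s t) holomorphic_on S) \<Longrightarrow> (\<lambda>x. det_fun r (f x)) holomorphic_on S"
  unfolding det_fun_expand by (intro holomorphic_intros)

lemma cnj_det_fun: "cnj (det_fun r f) = det_fun r (\<lambda>s t. cnj (f s t))"
  unfolding det_fun_expand by (simp add: sign_def)

lemma det_fun_zero: "r > 0 \<Longrightarrow> det_fun r (\<lambda>s t. 0) = 0"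
  unfolding det_fun_eq_0_iff by (intro exI[of _ "\<lambda>_. 1"]) auto

text \<open>An infinite matrix of finite rank is determined by the rows and columns of a nonsingular square
submatrix of maximal size. Bordering this submatrix by row \<open>a\<close> and column \<open>b\<close> yields a singular
matrix; a vector in its kernel has a nonzero last entry, because the submatrix is nonsingular, and
solving for the entry at \<open>(a, b)\<close> gives the formula. Here \<open>C\<close> is the inverse of the submatrix.\<close>

lemma bounded_rank_skeleton:
  fixes m :: "nat \<Rightarrow> nat \<Rightarrow> complex"
  assumes dep: "\<And>k :: nat \<Rightarrow> nat. \<exists>c. (\<exists>i<N. c i \<noteq> 0) \<and> (\<forall>j. (\<Sum>i<N. c i * m (k i) j) = 0)"
  shows "\<exists>r k l C. det_fun r (\<lambda>s t. m (k s) (l t)) \<noteq> 0 \<and>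
    (\<forall>a b. m a b = (\<Sum>t<r. \<Sum>s<r. m a (l t) * C t s * m (k s) b))"
proof -
  define P where "P r \<longleftrightarrow> (\<exists>k l. det_fun r (\<lambda>s t. m (k s) (l t)) \<noteq> 0)" for r
  have P0: "P 0" unfolding P_def det_fun_expand by simp
  have bound: "r < N" if "P r" for r
  proof (rule ccontr)
    assume "\<not> r < N"
    then have rN: "N \<le> r" by simp
    obtain k l where kl: "det_fun r (\<lambda>s t. m (k s) (l t)) \<noteq> 0" using \<open>P r\<close> P_def by blast
    obtain c i where c: "i < N" "c i \<noteq> 0" "\<forall>j. (\<Sum>i<N. c i * m (k i) j) = 0"
      using dep[of k] by blast
    define v where "v t = (if t < N then c t else 0)" for t
    have "(\<Sum>t<r. m (k t) (l s) * v t) = 0" for s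
    proof -
      have "(\<Sum>t<r. m (k t) (l s) * v t) = (\<Sum>t<N. c t * m (k t) (l s))"
        using rN by (intro sum.mono_neutral_cong_right) (auto simp: v_def mult.commute)
      then show ?thesis using c(3) by simp
    qed
    moreover have "i < r" "v i \<noteq> 0" using c rN by (auto simp: v_def)
    ultimately have "det_fun r (\<lambda>s t. m (k t) (l s)) = 0"
      unfolding det_fun_eq_0_iff by blast
    then show False using kl det_fun_transpose[of r "\<lambda>s t. m (k s) (l t)"] by simp
  qed
  define r where "r = (GREATEST r. P r)"
  have Pr: "P r" unfolding r_def using P0 bound by (intro GreatestI_nat[of P 0 N]) (auto intro: less_imp_le)
  have notP: "\<not> P (Suc r)"
  proof
    assume "P (Suc r)"
    then have "Suc r \<le> r" unfolding r_def
      using bound by (intro Greatest_le_nat[of P _ N]) (auto intro: less_imp_le)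
    then show False by simp
  qed
  obtain k l where kl: "det_fun r (\<lambda>s t. m (k s) (l t)) \<noteq> 0" using Pr P_def by blast
  obtain C where C: "\<And>t t'. t < r \<Longrightarrow> t' < r \<Longrightarrow> (\<Sum>s<r. C t s * m (k s) (l t')) = (if t = t' then 1 else 0)"
    using det_fun_left_inverse[OF kl] by blast
  have "m a b = (\<Sum>t<r. \<Sum>s<r. m a (l t) * C t s * m (k s) b)" for a b
  proof -
    \<comment> \<open>The bordered matrix has size \<open>r + 1\<close>, beyond the maximum.\<close>
    define k' l' where "k' = k(r := a)" and "l' = l(r := b)"
    have "det_fun (Suc r) (\<lambda>s t. m (k' s) (l' t)) = 0"
      using notP unfolding P_def by blast
    then obtain v where v: "\<exists>t<Suc r. v t \<noteq> 0"
      and v0: "\<And>s. s < Suc r \<Longrightarrow> (\<Sum>t<Suc r. m (k' s) (l' t) * v t) = 0"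
      unfolding det_fun_eq_0_iff by blast
    have row: "(\<Sum>t<r. m (k s) (l t) * v t) = - (m (k s) b * v r)" if "s < r" for s
    proof -
      have "(\<Sum>t<r. m (k' s) (l' t) * v t) = (\<Sum>t<r. m (k s) (l t) * v t)"
        using that by (intro sum.cong) (auto simp: k'_def l'_def)
      then show ?thesis using v0[of s] that by (simp add: k'_def l'_def eq_neg_iff_add_eq_0)
    qed
    have last: "(\<Sum>t<r. m a (l t) * v t) = - (m a b * v r)"
    proof -
      have "(\<Sum>t<r. m (k' r) (l' t) * v t) = (\<Sum>t<r. m a (l t) * v t)"
        by (intro sum.cong) (auto simp: k'_def l'_def)
      then show ?thesis using v0[of r] by (simp add: k'_def l'_def eq_neg_iff_add_eq_0)
    qed
    have vt: "v t = - v r * (\<Sum>s<r. C t s * m (k s) b)" if "t < r" for t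
    proof -
      have "v t = (\<Sum>t'<r. (if t = t' then 1 else 0) * v t')"
        using that by (simp add: if_distrib[of "\<lambda>x. x * _"] sum.delta cong: if_cong)
      also have "\<dots> = (\<Sum>t'<r. (\<Sum>s<r. C t s * m (k s) (l t')) * v t')"
        using C[OF that] by (intro sum.cong) auto
      also have "\<dots> = (\<Sum>s<r. C t s * (\<Sum>t'<r. m (k s) (l t') * v t'))"
        unfolding sum_distrib_left sum_distrib_right by (subst sum.swap) (simp add: mult.assoc)
      also have "\<dots> = (\<Sum>s<r. C t s * (- (m (k s) b * v r)))"
        using row by (intro sum.cong) auto
      also have "\<dots> = - v r * (\<Sum>s<r. C t s * m (k s) b)"
        unfolding sum_distrib_left by (intro sum.cong) (auto simp: mult_ac)
      finally show ?thesis .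
    qed
    \<comment> \<open>Otherwise the whole kernel vector would vanish.\<close>
    have vr: "v r \<noteq> 0"
    proof
      assume "v r = 0"
      then have "v t = 0" if "t < Suc r" for t
        using vt[of t] that by (cases "t = r") auto
      then show False using v by blast
    qed
    have "- (m a b * v r) = (\<Sum>t<r. m a (l t) * (- v r * (\<Sum>s<r. C t s * m (k s) b)))"
      unfolding last[symmetric] using vt by (intro sum.cong) auto
    also have "\<dots> = - (v r * (\<Sum>t<r. \<Sum>s<r. m a (l t) * C t s * m (k s) b))"
      unfolding sum_distrib_left sum_negf[symmetric] by (intro sum.cong) (auto simp: mult_ac)
    finally show ?thesis using vr by simp
  qed
  with kl show ?thesis by blast
qed

lemma summable_exp_coeffs: "summable (\<lambda>n. norm (\<zeta> ^ n / fact n :: complex))"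
  using summable_norm_exp[of \<zeta>]
  by (simp add: norm_mult norm_inverse norm_power divide_inverse mult.commute)

lemma suminf_exp: "(\<Sum>n. \<zeta> ^ n / fact n * w ^ n) = exp (\<zeta> * w :: complex)"
  unfolding exp_def by (rule suminf_cong) (simp add: power_mult_distrib scaleR_conv_of_real divide_inverse)

text \<open>The Taylor coefficients of these exponential integrals are moments, so that linear relations between
moments pass to them.\<close>

lemma integral_exp_sums:
  assumes "integrable dA G"
  shows "(\<lambda>n. \<zeta> ^ n / fact n * (LINT w|dA. G w * w ^ n)) sums (LINT w|dA. G w * exp (\<zeta> * w))"
  using sums_integral_dA[OF assms _ _ summable_exp_coeffs[of \<zeta>], of "\<lambda>n w. w ^ n"]
  unfolding suminf_exp by (simp add: norm_power power_le_one continuous_intros)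

lemma integral_exp_cnj_sums:
  assumes "integrable dA G"
  shows "(\<lambda>n. \<zeta> ^ n / fact n * (LINT w|dA. G w * cnj w ^ n)) sums (LINT w|dA. G w * exp (\<zeta> * cnj w))"
  using sums_integral_dA[OF assms _ _ summable_exp_coeffs[of \<zeta>], of "\<lambda>n w. cnj w ^ n"]
  unfolding suminf_exp by (simp add: norm_power power_le_one continuous_intros)

lemma entire_integral_exp:
  assumes G: "integrable dA G"
  shows "(\<lambda>\<zeta>. LINT w|dA. G w * exp (\<zeta> * w)) holomorphic_on UNIV"
proof -
  have "(\<lambda>\<zeta>. LINT w|dA. G w * exp (\<zeta> * w)) holomorphic_on ball 0 r" for r
    by (rule power_series_holomorphic[where a = "\<lambda>n. (LINT w|dA. G w * w ^ n) / fact n"])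
       (use integral_exp_sums[OF G] in \<open>simp add: mult.commute\<close>)
  then have "(\<lambda>\<zeta>. LINT w|dA. G w * exp (\<zeta> * w)) field_differentiable at z" for z
    by (rule holomorphic_on_imp_differentiable_at[of _ "ball 0 (norm z + 1)"]) auto
  then show ?thesis by (simp add: holomorphic_on_def)
qed

text \<open>Luecking's theorem for absolutely continuous measures: if the matrix of moments of an integrable
function has finite rank, then the function vanishes.

Write \<open>A \<zeta> a b\<close> for the moments of \<open>F\<close> times the character \<open>osc \<zeta>\<close>. Since
\<open>osc \<zeta> w = exp (\<zeta> * w) * exp (- cnj \<zeta> * cnj w)\<close>, expanding both exponentials and inserting the
skeleton decomposition of the moment matrix gives \<open>A \<zeta> = E \<zeta> * C * E' \<zeta>\<close>, where the entries of
\<open>E \<zeta>\<close> are entire and those of \<open>E' \<zeta>\<close> are conjugate entire in \<open>\<zeta>\<close>. Take the rows and columns of the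
maximal nonsingular submatrix. The determinant of \<open>A \<zeta>\<close> then has the same absolute value as the
entire function \<open>h \<zeta> = det (E \<zeta>) * det C * cnj (det (E' \<zeta>))\<close>. If the size \<open>r\<close> is positive, this
tends to 0 at infinity by the Riemann--Lebesgue lemma, so that \<open>h\<close> is zero by Liouville's theorem. But
the determinant of \<open>A 0\<close> is that of the nonsingular submatrix. Hence \<open>r = 0\<close> and all moments vanish.\<close>

theorem finite_rank_moment_matrix_imp_zero:
  assumes F: "integrable dA F"
    and dep: "\<And>k :: nat \<Rightarrow> nat. \<exists>c. (\<exists>i<N. c i \<noteq> 0) \<and> (\<forall>j. (\<Sum>i<N. c i * moment F (k i) j) = 0)"
  shows "AE w in dA. F w = 0"
proof -
  obtain r k l C where minor: "det_fun r (\<lambda>s t. moment F (k s) (l t)) \<noteq> 0"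
    and skel: "\<And>a b. moment F a b = (\<Sum>t<r. \<Sum>s<r. moment F a (l t) * C t s * moment F (k s) b)"
    using bounded_rank_skeleton[of N "moment F"] dep by blast
  define E where "E \<zeta> a b = (LINT w|dA. F w * w ^ a * cnj w ^ b * exp (\<zeta> * w))" for \<zeta> a b
  define E' where "E' \<zeta> a b = (LINT w|dA. F w * w ^ a * cnj w ^ b * exp (- cnj \<zeta> * cnj w))" for \<zeta> a b
  define A where "A \<zeta> a b = (LINT w|dA. F w * w ^ a * cnj w ^ b * osc \<zeta> w)" for \<zeta> a b
  have E_sums: "(\<lambda>n. \<zeta> ^ n / fact n * moment F (a + n) b) sums E \<zeta> a b" for \<zeta> a b
  proof -
    have eq: "F w * w ^ (a + n) * cnj w ^ b = F w * w ^ a * cnj w ^ b * w ^ n" for n w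
      by (simp add: power_add)
    show ?thesis
      using integral_exp_sums[OF integrable_moment[OF F, of a b], of \<zeta>]
      unfolding E_def moment_def eq .
  qed
  have E'_sums: "(\<lambda>n. (- cnj \<zeta>) ^ n / fact n * moment F a (b + n)) sums E' \<zeta> a b" for \<zeta> a b
  proof -
    have eq: "F w * w ^ a * cnj w ^ (b + n) = F w * w ^ a * cnj w ^ b * cnj w ^ n" for n w
      by (simp add: power_add)
    show ?thesis
      using integral_exp_cnj_sums[OF integrable_moment[OF F, of a b], of "- cnj \<zeta>"]
      unfolding E'_def moment_def eq .
  qed
  have A_sums: "(\<lambda>n. (- cnj \<zeta>) ^ n / fact n * E \<zeta> a (b + n)) sums A \<zeta> a b" for \<zeta> a b
  proof -
    have i: "integrable dA (\<lambda>w. F w * w ^ a * cnj w ^ b * exp (\<zeta> * w))"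
      by (intro integrable_dA_mult_continuous integrable_moment F continuous_intros)
    have eq: "F w * w ^ a * cnj w ^ b * osc \<zeta> w
        = F w * w ^ a * cnj w ^ b * exp (\<zeta> * w) * exp (- cnj \<zeta> * cnj w)" for w
      by (simp add: osc_def exp_diff exp_minus divide_inverse)
    have eq': "F w * w ^ a * cnj w ^ (b + n) * exp (\<zeta> * w) = F w * w ^ a * cnj w ^ b * exp (\<zeta> * w) * cnj w ^ n" for n w
      by (simp add: power_add)
    show ?thesis
      using integral_exp_cnj_sums[OF i, of "- cnj \<zeta>"]
      unfolding A_def E_def eq eq' .
  qed
  have E_skel: "E \<zeta> a b = (\<Sum>t<r. \<Sum>s<r. E \<zeta> a (l t) * C t s * moment F (k s) b)" for \<zeta> a b
  proof -
    have eq: "(\<Sum>t<r. \<Sum>s<r. \<zeta> ^ n / fact n * moment F (a + n) (l t) * (C t s * moment F (k s) b))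
        = \<zeta> ^ n / fact n * moment F (a + n) b" for n
      unfolding skel[of "a + n" b] sum_distrib_left by (simp only: mult.assoc)
    have "(\<lambda>n. \<Sum>t<r. \<Sum>s<r. \<zeta> ^ n / fact n * moment F (a + n) (l t) * (C t s * moment F (k s) b))
        sums (\<Sum>t<r. \<Sum>s<r. E \<zeta> a (l t) * (C t s * moment F (k s) b))"
      by (intro sums_sum sums_mult2 E_sums)
    then have "(\<lambda>n. \<zeta> ^ n / fact n * moment F (a + n) b)
        sums (\<Sum>t<r. \<Sum>s<r. E \<zeta> a (l t) * (C t s * moment F (k s) b))"
      unfolding eq .
    from sums_unique2[OF E_sums this] show ?thesis by (simp only: mult.assoc)
  qed
  have A_skel: "A \<zeta> a b = (\<Sum>t<r. E \<zeta> a (l t) * (\<Sum>s<r. C t s * E' \<zeta> (k s) b))" for \<zeta> a b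
  proof -
    have eq: "(\<Sum>t<r. \<Sum>s<r. (E \<zeta> a (l t) * C t s) * ((- cnj \<zeta>) ^ n / fact n * moment F (k s) (b + n)))
        = (- cnj \<zeta>) ^ n / fact n * E \<zeta> a (b + n)" for n
      unfolding E_skel[of \<zeta> a "b + n"] sum_distrib_left
      by (intro sum.cong) (simp_all only: mult_ac)
    have "(\<lambda>n. \<Sum>t<r. \<Sum>s<r. (E \<zeta> a (l t) * C t s) * ((- cnj \<zeta>) ^ n / fact n * moment F (k s) (b + n)))
        sums (\<Sum>t<r. \<Sum>s<r. (E \<zeta> a (l t) * C t s) * E' \<zeta> (k s) b)"
      by (intro sums_sum sums_mult E'_sums)
    then have "(\<lambda>n. (- cnj \<zeta>) ^ n / fact n * E \<zeta> a (b + n))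
        sums (\<Sum>t<r. \<Sum>s<r. (E \<zeta> a (l t) * C t s) * E' \<zeta> (k s) b)"
      unfolding eq .
    from sums_unique2[OF A_sums this] show ?thesis by (simp only: mult.assoc sum_distrib_left)
  qed
  define detA where "detA \<zeta> = det_fun r (\<lambda>i j. A \<zeta> (k i) (l j))" for \<zeta>
  define h where "h \<zeta> = det_fun r (\<lambda>i t. E \<zeta> (k i) (l t)) * det_fun r C
      * det_fun r (\<lambda>s j. cnj (E' \<zeta> (k s) (l j)))" for \<zeta>
  have detA: "detA \<zeta> = det_fun r (\<lambda>i t. E \<zeta> (k i) (l t)) * (det_fun r C * det_fun r (\<lambda>s j. E' \<zeta> (k s) (l j)))" for \<zeta>
    unfolding detA_def A_skel det_fun_mult ..
  have norm_h: "norm (h \<zeta>) = norm (detA \<zeta>)" for \<zeta>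
    unfolding h_def detA cnj_det_fun[symmetric] by (simp add: norm_mult)
  have hol: "h holomorphic_on UNIV"
  proof -
    have "(\<lambda>\<zeta>. cnj (E' \<zeta> a b)) holomorphic_on UNIV" for a b
    proof -
      have i: "integrable dA (\<lambda>w. cnj (F w * w ^ a * cnj w ^ b))"
        using integrable_moment[OF F, of a b] by (simp only: complex_integrable_cnj)
      have eq: "cnj (E' \<zeta> a b) = (LINT w|dA. cnj (F w * w ^ a * cnj w ^ b) * exp ((- \<zeta>) * w))" for \<zeta>
        unfolding E'_def Bochner_Integration.integral_cnj[symmetric]
        by (rule Bochner_Integration.integral_cong) (simp_all add: exp_cnj)
      have "(\<lambda>\<zeta>. (\<lambda>\<zeta>. LINT w|dA. cnj (F w * w ^ a * cnj w ^ b) * exp (\<zeta> * w)) (- \<zeta>)) holomorphic_on UNIV"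
        using holomorphic_on_compose_gen[of uminus UNIV, OF _ entire_integral_exp[OF i]]
        by (simp add: o_def holomorphic_intros)
      then show ?thesis unfolding eq .
    qed
    moreover have "(\<lambda>\<zeta>. E \<zeta> a b) holomorphic_on UNIV" for a b
      unfolding E_def by (intro entire_integral_exp integrable_moment F)
    ultimately show ?thesis
      unfolding h_def[abs_def] by (intro holomorphic_intros holomorphic_det_fun)
  qed
  have A_lim: "((\<lambda>\<zeta>. A \<zeta> a b) \<longlongrightarrow> 0) at_infinity" for a b
  proof -
    have i: "integrable dA (\<lambda>w. F w * w ^ a * cnj w ^ b)" by (rule integrable_moment[OF F])
    have "A \<zeta> a b = (1 / pi) *\<^sub>R (LINT w|lebesgue. indicator (ball 0 1) w *\<^sub>R (F w * w ^ a * cnj w ^ b) * osc \<zeta> w)" for \<zeta>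
      unfolding A_def
      by (subst integral_dA) (auto intro!: integrable_dA_mult_continuous[OF i] continuous_osc)
    moreover have "((\<lambda>\<zeta>. (1 / pi) *\<^sub>R (LINT w|lebesgue. indicator (ball 0 1) w *\<^sub>R (F w * w ^ a * cnj w ^ b) * osc \<zeta> w))
        \<longlongrightarrow> (1 / pi) *\<^sub>R 0) at_infinity"
      using i unfolding integrable_dA_iff by (intro tendsto_intros Riemann_Lebesgue)
    ultimately show ?thesis by simp
  qed
  have r0: "r = 0"
  proof (rule ccontr)
    assume "r \<noteq> 0"
    have "(detA \<longlongrightarrow> det_fun r (\<lambda>i j. 0)) at_infinity"
      unfolding detA_def[abs_def] by (intro tendsto_det_fun A_lim)
    then have "(detA \<longlongrightarrow> 0) at_infinity" using det_fun_zero \<open>r \<noteq> 0\<close> by simp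
    then have "((\<lambda>\<zeta>. norm (h \<zeta>)) \<longlongrightarrow> 0) at_infinity"
      unfolding norm_h by (rule tendsto_norm_zero)
    then have "(h \<longlongrightarrow> 0) at_infinity" by (rule tendsto_norm_zero_cancel)
    then have "h 0 = 0" using Liouville_weak[OF hol] by blast
    then have "detA 0 = 0" using norm_h[of 0] by simp
    moreover have "detA 0 = det_fun r (\<lambda>s t. moment F (k s) (l t))"
      unfolding detA_def A_def moment_def osc_def by simp
    ultimately show False using minor by simp
  qed
  have "moment F a b = 0" for a b using skel[of a b] r0 by simp
  then show ?thesis by (rule AE_zero_if_moments_zero[OF F])
qed

section \<open>Integration of quasihomogeneous functions\<close>

definition plane_to_complex :: "real ^ 2 \<Rightarrow> complex" where
  "plane_to_complex v = Complex (v $ 1) (v $ 2)"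

definition complex_to_plane :: "complex \<Rightarrow> real ^ 2" where
  "complex_to_plane z = vector [Re z, Im z]"

lemma plane_to_complex_inverse [simp]: "plane_to_complex (complex_to_plane z) = z"
  by (simp add: plane_to_complex_def complex_to_plane_def)

lemma complex_to_plane_inverse [simp]: "complex_to_plane (plane_to_complex v) = v"
  by (simp add: plane_to_complex_def complex_to_plane_def Finite_Cartesian_Product.vec_eq_iff forall_2)

lemma norm_plane_to_complex [simp]: "norm (plane_to_complex v) = norm v"
  by (simp add: plane_to_complex_def norm_vec_def L2_set_def sum_2 cmod_def)

lemma norm_complex_to_plane [simp]: "norm (complex_to_plane z) = norm z"
  using norm_plane_to_complex[of "complex_to_plane z"] by simp

lemma linear_plane_to_complex: "linear plane_to_complex"
  by (rule linearI) (auto simp: plane_to_complex_def complex_eq_iff)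

lemma linear_complex_to_plane: "linear complex_to_plane"
  by (rule linearI) (auto simp: complex_to_plane_def Finite_Cartesian_Product.vec_eq_iff forall_2)

lemma measurable_plane_to_complex [measurable]: "plane_to_complex \<in> borel_measurable borel"
  by (intro borel_measurable_continuous_onI linear_continuous_on linear_plane_to_complex[THEN linear_conv_bounded_linear[THEN iffD1]])

lemma plane_to_complex_vimage_box:
  "plane_to_complex -` box l u = box (complex_to_plane l) (complex_to_plane u)"
  by (auto simp: plane_to_complex_def complex_to_plane_def box_def Basis_complex_def Basis_vec_def inner_axis forall_2)

lemma lborel_plane_complex: "distr lborel borel plane_to_complex = lborel"
proof (rule lborel_eqI[symmetric])
  fix l u :: complex
  assume le: "\<And>b. b \<in> Basis \<Longrightarrow> l \<bullet> b \<le> u \<bullet> b"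
  have "Re l \<le> Re u" "Im l \<le> Im u" using le[of 1] le[of \<i>] by (auto simp: Basis_complex_def)
  then have le': "\<forall>b\<in>Basis. complex_to_plane l \<bullet> b \<le> complex_to_plane u \<bullet> b"
    by (auto simp: complex_to_plane_def Basis_vec_def inner_axis forall_2)
  have B: "(Basis :: (real ^ 2) set) = {axis 1 1, axis 2 1}"
    by (auto simp: Basis_vec_def UNIV_2)
  have "emeasure (distr lborel borel plane_to_complex) (box l u)
      = emeasure lborel (box (complex_to_plane l) (complex_to_plane u))"
    by (simp add: emeasure_distr plane_to_complex_vimage_box)
  also have "\<dots> = ennreal (\<Prod>b\<in>Basis. (complex_to_plane u - complex_to_plane l) \<bullet> b)"
    using le' by (simp add: emeasure_lborel_box_eq)
  also have "(\<Prod>b\<in>Basis. (complex_to_plane u - complex_to_plane l) \<bullet> b) = (\<Prod>b\<in>Basis. (u - l) \<bullet> b)"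
    unfolding B by (simp add: Basis_complex_def complex_to_plane_def inner_axis axis_eq_axis)
  finally show "emeasure (distr lborel borel plane_to_complex) (box l u) = ennreal (\<Prod>b\<in>Basis. (u - l) \<bullet> b)" .
qed simp

text \<open>The invariance of volume under orthogonal maps is available for the coordinate space \<open>real ^ 2\<close>; it is
transported to the complex plane along the obvious identification.\<close>

lemma lborel_rotation:
  fixes c :: complex
  assumes c: "norm c = 1"
  shows "distr lborel borel ((*) c) = lborel"
proof (rule lborel_eqI[symmetric])
  fix l u :: complex
  assume le: "\<And>b. b \<in> Basis \<Longrightarrow> l \<bullet> b \<le> u \<bullet> b"
  define \<rho> where "\<rho> v = complex_to_plane (cnj c * plane_to_complex v)" for v
  define B where "B = box (complex_to_plane l) (complex_to_plane u)"
  have cc: "cnj c * c = 1" using c complex_norm_square[of c] by (simp add: mult.commute)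
  have lin: "linear (\<lambda>w. cnj c * w)" by (rule linearI) (auto simp: algebra_simps)
  have "linear \<rho>"
    unfolding \<rho>_def using linear_compose[OF linear_compose[OF linear_plane_to_complex lin] linear_complex_to_plane]
    by (simp add: o_def)
  then have \<rho>: "orthogonal_transformation \<rho>"
    unfolding orthogonal_transformation by (simp add: \<rho>_def norm_mult c)
  have img: "plane_to_complex -` ((*) c -` box l u) = \<rho> ` B"
  proof (intro Set.set_eqI iffI)
    fix v assume v: "v \<in> plane_to_complex -` ((*) c -` box l u)"
    have "v = \<rho> (complex_to_plane (c * plane_to_complex v))"
      using cc by (simp add: \<rho>_def flip: mult.assoc)
    moreover have "complex_to_plane (c * plane_to_complex v) \<in> B"
      using v unfolding B_def plane_to_complex_vimage_box[symmetric] by simp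
    ultimately show "v \<in> \<rho> ` B" by blast
  next
    fix v assume "v \<in> \<rho> ` B"
    then obtain x where x: "x \<in> B" "v = \<rho> x" by blast
    have "c * plane_to_complex v = plane_to_complex x"
      using cc x by (simp add: \<rho>_def mult.assoc[symmetric] mult.commute[of c])
    then show "v \<in> plane_to_complex -` ((*) c -` box l u)"
      using x(1) unfolding B_def plane_to_complex_vimage_box[symmetric] by simp
  qed
  have Bm: "B \<in> lmeasurable" unfolding B_def by simp
  have cm: "(*) c \<in> borel_measurable borel"
    by (intro borel_measurable_continuous_onI continuous_intros)
  have S: "(*) c -` box l u \<in> sets borel"
    using measurable_sets[OF cm, of "box l u"] by simp
  then have S': "plane_to_complex -` ((*) c -` box l u) \<in> sets borel"
    using measurable_sets[OF measurable_plane_to_complex] by simp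
  have "emeasure (distr lborel borel ((*) c)) (box l u) = emeasure lborel ((*) c -` box l u)"
    using cm by (simp add: emeasure_distr)
  also have "\<dots> = emeasure lborel (plane_to_complex -` ((*) c -` box l u))"
    using S by (subst lborel_plane_complex[symmetric]) (simp add: emeasure_distr)
  also have "\<dots> = emeasure lebesgue (\<rho> ` B)"
    using S' by (simp add: img[symmetric])
  also have "\<dots> = ennreal (measure lebesgue (\<rho> ` B))"
    using measurable_orthogonal_image[OF \<rho> Bm] by (simp add: emeasure_eq_measure2)
  also have "\<dots> = ennreal (measure lebesgue B)"
    using measure_orthogonal_image[OF \<rho> Bm] by simp
  also have "\<dots> = emeasure lborel B"
    using Bm unfolding B_def by (simp add: emeasure_eq_measure2)
  also have "\<dots> = emeasure lborel (box l u)"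
    unfolding B_def plane_to_complex_vimage_box[symmetric]
    by (subst lborel_plane_complex[symmetric]) (simp add: emeasure_distr)
  also have "\<dots> = ennreal (\<Prod>b\<in>Basis. (u - l) \<bullet> b)"
    using le by (simp add: emeasure_lborel_box_eq)
  finally show "emeasure (distr lborel borel ((*) c)) (box l u) = ennreal (\<Prod>b\<in>Basis. (u - l) \<bullet> b)" .
qed simp

lemma emeasure_dA:
  assumes A: "A \<in> sets borel" "A \<subseteq> ball 0 1"
  shows "emeasure dA A = ennreal (1 / pi) * emeasure lborel A"
proof -
  have s: "A \<in> sets (lebesgue_on (ball 0 1))"
    using A by (auto simp: sets_restrict_space_iff)
  have "emeasure dA A = ennreal (1 / pi) * emeasure (lebesgue_on (ball 0 1)) A"
    unfolding dA_def using s by (simp add: emeasure_density nn_integral_cmult_indicator)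
  also have "emeasure (lebesgue_on (ball 0 1)) A = emeasure lebesgue A"
    using A by (intro emeasure_restrict_space) auto
  finally show ?thesis using A by simp
qed

lemma measurable_norm_dA [measurable]: "norm \<in> borel_measurable dA"
  by (rule borel_measurable_dA_if_borel) simp

lemma emeasure_dA_annulus:
  assumes "0 \<le> x" "x \<le> 1"
  shows "emeasure dA {w \<in> ball 0 1. x < norm w} = ennreal (1 - x\<^sup>2)"
proof (cases "x = 1")
  case True
  then have "{w \<in> ball (0::complex) 1. x < norm w} = {}" by auto
  then show ?thesis using True by (simp only: emeasure_empty) simp
next
  case False
  have eq: "{w \<in> ball 0 1. x < norm w} = ball 0 1 - cball (0::complex) x" by auto
  have "emeasure lborel (ball 0 1 - cball (0::complex) x)
      = emeasure lborel (ball (0::complex) 1) - emeasure lborel (cball (0::complex) x)"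
    using assms False by (intro emeasure_Diff) (auto simp: emeasure_cball)
  also have "\<dots> = ennreal pi - ennreal (pi * x\<^sup>2)"
    using assms by (simp add: emeasure_cball emeasure_ball unit_ball_vol_2)
  also have "\<dots> = ennreal (pi * (1 - x\<^sup>2))"
    using assms by (simp add: ennreal_minus right_diff_distrib)
  finally have "emeasure dA (ball 0 1 - cball (0::complex) x) = ennreal (1 / pi) * ennreal (pi * (1 - x\<^sup>2))"
    by (subst emeasure_dA) auto
  also have "\<dots> = ennreal (1 - x\<^sup>2)"
    using assms by (subst ennreal_mult[symmetric]) (auto simp: power_le_one)
  finally show ?thesis unfolding eq .
qed

lemma integrable_complex_mult_iff:
  fixes f :: "'a \<Rightarrow> complex"
  assumes "c \<noteq> 0"
  shows "integrable M (\<lambda>x. c * f x) \<longleftrightarrow> integrable M f"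
proof
  assume "integrable M (\<lambda>x. c * f x)"
  then have "integrable M (\<lambda>x. (1 / c) * (c * f x))" by (rule integrable_mult_right)
  moreover have "(\<lambda>x. (1 / c) * (c * f x)) = f" using assms by (simp add: fun_eq_iff)
  ultimately show "integrable M f" by (simp only:)
qed (rule integrable_mult_right)

text \<open>This rests on the completeness of Lebesgue measure. It is used to compare a symbol whose radial part is
merely Lebesgue measurable with one whose radial part is Borel.\<close>

lemma borel_measurable_lebesgue_cong_AE:
  assumes f: "f \<in> borel_measurable lebesgue" and ae: "AE x in lebesgue. f x = g x"
  shows "g \<in> borel_measurable lebesgue"
proof (rule measurableI)
  fix A :: "'b set" assume A: "A \<in> sets borel"
  show "g -` A \<inter> space lebesgue \<in> sets lebesgue"
  proof (rule completion.in_sets_AE)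
    show "AE x in lebesgue. (x \<in> f -` A) = (x \<in> g -` A \<inter> space lebesgue)"
      using ae by eventually_elim auto
    show "f -` A \<in> sets lebesgue" using measurable_sets[OF f A] by simp
  qed simp
qed simp

lemma borel_measurable_lebesgue_on_cong_AE:
  fixes f g :: "'a::euclidean_space \<Rightarrow> 'b::euclidean_space"
  assumes f: "f \<in> borel_measurable (lebesgue_on S)" and S: "S \<in> sets lebesgue"
    and ae: "AE x in lebesgue. x \<in> S \<longrightarrow> f x = g x"
  shows "g \<in> borel_measurable (lebesgue_on S)"
proof -
  have "(\<lambda>x. if x \<in> S then f x else 0) \<in> borel_measurable lebesgue"
    using f S by (subst borel_measurable_if) auto
  then have "(\<lambda>x. if x \<in> S then g x else 0) \<in> borel_measurable lebesgue"
    by (rule borel_measurable_lebesgue_cong_AE) (use ae in \<open>eventually_elim, auto\<close>)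
  then show ?thesis using S by (subst (asm) borel_measurable_if) auto
qed

text \<open>Under the modulus, the normalized area of the disk becomes the measure \<open>2 r dr\<close> on the unit interval.
Both measures give \<open>1 - x\<^sup>2\<close> to the half line beyond \<open>x\<close>, for \<open>x\<close> between 0 and 1.\<close>

lemma distr_norm_dA:
  "distr dA borel norm = density lborel (\<lambda>r. ennreal (2 * r * indicator {0<..<1} r))"
proof (rule measure_eqI_lessThan)
  have L: "emeasure (distr dA borel norm) {x<..} = ennreal (1 - (max 0 (min 1 x))\<^sup>2) " for x
  proof -
    have "emeasure (distr dA borel norm) {x<..} = emeasure dA {w \<in> ball 0 1. x < norm w}"
      by (subst emeasure_distr) (auto simp: vimage_def Int_def conj_commute intro: arg_cong[where f = "emeasure dA"])
    also have "\<dots> = emeasure dA {w \<in> ball 0 1. max 0 (min 1 x) < norm w}"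
    proof (cases "x < 0")
      case True
      have "emeasure dA {w \<in> ball 0 1. x < norm w} = emeasure dA (ball 0 1)"
        using True by (intro arg_cong[where f = "emeasure dA"]) (auto intro: less_le_trans)
      also have "\<dots> = emeasure dA (ball 0 1 - {0})"
      proof -
        have "emeasure lborel (ball (0::complex) 1 - {0}) = emeasure lborel (ball (0::complex) 1)"
          by (intro emeasure_Diff_null_set) auto
        then show ?thesis by (simp add: emeasure_dA)
      qed
      also have "ball 0 1 - {0} = {w \<in> ball (0::complex) 1. max 0 (min 1 x) < norm w}"
        using True by auto
      finally show ?thesis .
    next
      case False
      then show ?thesis by (intro arg_cong[where f = "emeasure dA"]) auto
    qed
    also have "\<dots> = ennreal (1 - (max 0 (min 1 x))\<^sup>2)"
      by (rule emeasure_dA_annulus) auto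
    finally show ?thesis .
  qed
  have R: "emeasure (density lborel (\<lambda>r. ennreal (2 * r * indicator {0<..<1} r))) {x<..} = ennreal (1 - (max 0 (min 1 x))\<^sup>2)" for x :: real
  proof -
    \<comment> \<open>Outside the unit interval the density vanishes, so \<open>x\<close> may be clamped to it.\<close>
    define y where "y = max 0 (min 1 x)"
    have y: "0 \<le> y" "y \<le> 1" by (auto simp: y_def)
    have "emeasure (density lborel (\<lambda>r. ennreal (2 * r * indicator {0<..<1} r))) {x<..}
        = (\<integral>\<^sup>+ r. ennreal (2 * r * indicator {0<..<1} r) * indicator {x<..} r \<partial>lborel)"
      by (subst emeasure_density) auto
    also have "\<dots> = (\<integral>\<^sup>+ r. ennreal (2 * r) * indicator {y..1} r \<partial>lborel)"
    proof (rule nn_integral_cong_AE)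
      have "AE r in lborel. r \<noteq> y \<and> r \<noteq> (1::real)"
        using AE_lborel_singleton[of y] AE_lborel_singleton[of 1] by eventually_elim auto
      then show "AE r in lborel. ennreal (2 * r * indicator {0<..<1} r) * indicator {x<..} r = ennreal (2 * r) * indicator {y..1} r"
        by eventually_elim (auto simp: y_def indicator_def)
    qed
    also have "\<dots> = ennreal (1\<^sup>2 - y\<^sup>2)"
      using y by (intro nn_integral_FTC_Icc) (auto intro!: derivative_eq_intros)
    finally show ?thesis by (simp add: y_def)
  qed
  show "emeasure (distr dA borel norm) {x<..} = emeasure (density lborel (\<lambda>r. ennreal (2 * r * indicator {0<..<1} r))) {x<..}" for x
    unfolding L R ..
  show "emeasure (distr dA borel norm) {x<..} < \<infinity>" for x unfolding L by simp
qed auto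


lemma integral_dA_radial:
  fixes \<phi> :: "real \<Rightarrow> complex"
  assumes [measurable]: "\<phi> \<in> borel_measurable borel"
  shows "integrable dA (\<lambda>w. \<phi> (norm w)) \<longleftrightarrow> integrable (lebesgue_on {0<..<1}) (\<lambda>r. \<phi> r * of_real r)" (is ?A)
    and "(LINT w|dA. \<phi> (norm w)) = 2 * (LINT r|lebesgue_on {0<..<1}. \<phi> r * of_real r)" (is ?B)
proof -
  have S: "{0<..<1::real} \<inter> space lebesgue \<in> sets lebesgue" by simp
  have eq: "(2 * r * indicator {0<..<1} r) *\<^sub>R \<phi> r = 2 * (indicator {0<..<1} r *\<^sub>R (\<phi> r * of_real r))" for r :: real
    by (simp add: scaleR_conv_of_real indicator_def)
  have m: "(\<lambda>r. indicator {0<..<1} r *\<^sub>R (\<phi> r * of_real r)) \<in> borel_measurable borel"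
    by measurable
  have nn: "AE r in lborel. 0 \<le> 2 * r * indicator {0<..<1} (r::real)"
    by (intro AE_I2) (auto simp: indicator_def)
  have "integrable dA (\<lambda>w. \<phi> (norm w)) \<longleftrightarrow> integrable (distr dA borel norm) \<phi>"
    by (subst integrable_distr_eq) auto
  also have "\<dots> \<longleftrightarrow> integrable lborel (\<lambda>r. (2 * r * indicator {0<..<1} r) *\<^sub>R \<phi> r)"
    unfolding distr_norm_dA by (rule integrable_density[OF _ _ nn]) auto
  also have "\<dots> \<longleftrightarrow> integrable lborel (\<lambda>r. indicator {0<..<1} r *\<^sub>R (\<phi> r * of_real r))"
    unfolding eq by (rule integrable_complex_mult_iff) simp
  also have "\<dots> \<longleftrightarrow> integrable lebesgue (\<lambda>r. indicator {0<..<1} r *\<^sub>R (\<phi> r * of_real r))"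
    by (rule integrable_completion[symmetric]) (use m in simp)
  also have "\<dots> \<longleftrightarrow> integrable (lebesgue_on {0<..<1}) (\<lambda>r. \<phi> r * of_real r)"
    by (rule integrable_restrict_space[OF S, symmetric])
  finally show ?A .
  have "(LINT w|dA. \<phi> (norm w)) = integral\<^sup>L (distr dA borel norm) \<phi>"
    by (subst integral_distr) auto
  also have "\<dots> = (LINT r|lborel. (2 * r * indicator {0<..<1} r) *\<^sub>R \<phi> r)"
    unfolding distr_norm_dA by (rule integral_density[OF _ _ nn]) auto
  also have "\<dots> = 2 * (LINT r|lborel. indicator {0<..<1} r *\<^sub>R (\<phi> r * of_real r))"
    unfolding eq by (rule integral_mult_right_zero)
  also have "(LINT r|lborel. indicator {0<..<1} r *\<^sub>R (\<phi> r * of_real r))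
      = (LINT r|lebesgue. indicator {0<..<1} r *\<^sub>R (\<phi> r * of_real r))"
    by (rule integral_completion[symmetric]) (use m in simp)
  also have "\<dots> = (LINT r|lebesgue_on {0<..<1}. \<phi> r * of_real r)"
    by (rule integral_restrict_space[OF S, symmetric])
  finally show ?B .
qed

lemma measurable_sgn_power_int [measurable]: "(\<lambda>w::complex. sgn w powi d) \<in> borel_measurable borel"
proof -
  have "(sgn :: complex \<Rightarrow> complex) \<in> borel_measurable borel"
    unfolding sgn_div_norm[abs_def] by measurable
  then show ?thesis
    unfolding power_int_def by (cases "d \<ge> 0") auto
qed

text \<open>Rotation by a suitable angle changes the sign of the integrand and preserves area.\<close>

lemma integral_dA_angular_zero:
  fixes \<phi> :: "real \<Rightarrow> complex"
  assumes [measurable]: "\<phi> \<in> borel_measurable borel" and d: "d \<noteq> 0"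
    and int: "integrable dA (\<lambda>w. \<phi> (norm w) * sgn w powi d)"
  shows "(LINT w|dA. \<phi> (norm w) * sgn w powi d) = 0"
proof -
  \<comment> \<open>The \<open>d\<close>-th power of this rotation is \<open>-1\<close>.\<close>
  define c where "c = cis (pi / of_int d)"
  have c: "norm c = 1" "c \<noteq> 0" by (simp_all add: c_def)
  have cd: "c powi d = -1" using d by (simp add: c_def cis_power_int)
  define H where "H w = indicator (ball 0 1) w *\<^sub>R (\<phi> (norm w) * sgn w powi d)" for w
  have Hm: "H \<in> borel_measurable borel"
    unfolding H_def
    by (intro borel_measurable_scaleR borel_measurable_times borel_measurable_indicator
        measurable_compose[OF borel_measurable_norm assms(1)] measurable_sgn_power_int) auto
  have cm: "(*) c \<in> borel_measurable borel"
    by (intro borel_measurable_continuous_onI continuous_intros)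
  have rot: "H (c * w) = - H w" for w
  proof -
    have "sgn c = c" using c by (simp add: sgn_eq)
    then show ?thesis
      by (simp add: H_def norm_mult c sgn_mult power_int_mult_distrib cd indicator_def)
  qed
  have "(LINT w|lborel. H w) = (LINT w|lborel. H (c * w))"
    using integral_distr[OF _ Hm, of "(*) c" lborel] cm lborel_rotation[OF c(1)] by simp
  then have "(LINT w|lborel. H w) = 0" unfolding rot by simp
  moreover have "(LINT w|lebesgue. H w) = (LINT w|lborel. H w)"
    by (rule integral_completion) (use Hm in simp)
  ultimately show ?thesis
    using integral_dA[OF int] by (simp add: H_def)
qed

lemma quasihomogeneous_eq:
  assumes "quasihomogeneous H \<phi> d" "0 < norm w" "norm w < 1"
  shows "H w = \<phi> (norm w) * sgn w powi d"
proof -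
  have "w \<noteq> 0" using assms by auto
  have "H (rcis (norm w) (Arg w)) = \<phi> (norm w) * cis (of_int d * Arg w)"
    using assms unfolding quasihomogeneous_def by blast
  then show ?thesis
    using cis_Arg[OF \<open>w \<noteq> 0\<close>] by (simp add: rcis_cmod_Arg flip: cis_power_int)
qed

lemma AE_dA_nonzero: "AE w in dA. 0 < norm w"
proof -
  have "AE w in lborel. w \<noteq> (0::complex)" by (rule AE_lborel_singleton)
  then have "AE w in lebesgue. w \<noteq> (0::complex)" by (rule AE_completion)
  then show ?thesis unfolding AE_dA by eventually_elim simp
qed

text \<open>The preimage of a null set of radii is a null set of the disk, because the modulus maps area to a
measure with a density.\<close>

lemma AE_dA_radial:
  assumes "AE r in lborel. P r"
  shows "AE w in dA. P (norm w)"
proof -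
  obtain N where N: "N \<in> null_sets lborel" "{r \<in> space lborel. \<not> P r} \<subseteq> N"
    using assms by (auto simp: eventually_ae_filter)
  have "AE r in lborel. r \<notin> N" using N(1) by (rule AE_not_in)
  then have "AE r in density lborel (\<lambda>r. ennreal (2 * r * indicator {0<..<1} r)). r \<notin> N"
    by (subst AE_density) auto
  then have "AE r in distr dA borel norm. r \<notin> N" unfolding distr_norm_dA .
  then have "AE w in dA. norm w \<notin> N" by (rule AE_distrD[rotated]) simp
  then show ?thesis by eventually_elim (use N(2) in auto)
qed

lemma borel_version_of_radial_part:
  fixes \<phi> :: "real \<Rightarrow> complex"
  assumes "\<phi> \<in> borel_measurable (lebesgue_on {0<..<1})"
  obtains \<phi>' where "\<phi>' \<in> borel_measurable borel" "AE r in lborel. r \<in> {0<..<1} \<longrightarrow> \<phi> r = \<phi>' r"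
proof -
  define \<phi>0 where "\<phi>0 r = (if r \<in> {0<..<1} then \<phi> r else 0)" for r
  have m: "\<phi>0 \<in> borel_measurable lebesgue"
    unfolding \<phi>0_def[abs_def] using assms by (subst borel_measurable_if) auto
  have "(\<lambda>r. Re (\<phi>0 r)) \<in> borel_measurable (completion lborel)" "(\<lambda>r. Im (\<phi>0 r)) \<in> borel_measurable (completion lborel)"
    using m by auto
  then obtain a b where ab: "a \<in> borel_measurable lborel" "AE r in lborel. Re (\<phi>0 r) = a r"
      "b \<in> borel_measurable lborel" "AE r in lborel. Im (\<phi>0 r) = b r"
    using completion_ex_borel_measurable_real[of "\<lambda>r. Re (\<phi>0 r)" lborel]
      completion_ex_borel_measurable_real[of "\<lambda>r. Im (\<phi>0 r)" lborel] by blast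
  show thesis
  proof (rule that[of "\<lambda>r. of_real (a r) + \<i> * of_real (b r)"])
    show "(\<lambda>r. of_real (a r) + \<i> * of_real (b r)) \<in> borel_measurable borel"
      using ab by auto
    show "AE r in lborel. r \<in> {0<..<1} \<longrightarrow> \<phi> r = of_real (a r) + \<i> * of_real (b r)"
      using ab(2,4) by eventually_elim (auto simp: \<phi>0_def complex_eq_iff)
  qed
qed

text \<open>Polar coordinates for functions with a single angular frequency. The radial part is only Lebesgue
measurable, so it is replaced by a Borel version before the modulus is composed with it.\<close>

lemma quasihomogeneous_dA:
  assumes H: "quasihomogeneous H \<phi> d" and \<phi>: "\<phi> \<in> borel_measurable (lebesgue_on {0<..<1})"
  shows "integrable dA H \<longleftrightarrow> integrable (lebesgue_on {0<..<1}) (\<lambda>r. \<phi> r * of_real r)" (is ?A)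
    and "integrable dA H \<Longrightarrow>
      (LINT w|dA. H w) = (if d = 0 then 2 * (LINT r|lebesgue_on {0<..<1}. \<phi> r * of_real r) else 0)" (is "_ \<Longrightarrow> ?B")
proof -
  obtain \<phi>' where \<phi>'[measurable]: "\<phi>' \<in> borel_measurable borel" and ae: "AE r in lborel. r \<in> {0<..<1} \<longrightarrow> \<phi> r = \<phi>' r"
    using borel_version_of_radial_part[OF \<phi>] by blast
  define K where "K w = \<phi>' (norm w) * sgn w powi d" for w
  have Km: "K \<in> borel_measurable dA"
    unfolding K_def by (intro borel_measurable_dA_if_borel) measurable
  have HK: "AE w in dA. H w = K w"
    using AE_dA_radial[OF ae] AE_dA_nonzero AE_space
    by eventually_elim (auto simp: K_def quasihomogeneous_eq[OF H])
  have Hm: "H \<in> borel_measurable dA"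
  proof -
    have "AE w in lebesgue. w \<in> ball 0 1 \<longrightarrow> K w = H w"
      using HK unfolding AE_dA by eventually_elim auto
    from borel_measurable_lebesgue_on_cong_AE[OF Km[unfolded borel_measurable_dA_iff] _ this]
    show ?thesis unfolding borel_measurable_dA_iff by simp
  qed
  have \<phi>'r: "(\<lambda>r. \<phi>' r * of_real r) \<in> borel_measurable (lebesgue_on {0<..<1})"
  proof -
    have "(\<lambda>r. \<phi>' r * of_real r) \<in> borel_measurable lborel" by simp
    then show ?thesis by (intro measurable_restrict_space1 measurable_completion)
  qed
  have \<phi>r: "(\<lambda>r. \<phi> r * of_real r) \<in> borel_measurable (lebesgue_on {0<..<1})"
  proof -
    have "complex_of_real \<in> borel_measurable lborel" by simp
    then have "complex_of_real \<in> borel_measurable (lebesgue_on {0<..<1})"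
      by (intro measurable_restrict_space1 measurable_completion)
    with \<phi> show ?thesis by (rule borel_measurable_times)
  qed
  have ae': "AE r in lebesgue_on {0<..<1}. \<phi>' r * of_real r = \<phi> r * of_real r"
  proof -
    have "AE r in lebesgue. r \<in> {0<..<1} \<longrightarrow> \<phi>' r * of_real r = \<phi> r * of_real r"
      using AE_completion[OF ae] by eventually_elim auto
    then show ?thesis by (simp add: AE_restrict_space_iff)
  qed
  have nK: "AE w in dA. norm (K w) = norm (\<phi>' (norm w))"
    using AE_dA_nonzero by eventually_elim (simp add: K_def norm_mult norm_power_int norm_sgn)
  have "integrable dA H \<longleftrightarrow> integrable dA K"
    using Hm Km HK by (rule integrable_cong_AE)
  also have "\<dots> \<longleftrightarrow> integrable dA (\<lambda>w. \<phi>' (norm w))"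
  proof -
    have m': "(\<lambda>w. \<phi>' (norm w)) \<in> borel_measurable dA" by measurable
    have "integrable dA K \<longleftrightarrow> integrable dA (\<lambda>w. norm (K w))"
      using Km by (rule integrable_norm_iff[symmetric])
    also have "\<dots> \<longleftrightarrow> integrable dA (\<lambda>w. norm (\<phi>' (norm w)))"
      using Km m' nK by (intro integrable_cong_AE) auto
    also have "\<dots> \<longleftrightarrow> integrable dA (\<lambda>w. \<phi>' (norm w))"
      using m' by (rule integrable_norm_iff)
    finally show ?thesis .
  qed
  also have "\<dots> \<longleftrightarrow> integrable (lebesgue_on {0<..<1}) (\<lambda>r. \<phi>' r * of_real r)"
    by (rule integral_dA_radial) measurable
  also have "\<dots> \<longleftrightarrow> integrable (lebesgue_on {0<..<1}) (\<lambda>r. \<phi> r * of_real r)"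
    by (rule integrable_cong_AE[OF \<phi>'r \<phi>r ae'])
  finally show ?A .
  assume int: "integrable dA H"
  have "(LINT w|dA. H w) = (LINT w|dA. K w)"
    using Hm Km HK by (rule integral_cong_AE)
  also have "\<dots> = (if d = 0 then 2 * (LINT r|lebesgue_on {0<..<1}. \<phi> r * of_real r) else 0)"
  proof (cases "d = 0")
    case True
    have "(LINT w|dA. K w) = (LINT w|dA. \<phi>' (norm w))" unfolding K_def True by simp
    also have "\<dots> = 2 * (LINT r|lebesgue_on {0<..<1}. \<phi>' r * of_real r)"
      by (rule integral_dA_radial) measurable
    also have "(LINT r|lebesgue_on {0<..<1}. \<phi>' r * of_real r) = (LINT r|lebesgue_on {0<..<1}. \<phi> r * of_real r)"
      by (rule integral_cong_AE[OF \<phi>'r \<phi>r ae'])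
    finally show ?thesis using True by simp
  next
    case False
    have "integrable dA K" using int integrable_cong_AE[OF Hm Km HK] by simp
    then show ?thesis unfolding K_def using integral_dA_angular_zero[OF \<phi>' False] False by simp
  qed
  finally show ?B .
qed

section \<open>Mellin transforms of powers and their logarithmic multiples\<close>

lemma unit_interval_lebesgue: "{0<..<1::real} \<inter> space lebesgue \<in> sets lebesgue"
  by simp

lemma integrable_unit_interval_iff:
  fixes f :: "real \<Rightarrow> 'a::euclidean_space"
  assumes [measurable]: "f \<in> borel_measurable borel"
  shows "integrable (lebesgue_on {0<..<1}) f \<longleftrightarrow> set_integrable lborel {0<..<1} f"
proof -
  have m: "(\<lambda>r. indicator {0<..<1} r *\<^sub>R f r) \<in> borel_measurable borel"
    by measurable
  have "integrable (lebesgue_on {0<..<1}) f \<longleftrightarrow> integrable lebesgue (\<lambda>r. indicator {0<..<1} r *\<^sub>R f r)"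
    by (rule integrable_restrict_space[OF unit_interval_lebesgue])
  also have "\<dots> \<longleftrightarrow> integrable lborel (\<lambda>r. indicator {0<..<1} r *\<^sub>R f r)"
    by (rule integrable_completion) (use m in simp)
  finally show ?thesis by (simp add: set_integrable_def)
qed

lemma integral_unit_interval_eq:
  fixes f :: "real \<Rightarrow> 'a::euclidean_space"
  assumes [measurable]: "f \<in> borel_measurable borel"
  shows "(LINT r|lebesgue_on {0<..<1}. f r) = (LINT r:{0<..<1}|lborel. f r)"
proof -
  have m: "(\<lambda>r. indicator {0<..<1} r *\<^sub>R f r) \<in> borel_measurable borel"
    by measurable
  have "(LINT r|lebesgue_on {0<..<1}. f r) = (LINT r|lebesgue. indicator {0<..<1} r *\<^sub>R f r)"
    by (rule integral_restrict_space[OF unit_interval_lebesgue])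
  also have "\<dots> = (LINT r|lborel. indicator {0<..<1} r *\<^sub>R f r)"
    by (rule integral_completion) (use m in simp)
  finally show ?thesis by (simp add: set_lebesgue_integral_def)
qed

lemma integrable_powr_unit_interval:
  fixes s :: real
  assumes "s > -1"
  shows "integrable (lebesgue_on {0<..<1}) (\<lambda>r. r powr s)"
proof -
  have "(\<lambda>r::real. r powr s) integrable_on {0..1}"
    using integrable_on_powr_from_0[of s 1] assms by simp
  then have "(\<lambda>r::real. r powr s) absolutely_integrable_on {0..1}"
    by (intro nonnegative_absolutely_integrable_1) auto
  then have "set_integrable lebesgue {0..1} (\<lambda>r::real. r powr s)" .
  then have "set_integrable lebesgue {0<..<1} (\<lambda>r::real. r powr s)"
    by (rule set_integrable_subset) auto
  then show ?thesis
    using integrable_restrict_space[OF unit_interval_lebesgue, of "\<lambda>r. r powr s"]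
    by (simp add: set_integrable_def)
qed

lemma measurable_unit_interval_if_borel:
  fixes f :: "real \<Rightarrow> 'a::euclidean_space"
  assumes "f \<in> borel_measurable borel"
  shows "f \<in> borel_measurable (lebesgue_on {0<..<1})"
proof -
  have "f \<in> borel_measurable lborel" using assms by simp
  then show ?thesis by (intro measurable_restrict_space1 measurable_completion)
qed

text \<open>The logarithm is dominated by every negative power, in particular by one that uses up half of the
distance of the exponent from \<open>-1\<close>.\<close>

lemma integrable_powr_ln_unit_interval:
  fixes s :: real
  assumes s: "s > -1"
  shows "integrable (lebesgue_on {0<..<1}) (\<lambda>r. r powr s * ln r)"
proof (rule Bochner_Integration.integrable_bound)
  define e where "e = (s + 1) / 2"
  have e: "e > 0" "s - e > -1" using s by (auto simp: e_def field_simps)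
  show "integrable (lebesgue_on {0<..<1}) (\<lambda>r. r powr (s - e) * (1 / e))"
    by (intro integrable_mult_left integrable_powr_unit_interval e)
  show "(\<lambda>r. r powr s * ln r) \<in> borel_measurable (lebesgue_on {0<..<1})"
    by (rule measurable_unit_interval_if_borel) measurable
  show "AE r in lebesgue_on {0<..<1}. norm (r powr s * ln r) \<le> norm (r powr (s - e) * (1 / e))"
  proof (rule AE_I2)
    fix r :: real assume "r \<in> space (lebesgue_on {0<..<1})"
    then have r: "0 < r" "r < 1" by auto
    have "ln (1 / r) \<le> (1 / r) powr e / e" using r e by (intro ln_powr_bound) auto
    then have "- ln r \<le> r powr (- e) / e"
    proof -
      have "(1 / r) powr e = r powr (- e)" using r by (simp add: powr_minus_divide powr_divide)
      moreover have "ln (1 / r) = - ln r" using r by (simp add: ln_div)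
      ultimately show ?thesis using \<open>ln (1 / r) \<le> (1 / r) powr e / e\<close> by simp
    qed
    then have "r powr s * \<bar>ln r\<bar> \<le> r powr s * (r powr (- e) / e)"
      using r by (intro mult_left_mono) auto
    also have "\<dots> = r powr (s - e) * (1 / e)" by (simp add: powr_diff powr_minus divide_inverse)
    finally show "norm (r powr s * ln r) \<le> norm (r powr (s - e) * (1 / e))"
      using e by (simp add: abs_mult)
  qed
qed

text \<open>The fundamental theorem of calculus on the open unit interval, with limits of the primitive in place
of its values at the end points, where the integrands below may be singular.\<close>

lemma integral_unit_interval_FTC:
  fixes f F :: "real \<Rightarrow> complex"
  assumes m: "f \<in> borel_measurable borel"
    and int: "integrable (lebesgue_on {0<..<1}) f"
    and deriv: "\<And>r. 0 < r \<Longrightarrow> r < 1 \<Longrightarrow> (F has_vector_derivative f r) (at r)"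
    and cont: "\<And>r. 0 < r \<Longrightarrow> r < 1 \<Longrightarrow> isCont f r"
    and A: "(F \<longlongrightarrow> A) (at_right 0)" and B: "(F \<longlongrightarrow> B) (at_left 1)"
  shows "(LINT r|lebesgue_on {0<..<1}. f r) = B - A"
proof -
  have e: "einterval 0 1 = {0<..<1::real}"
    by (auto simp: einterval_def zero_ereal_def one_ereal_def)
  have "(LBINT x=0..1. f x) = B - A"
  proof (rule interval_integral_FTC_integrable[where F = F])
    show "set_integrable lborel (einterval 0 1) f"
      unfolding e using int integrable_unit_interval_iff[OF m] by simp
    show "((F \<circ> real_of_ereal) \<longlongrightarrow> A) (at_right 0)"
      using A by (simp add: zero_ereal_def ereal_tendsto_simps)
    show "((F \<circ> real_of_ereal) \<longlongrightarrow> B) (at_left 1)"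
      using B by (simp add: one_ereal_def ereal_tendsto_simps)
  qed (use deriv cont in \<open>auto simp: zero_ereal_def one_ereal_def\<close>)
  moreover have "(LBINT x=0..1. f x) = (LINT r:{0<..<1}|lborel. f r)"
    by (simp add: interval_lebesgue_integral_def e)
  ultimately show ?thesis using integral_unit_interval_eq[OF m] by simp
qed

lemma norm_of_real_powr: "r > 0 \<Longrightarrow> norm (complex_of_real r powr s) = r powr Re s"
  by (simp add: norm_powr_real_powr)

lemma of_real_powr_mult:
  "r > 0 \<Longrightarrow> complex_of_real (r powr a) * complex_of_real r powr (\<zeta> - 1) = complex_of_real r powr (\<zeta> + of_real a - 1)"
  by (simp add: powr_of_real[symmetric] powr_add[symmetric] algebra_simps)

lemma measurable_powr_of_real [measurable]: "(\<lambda>r. complex_of_real r powr s) \<in> borel_measurable borel"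
proof -
  have "complex_of_real r powr s = (if r = 0 then 0 else if r > 0 then exp (s * of_real (ln r))
      else exp (s * (of_real (ln (- r)) + \<i> * of_real pi)))" for r
  proof -
    have "Ln (complex_of_real r) = of_real (ln (- r)) + \<i> * of_real pi" if "r < 0"
      using that Ln_minus[of "complex_of_real (- r)"] Ln_of_real[of "- r"] by simp
    then show ?thesis by (auto simp: powr_def Ln_of_real)
  qed
  then show ?thesis by simp
qed

lemma mellin_powr:
  assumes s: "Re \<zeta> + a > 0"
  shows "mellin_exists (\<lambda>r. complex_of_real (r powr a)) \<zeta>"
    and "mellin (\<lambda>r. complex_of_real (r powr a)) \<zeta> = 1 / (\<zeta> + of_real a)"
proof -
  let ?f = "\<lambda>r. complex_of_real (r powr a) * complex_of_real r powr (\<zeta> - 1)"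
  define s where "s = \<zeta> + of_real a"
  have s0: "Re s > 0" using s by (simp add: s_def)
  then have s1: "s \<noteq> 0" by auto
  note s0 = s0 s1
  have m: "?f \<in> borel_measurable borel" by measurable
  show ex: "mellin_exists (\<lambda>r. complex_of_real (r powr a)) \<zeta>"
    unfolding mellin_exists_def
  proof (rule Bochner_Integration.integrable_bound)
    show "integrable (lebesgue_on {0<..<1}) (\<lambda>r. r powr (Re s - 1))"
      using s0 by (intro integrable_powr_unit_interval) simp
    show "?f \<in> borel_measurable (lebesgue_on {0<..<1})" by (rule measurable_unit_interval_if_borel[OF m])
    show "AE r in lebesgue_on {0<..<1}. norm (?f r) \<le> norm (r powr (Re s - 1))"
      by (intro AE_I2) (auto simp: of_real_powr_mult norm_of_real_powr s_def)
  qed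
  have "(LINT r|lebesgue_on {0<..<1}. ?f r) = 1 / s - 0"
  proof (rule integral_unit_interval_FTC[where F = "\<lambda>r. complex_of_real r powr s / s"])
    show "integrable (lebesgue_on {0<..<1}) ?f" using ex by (simp add: mellin_exists_def)
    fix r :: real assume r: "0 < r" "r < 1"
    have "((\<lambda>z. z powr s / s) has_field_derivative s * of_real r powr (s - 1) / s) (at (of_real r))"
      using r by (intro DERIV_cdivide has_field_derivative_powr) (auto simp: complex_nonpos_Reals_iff)
    then have "((\<lambda>r. complex_of_real r powr s / s) has_vector_derivative of_real r powr (s - 1)) (at r)"
      using s0 by (intro has_vector_derivative_real_field) simp
    then show "((\<lambda>r. complex_of_real r powr s / s) has_vector_derivative ?f r) (at r)"
      using r by (simp add: of_real_powr_mult s_def)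
    show "isCont ?f r"
      using r by (intro continuous_intros) (auto simp: complex_nonpos_Reals_iff)
  next
    have "((\<lambda>r. r powr Re s / norm s) \<longlongrightarrow> 0) (at_right 0)"
      using s0 by real_asymp
    then have "((\<lambda>r. norm (complex_of_real r powr s / s)) \<longlongrightarrow> 0) (at_right 0)"
      by (rule Lim_transform_eventually)
         (auto simp: eventually_at_right_field norm_divide norm_of_real_powr intro!: exI[of _ 1])
    then show "((\<lambda>r. complex_of_real r powr s / s) \<longlongrightarrow> 0) (at_right 0)"
      by (rule tendsto_norm_zero_cancel)
    have "((\<lambda>r. complex_of_real r powr s / s) \<longlongrightarrow> complex_of_real 1 powr s / s) (at_left 1)"
      using s0 by (intro tendsto_intros) (auto simp: complex_nonpos_Reals_iff)
    then show "((\<lambda>r. complex_of_real r powr s / s) \<longlongrightarrow> 1 / s) (at_left 1)" by simp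
  qed (use m in auto)
  then show "mellin (\<lambda>r. complex_of_real (r powr a)) \<zeta> = 1 / (\<zeta> + of_real a)"
    by (simp add: mellin_def s_def)
qed

text \<open>The primitive is obtained by integrating by parts once.\<close>

lemma mellin_powr_ln:
  assumes s: "Re \<zeta> + a > 0"
  shows "mellin_exists (\<lambda>r. complex_of_real (r powr a * ln r)) \<zeta>"
    and "mellin (\<lambda>r. complex_of_real (r powr a * ln r)) \<zeta> = - 1 / (\<zeta> + of_real a)\<^sup>2"
proof -
  let ?f = "\<lambda>r. complex_of_real (r powr a * ln r) * complex_of_real r powr (\<zeta> - 1)"
  define s where "s = \<zeta> + of_real a"
  have s0: "Re s > 0" using s by (simp add: s_def)
  then have s1: "s \<noteq> 0" by auto
  note s0 = s0 s1
  have m: "?f \<in> borel_measurable borel" by measurable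
  have f_eq: "?f r = complex_of_real r powr (s - 1) * complex_of_real (ln r)" if "r > 0" for r
    using of_real_powr_mult[OF that, of a \<zeta>] by (simp add: s_def mult_ac)
  show ex: "mellin_exists (\<lambda>r. complex_of_real (r powr a * ln r)) \<zeta>"
    unfolding mellin_exists_def
  proof (rule Bochner_Integration.integrable_bound)
    show "integrable (lebesgue_on {0<..<1}) (\<lambda>r. r powr (Re s - 1) * ln r)"
      using s0 by (intro integrable_powr_ln_unit_interval) simp
    show "?f \<in> borel_measurable (lebesgue_on {0<..<1})" by (rule measurable_unit_interval_if_borel[OF m])
    show "AE r in lebesgue_on {0<..<1}. norm (?f r) \<le> norm (r powr (Re s - 1) * ln r)"
    proof (rule AE_I2)
      fix r :: real assume "r \<in> space (lebesgue_on {0<..<1})"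
      then have r: "r > 0" by simp
      show "norm (?f r) \<le> norm (r powr (Re s - 1) * ln r)"
        unfolding f_eq[OF r] norm_mult norm_of_real_powr[OF r] by simp
    qed
  qed
  let ?F = "\<lambda>r. complex_of_real r powr s * (complex_of_real (ln r) / s - 1 / s\<^sup>2)"
  have "(LINT r|lebesgue_on {0<..<1}. ?f r) = - 1 / s\<^sup>2 - 0"
  proof (rule integral_unit_interval_FTC[where F = ?F])
    show "integrable (lebesgue_on {0<..<1}) ?f" using ex by (simp add: mellin_exists_def)
    fix r :: real assume r: "0 < r" "r < 1"
    have np: "complex_of_real r \<notin> \<real>\<^sub>\<le>\<^sub>0" using r by (simp add: complex_nonpos_Reals_iff)
    have "((\<lambda>z. z powr s * (Ln z / s - 1 / s\<^sup>2)) has_field_derivative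
        (s * of_real r powr (s - 1)) * (Ln (of_real r) / s - 1 / s\<^sup>2) + of_real r powr s * (inverse (of_real r) / s)) (at (of_real r))"
      using np by (auto intro!: derivative_eq_intros has_field_derivative_powr simp: divide_inverse)
    also have "(s * of_real r powr (s - 1)) * (Ln (of_real r) / s - 1 / s\<^sup>2) + of_real r powr s * (inverse (of_real r) / s) = ?f r"
      unfolding f_eq[OF r(1)] using r s0 
      by (simp add: powr_diff Ln_of_real field_simps power2_eq_square)
    finally have "((\<lambda>r. of_real r powr s * (Ln (of_real r) / s - 1 / s\<^sup>2)) has_vector_derivative ?f r) (at r)"
      by (rule has_vector_derivative_real_field)
    then show "(?F has_vector_derivative ?f r) (at r)"
    proof (rule has_vector_derivative_transform_within_open[of _ _ _ "{0<..}"])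
      show "of_real x powr s * (Ln (of_real x) / s - 1 / s\<^sup>2) = ?F x" if "x \<in> {0<..}" for x
        using that by (simp add: Ln_of_real)
    qed (use r in auto)
    show "isCont ?f r"
      using r np by (intro continuous_intros) auto
  next
    have "((\<lambda>r. r powr Re s * (\<bar>ln r\<bar> / norm s + 1 / norm s ^ 2)) \<longlongrightarrow> 0) (at_right 0)"
      using s0 by real_asymp
    moreover have "\<forall>\<^sub>F r in at_right 0. norm (?F r) \<le> r powr Re s * (\<bar>ln r\<bar> / norm s + 1 / norm s ^ 2)"
      unfolding eventually_at_right_field
    proof (intro exI[of _ 1] conjI allI impI)
      fix r :: real assume r: "0 < r" "r < 1"
      have "norm (complex_of_real (ln r) / s - 1 / s\<^sup>2) \<le> \<bar>ln r\<bar> / norm s + 1 / norm s ^ 2"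
        by (rule order_trans[OF norm_triangle_ineq4]) (simp add: norm_divide norm_power)
      then show "norm (?F r) \<le> r powr Re s * (\<bar>ln r\<bar> / norm s + 1 / norm s ^ 2)"
        unfolding norm_mult norm_of_real_powr[OF r(1)] by (intro mult_left_mono) auto
    qed simp
    ultimately show "(?F \<longlongrightarrow> 0) (at_right 0)"
      by (rule Lim_null_comparison[rotated])
    have "(?F \<longlongrightarrow> complex_of_real 1 powr s * (complex_of_real (ln 1) / s - 1 / s\<^sup>2)) (at_left 1)"
      using s0 by (intro tendsto_intros) (auto simp: complex_nonpos_Reals_iff)
    then show "(?F \<longlongrightarrow> - 1 / s\<^sup>2) (at_left 1)" by simp
  qed (use m in auto)
  then show "mellin (\<lambda>r. complex_of_real (r powr a * ln r)) \<zeta> = - 1 / (\<zeta> + of_real a)\<^sup>2"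
    by (simp add: mellin_def s_def)
qed

text \<open>The logarithmic divergence of the integral of \<open>c / r\<close> at 0.\<close>

lemma not_integrable_if_ge_inverse:
  fixes \<phi> :: "real \<Rightarrow> real"
  assumes \<phi>: "\<phi> \<in> borel_measurable borel" "integrable (lebesgue_on {0<..<1}) \<phi>" and c: "c > 0"
    and ge: "\<forall>\<^sub>F r in at_right 0. c / r \<le> \<bar>\<phi> r\<bar>"
  shows False
proof -
  obtain \<delta>0 where \<delta>0: "\<delta>0 > 0" "\<And>r. 0 < r \<Longrightarrow> r < \<delta>0 \<Longrightarrow> c / r \<le> \<bar>\<phi> r\<bar>"
    using ge by (auto simp: eventually_at_right_field)
  define \<delta> where "\<delta> = min \<delta>0 1 / 2"
  have \<delta>: "\<delta> > 0" "\<delta> < 1" "\<delta> < \<delta>0" using \<delta>0(1) by (auto simp: \<delta>_def min_def)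
  have si: "set_integrable lborel {0<..<1} \<phi>" using integrable_unit_interval_iff[OF \<phi>(1)] \<phi>(2) by simp
  define I where "I = (LINT r|lborel. indicator {0<..<1} r * \<bar>\<phi> r\<bar>)"
  have abs: "integrable lborel (\<lambda>r. indicator {0<..<1} r * \<bar>\<phi> r\<bar>)"
    using integrable_norm[OF si[unfolded set_integrable_def]] by (simp add: abs_mult)
  have I: "I \<ge> 0" unfolding I_def by (intro integral_nonneg_AE) auto
  \<comment> \<open>Chosen so that the integral of \<open>c / r\<close> over \<open>[\<epsilon>, \<delta>]\<close> is \<open>I + 1\<close>, more than the whole integral of \<open>\<bar>\<phi>\<bar>\<close>.\<close>
  define \<epsilon> where "\<epsilon> = \<delta> * exp (- (I + 1) / c)"
  have \<epsilon>: "\<epsilon> > 0" "\<epsilon> \<le> \<delta>"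
  proof -
    show "\<epsilon> > 0" using \<delta> by (simp add: \<epsilon>_def)
    have "- (I + 1) / c \<le> 0" using c I by (intro divide_nonpos_pos) auto
    then show "\<epsilon> \<le> \<delta>" using \<delta> unfolding \<epsilon>_def by (intro mult_right_le_one_le) auto
  qed
  have FTC: "has_bochner_integral lborel (\<lambda>r. c / r * indicator {\<epsilon>..\<delta>} r) (c * ln \<delta> - c * ln \<epsilon>)"
    using \<epsilon> c by (intro has_bochner_integral_FTC_Icc_nonneg) (auto intro!: derivative_eq_intros)
  have "I + 1 = (LINT r|lborel. c / r * indicator {\<epsilon>..\<delta>} r)"
  proof -
    have "ln \<epsilon> = ln \<delta> - (I + 1) / c" using \<delta> by (simp add: \<epsilon>_def ln_mult minus_divide_left)
    then have "c * ln \<delta> - c * ln \<epsilon> = I + 1" using c by (simp add: right_diff_distrib)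
    then show ?thesis using FTC unfolding has_bochner_integral_iff by simp
  qed
  also have "\<dots> \<le> (LINT r|lborel. indicator {0<..<1} r * \<bar>\<phi> r\<bar>)"
  proof (rule integral_mono[OF _ abs])
    show "integrable lborel (\<lambda>r. c / r * indicator {\<epsilon>..\<delta>} r)"
      using FTC by (simp add: has_bochner_integral_iff)
    show "c / r * indicator {\<epsilon>..\<delta>} r \<le> indicator {0<..<1} r * \<bar>\<phi> r\<bar>" for r
      using \<delta>0(2)[of r] \<delta> \<epsilon> by (auto simp: indicator_def)
  qed
  finally show False by (simp add: I_def)
qed

section \<open>The radial part of the convolution of two powers\<close>

text \<open>The function on the unit interval whose Mellin transform is
\<open>(\<zeta> - m + n) / ((\<zeta> + n + p) * (\<zeta> - m + q))\<close>, that is, the radial part of \<open>f \<diamond> g\<close>. It is read off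
from the partial fraction decomposition; a double pole produces a logarithm.\<close>

definition diamond_radial :: "real \<Rightarrow> real \<Rightarrow> int \<Rightarrow> int \<Rightarrow> real \<Rightarrow> real" where
  "diamond_radial p q m n r =
     (if p + n = q - m then r powr (p + n) * (1 + (m + p) * ln r)
      else ((m + p) * r powr (p + n) + (n - q) * r powr (q - m)) / (p + n - (q - m)))"

lemma measurable_diamond_radial [measurable]: "diamond_radial p q m n \<in> borel_measurable borel"
  unfolding diamond_radial_def[abs_def] by measurable

text \<open>A summand with coefficient 0 imposes no condition. This is how the exceptional cases \<open>m + p = 0\<close> and
\<open>n - q = 0\<close> of the integrability criterion arise.\<close>

lemma mellin_linear_combination:
  assumes "c \<noteq> 0 \<Longrightarrow> mellin_exists \<phi> \<zeta>" "d \<noteq> 0 \<Longrightarrow> mellin_exists \<psi> \<zeta>"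
  shows "mellin_exists (\<lambda>r. c * \<phi> r + d * \<psi> r) \<zeta>"
    and "mellin (\<lambda>r. c * \<phi> r + d * \<psi> r) \<zeta> = c * mellin \<phi> \<zeta> + d * mellin \<psi> \<zeta>"
proof -
  let ?M = "lebesgue_on {0<..<1::real}"
  have i: "integrable ?M (\<lambda>r. c * (\<phi> r * complex_of_real r powr (\<zeta> - 1)))"
    "integrable ?M (\<lambda>r. d * (\<psi> r * complex_of_real r powr (\<zeta> - 1)))"
    using assms unfolding mellin_exists_def by (auto intro: integrable_mult_right)
  have eq: "(c * \<phi> r + d * \<psi> r) * complex_of_real r powr (\<zeta> - 1)
      = c * (\<phi> r * complex_of_real r powr (\<zeta> - 1)) + d * (\<psi> r * complex_of_real r powr (\<zeta> - 1))" for r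
    by (simp add: algebra_simps)
  show "mellin_exists (\<lambda>r. c * \<phi> r + d * \<psi> r) \<zeta>"
    unfolding mellin_exists_def eq using i by (rule Bochner_Integration.integrable_add)
  show "mellin (\<lambda>r. c * \<phi> r + d * \<psi> r) \<zeta> = c * mellin \<phi> \<zeta> + d * mellin \<psi> \<zeta>"
    unfolding mellin_def eq by (subst Bochner_Integration.integral_add[OF i]) simp
qed

lemma diamond_radial_eq:
  assumes "p + n = q - m"
  shows "complex_of_real (diamond_radial p q m n r)
    = 1 * of_real (r powr (p + n)) + of_real (m + p) * of_real (r powr (p + n) * ln r)"
  using assms by (simp add: diamond_radial_def algebra_simps)

lemma diamond_radial_partial_fractions:
  assumes "p + n \<noteq> q - m"
  shows "diamond_radial p q m n r = (m + p) / (p + n - (q - m)) * r powr (p + n)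
      + (n - q) / (p + n - (q - m)) * r powr (q - m)"
  unfolding diamond_radial_def if_not_P[OF assms]
  by (subst add_divide_distrib) (simp only: times_divide_eq_left)

lemma diamond_radial_neq:
  assumes "p + n \<noteq> q - m"
  shows "complex_of_real (diamond_radial p q m n r)
    = of_real ((m + p) / (p + n - (q - m))) * of_real (r powr (p + n))
      + of_real ((n - q) / (p + n - (q - m))) * of_real (r powr (q - m))"
  unfolding diamond_radial_partial_fractions[OF assms] by (simp only: of_real_add of_real_mult)

lemma partial_fractions:
  fixes x y d P Q \<mu> :: complex
  assumes "x \<noteq> 0"
  shows "1 * (1 / x) + \<mu> * (- 1 / x\<^sup>2) = (x - \<mu>) / (x * x)"
    and "y \<noteq> 0 \<Longrightarrow> d \<noteq> 0 \<Longrightarrow> (P / d) * (1 / x) + (Q / d) * (1 / y) = (P * y + Q * x) / (d * (x * y))"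
  using assms by (simp_all add: field_simps power2_eq_square)

lemma mellin_diamond_radial:
  assumes a: "Re \<zeta> + (p + n) > 0" and b: "Re \<zeta> + (q - m) > 0"
  shows "mellin_exists (\<lambda>r. of_real (diamond_radial p q m n r)) \<zeta>"
    and "mellin (\<lambda>r. of_real (diamond_radial p q m n r)) \<zeta>
      = (\<zeta> - of_int m + of_int n) / ((\<zeta> + of_int n + of_real p) * (\<zeta> - of_int m + of_real q))"
proof -
  let ?a = "complex_of_real (p + n)" and ?b = "complex_of_real (q - m)"
  have "Re (\<zeta> + ?a) > 0" "Re (\<zeta> + ?b) > 0" using a b by auto
  then have nz: "\<zeta> + ?a \<noteq> 0" "\<zeta> + ?b \<noteq> 0" by (metis zero_complex.simps(1) less_irrefl)+
  have "mellin_exists (\<lambda>r. of_real (diamond_radial p q m n r)) \<zeta> \<and>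
    mellin (\<lambda>r. of_real (diamond_radial p q m n r)) \<zeta>
      = (\<zeta> - of_int m + of_int n) / ((\<zeta> + ?a) * (\<zeta> + ?b))"
  proof (cases "p + n = q - m")
    case True
    have "mellin (\<lambda>r. of_real (diamond_radial p q m n r)) \<zeta>
        = 1 * (1 / (\<zeta> + ?a)) + of_real (m + p) * (- 1 / (\<zeta> + ?a)\<^sup>2)"
      unfolding diamond_radial_eq[OF True]
      by (subst mellin_linear_combination(2)[OF mellin_powr(1)[OF a] mellin_powr_ln(1)[OF a]])
         (simp only: mellin_powr(2)[OF a] mellin_powr_ln(2)[OF a])
    also have "\<dots> = (\<zeta> + ?a - of_real (m + p)) / ((\<zeta> + ?a) * (\<zeta> + ?a))"
      by (rule partial_fractions(1)[OF nz(1)])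
    also have "\<zeta> + ?a - of_real (m + p) = \<zeta> - of_int m + of_int n" by simp
    finally have "mellin (\<lambda>r. of_real (diamond_radial p q m n r)) \<zeta>
        = (\<zeta> - of_int m + of_int n) / ((\<zeta> + ?a) * (\<zeta> + ?b))" using True by simp
    moreover have "mellin_exists (\<lambda>r. of_real (diamond_radial p q m n r)) \<zeta>"
      unfolding diamond_radial_eq[OF True]
      by (intro mellin_linear_combination(1) mellin_powr(1) mellin_powr_ln(1) a)
    ultimately show ?thesis by blast
  next
    case False
    let ?d = "complex_of_real (p + n - (q - m))"
    have d: "?d \<noteq> 0" using False by (simp only: of_real_eq_0_iff right_minus_eq not_False_eq_True)
    have "mellin (\<lambda>r. of_real (diamond_radial p q m n r)) \<zeta>
        = of_real ((m + p) / (p + n - (q - m))) * (1 / (\<zeta> + ?a)) + of_real ((n - q) / (p + n - (q - m))) * (1 / (\<zeta> + ?b))"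
      unfolding diamond_radial_neq[OF False]
      by (subst mellin_linear_combination(2)[OF mellin_powr(1)[OF a] mellin_powr(1)[OF b]])
         (simp only: mellin_powr(2)[OF a] mellin_powr(2)[OF b])
    also have "\<dots> = (of_real (m + p) * (\<zeta> + ?b) + of_real (n - q) * (\<zeta> + ?a)) / (?d * ((\<zeta> + ?a) * (\<zeta> + ?b)))"
      unfolding of_real_divide by (rule partial_fractions(2)[OF nz d])
    also have "of_real (m + p) * (\<zeta> + ?b) + of_real (n - q) * (\<zeta> + ?a) = ?d * (\<zeta> - of_int m + of_int n)"
      by (simp add: algebra_simps)
    also have "?d * (\<zeta> - of_int m + of_int n) / (?d * ((\<zeta> + ?a) * (\<zeta> + ?b)))
        = (\<zeta> - of_int m + of_int n) / ((\<zeta> + ?a) * (\<zeta> + ?b))"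
      using d by (rule mult_divide_mult_cancel_left)
    finally have "mellin (\<lambda>r. of_real (diamond_radial p q m n r)) \<zeta>
        = (\<zeta> - of_int m + of_int n) / ((\<zeta> + ?a) * (\<zeta> + ?b))" .
    moreover have "mellin_exists (\<lambda>r. of_real (diamond_radial p q m n r)) \<zeta>"
      unfolding diamond_radial_neq[OF False]
      by (intro mellin_linear_combination(1) mellin_powr(1) a b)
    ultimately show ?thesis by blast
  qed
  then show "mellin_exists (\<lambda>r. of_real (diamond_radial p q m n r)) \<zeta>"
    and "mellin (\<lambda>r. of_real (diamond_radial p q m n r)) \<zeta>
      = (\<zeta> - of_int m + of_int n) / ((\<zeta> + of_int n + of_real p) * (\<zeta> - of_int m + of_real q))"
    by (simp_all add: algebra_simps)
qed

lemma mellin_exists_2_iff: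
  "mellin_exists \<phi> 2 \<longleftrightarrow> integrable (lebesgue_on {0<..<1}) (\<lambda>r. \<phi> r * of_real r)"
  unfolding mellin_exists_def by (rule Bochner_Integration.integrable_cong) auto

text \<open>Near 0 the smaller exponent dominates, so the modulus is at least a constant times \<open>r\<close> to the power
\<open>\<alpha> + 1 \<le> -1\<close>.\<close>

lemma not_integrable_two_powers:
  fixes P Q \<alpha> \<beta> :: real
  assumes "\<alpha> \<le> -2" "\<alpha> < \<beta>" "P \<noteq> 0"
  shows "\<not> integrable (lebesgue_on {0<..<1}) (\<lambda>r. (P * r powr \<alpha> + Q * r powr \<beta>) * r)"
proof
  assume int: "integrable (lebesgue_on {0<..<1}) (\<lambda>r. (P * r powr \<alpha> + Q * r powr \<beta>) * r)"
  define \<gamma> where "\<gamma> = \<beta> - \<alpha>"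
  have "\<gamma> > 0" using assms by (simp add: \<gamma>_def)
  then have "((\<lambda>r. r powr \<gamma>) \<longlongrightarrow> 0) (at_right 0)" by real_asymp
  then have "((\<lambda>r. P + Q * r powr \<gamma>) \<longlongrightarrow> P + Q * 0) (at_right 0)"
    by (intro tendsto_intros)
  then have "((\<lambda>r. P + Q * r powr (\<beta> - \<alpha>)) \<longlongrightarrow> P) (at_right 0)"
    by (simp add: \<gamma>_def)
  then have "((\<lambda>r. \<bar>P + Q * r powr (\<beta> - \<alpha>)\<bar>) \<longlongrightarrow> \<bar>P\<bar>) (at_right 0)"
    by (rule tendsto_rabs)
  then have "\<forall>\<^sub>F r in at_right 0. \<bar>P\<bar> / 2 < \<bar>P + Q * r powr (\<beta> - \<alpha>)\<bar>"
    using assms by (intro order_tendstoD) auto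
  moreover have "\<forall>\<^sub>F r in at_right 0. 0 < r \<and> r < (1::real)"
    by (auto simp: eventually_at_right_field intro!: exI[of _ 1])
  ultimately have ev: "\<forall>\<^sub>F r in at_right 0. (\<bar>P\<bar> / 2) / r \<le> \<bar>(P * r powr \<alpha> + Q * r powr \<beta>) * r\<bar>"
  proof eventually_elim
    case (elim r)
    have "r powr (-1) \<le> r powr (\<alpha> + 1)" using elim assms by (intro powr_mono') auto
    then have "\<bar>P\<bar> / 2 * r powr (-1) \<le> \<bar>P + Q * r powr (\<beta> - \<alpha>)\<bar> * r powr (\<alpha> + 1)"
      using elim by (intro mult_mono) auto
    also have "\<dots> = \<bar>(P * r powr \<alpha> + Q * r powr \<beta>) * r\<bar>"
    proof -
      have "(P * r powr \<alpha> + Q * r powr \<beta>) * r = (P + Q * r powr (\<beta> - \<alpha>)) * r powr (\<alpha> + 1)"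
      proof -
        have "r powr \<beta> = r powr (\<beta> - \<alpha>) * r powr \<alpha>" by (simp flip: powr_add)
        moreover have "r powr (\<alpha> + 1) = r powr \<alpha> * r" using elim by (simp add: powr_add)
        ultimately show ?thesis by (simp add: algebra_simps)
      qed
      then show ?thesis by (simp add: abs_mult)
    qed
    finally show ?case using elim by (simp add: powr_minus_divide)
  qed
  have "(\<lambda>r. (P * r powr \<alpha> + Q * r powr \<beta>) * r) \<in> borel_measurable borel"
    by measurable
  then show False
    by (rule not_integrable_if_ge_inverse[OF _ int _ ev]) (use assms in simp)
qed

lemma not_integrable_powr_log:
  fixes \<mu> \<alpha> :: real
  assumes "\<alpha> \<le> -2"
  shows "\<not> integrable (lebesgue_on {0<..<1}) (\<lambda>r. (r powr \<alpha> * (1 + \<mu> * ln r)) * r)"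
proof
  assume int: "integrable (lebesgue_on {0<..<1}) (\<lambda>r. (r powr \<alpha> * (1 + \<mu> * ln r)) * r)"
  have "\<forall>\<^sub>F r in at_right 0. 1 \<le> \<bar>1 + \<mu> * ln r\<bar>"
  proof (cases "\<mu> = 0")
    case False
    then have pos: "\<bar>\<mu>\<bar> > 0" by simp
    have "filterlim (\<lambda>r::real. - ln r) at_top (at_right 0)" by real_asymp
    then have "filterlim (\<lambda>r::real. \<bar>\<mu>\<bar> * - ln r) at_top (at_right 0)"
      by (rule filterlim_tendsto_pos_mult_at_top[OF tendsto_const pos])
    then have "\<forall>\<^sub>F r in at_right 0. 2 \<le> \<bar>\<mu>\<bar> * - ln r" by (simp add: filterlim_at_top)
    then show ?thesis
    proof eventually_elim
      case (elim r)
      also have "\<bar>\<mu>\<bar> * - ln r \<le> \<bar>\<mu>\<bar> * \<bar>ln r\<bar>" by (intro mult_left_mono) auto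
      finally have "2 \<le> \<bar>\<mu> * ln r\<bar>" by (simp add: abs_mult)
      then show ?case by linarith
    qed
  qed auto
  moreover have "\<forall>\<^sub>F r in at_right 0. 0 < r \<and> r < (1::real)"
    by (auto simp: eventually_at_right_field intro!: exI[of _ 1])
  ultimately have ev: "\<forall>\<^sub>F r in at_right 0. 1 / r \<le> \<bar>(r powr \<alpha> * (1 + \<mu> * ln r)) * r\<bar>"
  proof eventually_elim
    case (elim r)
    have "r powr (-1) \<le> r powr (\<alpha> + 1)" using elim assms by (intro powr_mono') auto
    then have "r powr (-1) * 1 \<le> r powr (\<alpha> + 1) * \<bar>1 + \<mu> * ln r\<bar>"
      using elim by (intro mult_mono) auto
    also have "\<dots> = \<bar>(r powr \<alpha> * (1 + \<mu> * ln r)) * r\<bar>"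
      using elim by (simp add: powr_add abs_mult)
    finally show ?case using elim by (simp add: powr_minus_divide)
  qed
  have "(\<lambda>r. (r powr \<alpha> * (1 + \<mu> * ln r)) * r) \<in> borel_measurable borel"
    by measurable
  then show False
    by (rule not_integrable_if_ge_inverse[OF _ int _ ev]) simp
qed

text \<open>Each power with a nonzero coefficient has to be integrable against \<open>r dr\<close> by itself, since different
powers cannot cancel at 0. For equal exponents both conditions on them coincide, and the factor
\<open>1 + (m + p) * ln r\<close> stays away from 0 near the origin. For different exponents the coefficients
cannot both vanish, because \<open>m + p = 0\<close> and \<open>n = q\<close> would make the exponents equal.\<close>

lemma integrable_diamond_radial_iff:
  "integrable (lebesgue_on {0<..<1}) (\<lambda>r. complex_of_real (diamond_radial p q m n r) * of_real r) \<longleftrightarrow>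
     (q - of_int m + 2 > 0 \<and> p + of_int n + 2 > 0) \<or>
     (of_int m + p = 0 \<and> q - of_int m + 2 > 0) \<or>
     (of_int n - q = 0 \<and> p + of_int n + 2 > 0)" (is "?int \<longleftrightarrow> ?cond")
proof
  assume ?cond
  show ?int
  proof (cases "p + n = q - m")
    case True
    then have "p + n + 2 > 0" using \<open>?cond\<close> by auto
    then have "mellin_exists (\<lambda>r. of_real (diamond_radial p q m n r)) 2"
      using True by (intro mellin_diamond_radial(1)) auto
    then show ?thesis unfolding mellin_exists_2_iff .
  next
    case False
    then have "m + p \<noteq> 0 \<Longrightarrow> p + n + 2 > 0" "n - q \<noteq> 0 \<Longrightarrow> q - m + 2 > 0"
      using \<open>?cond\<close> by auto
    then have pos: "(m + p) / (p + n - (q - m)) \<noteq> 0 \<Longrightarrow> Re 2 + (p + n) > 0"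
      "(n - q) / (p + n - (q - m)) \<noteq> 0 \<Longrightarrow> Re 2 + (q - m) > 0"
      by auto
    have "mellin_exists (\<lambda>r. of_real (diamond_radial p q m n r)) 2"
      unfolding diamond_radial_neq[OF False]
    proof (intro mellin_linear_combination(1) mellin_powr(1))
      show "Re 2 + (p + n) > 0" if "complex_of_real ((m + p) / (p + n - (q - m))) \<noteq> 0"
        using that unfolding of_real_eq_0_iff by (rule pos(1))
      show "Re 2 + (q - m) > 0" if "complex_of_real ((n - q) / (p + n - (q - m))) \<noteq> 0"
        using that unfolding of_real_eq_0_iff by (rule pos(2))
    qed
    then show ?thesis unfolding mellin_exists_2_iff .
  qed
next
  assume ?int
  then have int: "integrable (lebesgue_on {0<..<1}) (\<lambda>r. diamond_radial p q m n r * r)"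
    by (simp flip: of_real_mult add: complex_of_real_integrable_eq)
  show ?cond
  proof (cases "p + n = q - m")
    case True
    have "p + n + 2 > 0"
    proof (rule ccontr)
      assume "\<not> p + n + 2 > 0"
      then have "p + n \<le> -2" by simp
      from not_integrable_powr_log[OF this, of "m + p"] show False
        using int unfolding diamond_radial_def if_P[OF True] by contradiction
    qed
    then show ?thesis using True by auto
  next
    case False
    define A B where "A = (m + p) / (p + n - (q - m))" and "B = (n - q) / (p + n - (q - m))"
    have int': "integrable (lebesgue_on {0<..<1}) (\<lambda>r. (A * r powr (p + n) + B * r powr (q - m)) * r)"
      using int unfolding diamond_radial_partial_fractions[OF False] A_def B_def .
    then have int'': "integrable (lebesgue_on {0<..<1}) (\<lambda>r. (B * r powr (q - m) + A * r powr (p + n)) * r)"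
      by (simp add: add.commute)
    have A0: "A = 0 \<longleftrightarrow> m + p = 0" and B0: "B = 0 \<longleftrightarrow> n - q = 0"
      using False by (auto simp: A_def B_def)
    have AB: "\<not> (A = 0 \<and> B = 0)" using False unfolding A0 B0 by auto
    have A: "p + n + 2 > 0" if "A \<noteq> 0"
    proof (rule ccontr)
      assume "\<not> p + n + 2 > 0"
      then have le: "p + n \<le> -2" by simp
      consider "p + n < q - m" | "q - m < p + n" "B \<noteq> 0" | "B = 0" using False by linarith
      then show False
      proof cases
        case 1
        then show False using not_integrable_two_powers[OF le _ that] int' by blast
      next
        case 2
        then show False using not_integrable_two_powers[of "q - m" "p + n" B A] le int'' by simp
      next
        case 3
        then show False using not_integrable_two_powers[OF le _ that, of "p + n + 1" 0] int' by simp
      qed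
    qed
    have B: "q - m + 2 > 0" if "B \<noteq> 0"
    proof (rule ccontr)
      assume "\<not> q - m + 2 > 0"
      then have le: "q - m \<le> -2" by simp
      consider "q - m < p + n" | "p + n < q - m" "A \<noteq> 0" | "A = 0" using False by linarith
      then show False
      proof cases
        case 1
        then show False using not_integrable_two_powers[OF le _ that] int'' by blast
      next
        case 2
        then show False using not_integrable_two_powers[of "p + n" "q - m" A B] le int' by simp
      next
        case 3
        then show False using not_integrable_two_powers[OF le _ that, of "q - m + 1" 0] int' by simp
      qed
    qed
    show ?thesis using A B AB A0 B0 by auto
  qed
qed

section \<open>Toeplitz operators on monomials\<close>

lemma quasihomogeneous_mult_monomial:
  assumes "quasihomogeneous H \<phi> d"
  shows "quasihomogeneous (\<lambda>w. H w * w ^ i * cnj w ^ j) (\<lambda>r. \<phi> r * of_real (r ^ (i + j))) (d + int i - int j)"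
  unfolding quasihomogeneous_def
proof (intro allI impI)
  fix r \<theta> :: real assume r: "0 < r \<and> r < 1"
  have "H (rcis r \<theta>) = \<phi> r * cis (of_int d * \<theta>)"
    using assms r unfolding quasihomogeneous_def by blast
  moreover have "rcis r \<theta> ^ i = of_real (r ^ i) * cis (of_nat i * \<theta>)"
    by (simp add: rcis_def power_mult_distrib Complex.DeMoivre)
  moreover have "cnj (rcis r \<theta>) ^ j = of_real (r ^ j) * cis (- (of_nat j * \<theta>))"
    by (simp add: rcis_def power_mult_distrib Complex.DeMoivre cis_cnj)
  moreover have "cis (of_int (d + int i - int j) * \<theta>) = cis (of_int d * \<theta>) * cis (of_nat i * \<theta>) * cis (- (of_nat j * \<theta>))"
    by (simp add: cis_mult algebra_simps)
  moreover have "complex_of_real (r ^ (i + j)) = of_real (r ^ i) * of_real (r ^ j)"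
    by (simp add: power_add)
  ultimately show "H (rcis r \<theta>) * rcis r \<theta> ^ i * cnj (rcis r \<theta>) ^ j
      = \<phi> r * of_real (r ^ (i + j)) * cis (of_int (d + int i - int j) * \<theta>)"
    by (simp only: mult_ac)
qed

lemma of_real_powr_nat:
  assumes "r > 0"
  shows "complex_of_real r powr (of_nat (k + 2) - 1) = of_real (r ^ k) * of_real r"
proof -
  have "(of_nat (k + 2) - 1 :: complex) = of_nat (Suc k)" by simp
  then show ?thesis using assms powr_nat[of "complex_of_real r" "Suc k"] by (simp add: mult.commute)
qed

text \<open>The moments of a quasihomogeneous function are concentrated on one diagonal, where they are values of
the Mellin transform of its radial part.\<close>

lemma moment_quasihomogeneous:
  assumes H: "quasihomogeneous H \<phi> d" and \<phi>: "\<phi> \<in> borel_measurable (lebesgue_on {0<..<1})"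
    and ex: "mellin_exists \<phi> (of_nat (i + j + 2))"
  shows "integrable dA (\<lambda>w. H w * w ^ i * cnj w ^ j)"
    and "moment H i j = (if d + int i = int j then 2 * mellin \<phi> (of_nat (i + j + 2)) else 0)"
proof -
  have "(\<lambda>r. complex_of_real (r ^ (i + j))) \<in> borel_measurable (lebesgue_on {0<..<1})"
    by (rule measurable_unit_interval_if_borel) measurable
  with \<phi> have m: "(\<lambda>r. \<phi> r * of_real (r ^ (i + j))) \<in> borel_measurable (lebesgue_on {0<..<1})"
    by (rule borel_measurable_times)
  have eq: "\<phi> r * of_real (r ^ (i + j)) * of_real r = \<phi> r * complex_of_real r powr (of_nat (i + j + 2) - 1)"
    if "r \<in> space (lebesgue_on {0<..<1})" for r
    using that of_real_powr_nat[of r "i + j"] by (simp add: mult.assoc)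
  have "integrable (lebesgue_on {0<..<1}) (\<lambda>r. \<phi> r * of_real (r ^ (i + j)) * of_real r)"
    using ex unfolding mellin_exists_def
    by (subst Bochner_Integration.integrable_cong[OF refl eq])
  then show int: "integrable dA (\<lambda>w. H w * w ^ i * cnj w ^ j)"
    using quasihomogeneous_dA(1)[OF quasihomogeneous_mult_monomial[OF H] m] by simp
  have "(LINT r|lebesgue_on {0<..<1}. \<phi> r * of_real (r ^ (i + j)) * of_real r) = mellin \<phi> (of_nat (i + j + 2))"
    unfolding mellin_def by (rule Bochner_Integration.integral_cong[OF refl eq])
  then show "moment H i j = (if d + int i = int j then 2 * mellin \<phi> (of_nat (i + j + 2)) else 0)"
    unfolding moment_def quasihomogeneous_dA(2)[OF quasihomogeneous_mult_monomial[OF H] m int]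
    by simp
qed

text \<open>The angular frequency can be read off on any circle on which the function does not vanish, so the
data chosen in the definition of \<open>is_diamond\<close> are the expected ones.\<close>

lemma quasihomogeneous_unique:
  assumes "quasihomogeneous f \<phi> m" "quasihomogeneous f \<phi>' m'" "\<phi> (1/2) \<noteq> 0"
  shows "m' = m" and "\<And>r. 0 < r \<Longrightarrow> r < 1 \<Longrightarrow> \<phi>' r = \<phi> r"
proof -
  have eq: "\<phi> r * cis (of_int m * \<theta>) = \<phi>' r * cis (of_int m' * \<theta>)" if "0 < r" "r < 1" for r \<theta>
    using assms(1,2) that unfolding quasihomogeneous_def by metis
  show r: "\<phi>' r = \<phi> r" if "0 < r" "r < 1" for r using eq[OF that, of 0] by simp
  show "m' = m"
  proof (rule ccontr)
    assume ne: "m' \<noteq> m"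
    define \<theta> where "\<theta> = pi / (of_int m' - of_int m)"
    have "cis (of_int m * \<theta>) = cis (of_int m' * \<theta>)"
      using eq[of "1/2" \<theta>] r[of "1/2"] assms(3) by simp
    then have "cis (of_int m' * \<theta>) * cis (- (of_int m * \<theta>)) = 1"
      by (metis cis_mult cis_zero add.right_inverse)
    moreover have "of_int m' * \<theta> + - (of_int m * \<theta>) = pi"
      using ne by (simp add: \<theta>_def divide_simps) (simp add: algebra_simps)
    ultimately show False by (simp add: cis_mult)
  qed
qed

lemma toeplitz_cong:
  assumes "\<And>w. norm w < 1 \<Longrightarrow> u w = v w"
  shows "toeplitz h u z = toeplitz h v z"
  unfolding toeplitz_def by (rule Bochner_Integration.integral_cong) (use assms in auto)

lemma one_minus_cnj_mult_bound:
  assumes "norm z < 1" "norm w < 1"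
  shows "norm (1 / (1 - cnj w * z)\<^sup>2) \<le> 1 / (1 - norm z)\<^sup>2"
proof -
  have "norm (cnj w * z) \<le> norm z"
    using assms by (simp add: norm_mult mult_left_le_one_le)
  then have "1 - norm z \<le> norm (1 - cnj w * z)"
    using norm_triangle_ineq2[of 1 "cnj w * z"] by simp
  then have "(1 - norm z)\<^sup>2 \<le> (norm (1 - cnj w * z))\<^sup>2"
    using assms by (intro power_mono) auto
  then show ?thesis
    using assms by (simp add: norm_divide norm_power frac_le)
qed

lemma integrable_toeplitz:
  assumes h: "integrable dA h" and z: "norm z < 1"
  shows "integrable dA (\<lambda>w. h w * w ^ k / (1 - cnj w * z)\<^sup>2)"
proof -
  have cm: "cnj \<in> borel_measurable borel"
    by (intro borel_measurable_continuous_onI continuous_intros)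
  have "(\<lambda>w. 1 / (1 - cnj w * z)\<^sup>2) \<in> borel_measurable borel"
    using cm by measurable
  then have "integrable dA (\<lambda>w. (h w * w ^ k) * (1 / (1 - cnj w * z)\<^sup>2))"
    using one_minus_cnj_mult_bound[OF z]
    by (intro integrable_dA_mult_bounded integrable_dA_mult_continuous h continuous_intros borel_measurable_dA_if_borel)
  then show ?thesis by simp
qed

lemma toeplitz_sum:
  assumes h: "integrable dA h" and z: "norm z < 1"
  shows "toeplitz h (\<lambda>w. \<Sum>i\<in>I. c i * w ^ e i) z = (\<Sum>i\<in>I. c i * toeplitz h (\<lambda>w. w ^ e i) z)"
proof -
  have "toeplitz h (\<lambda>w. \<Sum>i\<in>I. c i * w ^ e i) z = (LINT w|dA. (\<Sum>i\<in>I. c i * (h w * w ^ e i / (1 - cnj w * z)\<^sup>2)))"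
    unfolding toeplitz_def
    by (rule Bochner_Integration.integral_cong) (simp_all add: sum_distrib_left sum_divide_distrib mult_ac)
  also have "\<dots> = (\<Sum>i\<in>I. LINT w|dA. c i * (h w * w ^ e i / (1 - cnj w * z)\<^sup>2))"
    by (rule Bochner_Integration.integral_sum) (intro integrable_mult_right integrable_toeplitz h z)
  also have "\<dots> = (\<Sum>i\<in>I. c i * toeplitz h (\<lambda>w. w ^ e i) z)"
    unfolding toeplitz_def by (intro sum.cong refl integral_mult_right_zero)
  finally show ?thesis .
qed

text \<open>Expanding the Bergman kernel, the coefficients of the image of a monomial are the moments of the symbol
up to the factor \<open>j + 1\<close>. Finite rank of a Toeplitz operator is thus finite rank of a moment matrix.\<close>

lemma toeplitz_monomial_sums:
  assumes h: "integrable dA h" and z: "norm z < 1"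
  shows "(\<lambda>j. of_nat (Suc j) * moment h k j * z ^ j) sums toeplitz h (\<lambda>w. w ^ k) z"
proof -
  have G: "integrable dA (\<lambda>w. h w * w ^ k)"
    by (intro integrable_dA_mult_continuous h continuous_intros)
  have "(\<lambda>n. of_nat (Suc n) * norm z ^ n) sums (1 / (1 - norm z)^2)"
    using z by (intro geometric_deriv_sums) simp
  then have c: "summable (\<lambda>j. norm (of_nat (Suc j) * z ^ j))"
    by (simp add: norm_mult norm_power sums_iff del: of_nat_Suc)
  have "(\<lambda>j. (of_nat (Suc j) * z ^ j) * (LINT w|dA. h w * w ^ k * cnj w ^ j))
      sums (LINT w|dA. h w * w ^ k * (\<Sum>j. (of_nat (Suc j) * z ^ j) * cnj w ^ j))"
    by (rule sums_integral_dA[OF G _ _ c]) (auto simp: norm_power power_le_one intro!: continuous_intros)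
  also have "(LINT w|dA. h w * w ^ k * (\<Sum>j. (of_nat (Suc j) * z ^ j) * cnj w ^ j)) = toeplitz h (\<lambda>w. w ^ k) z"
    unfolding toeplitz_def
  proof (rule Bochner_Integration.integral_cong)
    fix w assume "w \<in> space dA"
    then have "norm (cnj w) < 1" by simp
    then have "norm (cnj w * z) < 1"
      using z unfolding norm_mult by (metis mult_strict_mono' norm_ge_zero mult_1)
    from geometric_deriv_sums[OF this]
    have "(\<Sum>j. (of_nat (Suc j) * z ^ j) * cnj w ^ j) = 1 / (1 - cnj w * z)\<^sup>2"
      by (simp add: sums_iff power_mult_distrib mult_ac del: of_nat_Suc)
    then show "h w * w ^ k * (\<Sum>j. (of_nat (Suc j) * z ^ j) * cnj w ^ j) = h w * w ^ k / (1 - cnj w * z)\<^sup>2"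
      by simp
  qed simp
  finally show ?thesis by (simp only: moment_def mult_ac)
qed

definition toeplitz_weight :: "real \<Rightarrow> int \<Rightarrow> nat \<Rightarrow> complex" where
  "toeplitz_weight p m k = (if 0 \<le> int k + m
     then 2 * of_int (int k + m + 1) / (of_int (2 * int k + m + 2) + of_real p) else 0)"

text \<open>When the exponent \<open>k + m\<close> is negative, the image of the monomial is 0; in that case \<open>nat\<close> yields a
meaningless exponent and the weight 0 takes care of it.\<close>

lemma toeplitz_power_symbol:
  assumes p: "p > -2" and f: "quasihomogeneous f (\<lambda>r. of_real (r powr p)) m" and z: "norm z < 1"
  shows "toeplitz f (\<lambda>w. w ^ k) z = toeplitz_weight p m k * z ^ nat (int k + m)"
proof -
  have meas: "(\<lambda>r. complex_of_real (r powr p)) \<in> borel_measurable (lebesgue_on {0<..<1})"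
    by (rule measurable_unit_interval_if_borel) measurable
  have pos: "Re (of_nat (i + j + 2)) + p > 0" for i j :: nat using p by simp
  have ex: "mellin_exists (\<lambda>r. complex_of_real (r powr p)) (of_nat (i + j + 2))" for i j
    by (rule mellin_powr(1)[OF pos])
  have int: "integrable dA f"
    using moment_quasihomogeneous(1)[OF f meas ex[of 0 0]] by simp
  have mom: "moment f k j = (if m + int k = int j then 2 / (of_nat (k + j + 2) + of_real p) else 0)" for j
    unfolding moment_quasihomogeneous(2)[OF f meas ex] mellin_powr(2)[OF pos] by simp
  have "(\<lambda>j. of_nat (Suc j) * moment f k j * z ^ j) sums (toeplitz_weight p m k * z ^ nat (int k + m))"
  proof (cases "0 \<le> int k + m")
    case True
    define j0 where "j0 = nat (int k + m)"
    have j0: "int j0 = int k + m" using True by (simp add: j0_def)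
    have "(\<lambda>j. of_nat (Suc j) * moment f k j * z ^ j) sums (of_nat (Suc j0) * moment f k j0 * z ^ j0)"
      by (rule sums_finite[of "{j0}", simplified]) (use mom j0 in auto)
    moreover have "of_nat (Suc j0) * moment f k j0 = toeplitz_weight p m k"
    proof -
      have "of_nat (Suc j0) = (of_int (int k + m + 1) :: complex)" using j0 by (metis of_int_of_nat_eq of_nat_Suc int_Suc add.commute)
      moreover have "of_nat (k + j0 + 2) = (of_int (2 * int k + m + 2) :: complex)"
      proof -
        have "int (k + j0 + 2) = 2 * int k + m + 2" using j0 by simp
        then show ?thesis by (metis of_int_of_nat_eq)
      qed
      moreover have "m + int k = int j0" using j0 by simp
      ultimately show ?thesis unfolding mom toeplitz_weight_def using True by (simp only: if_True) (simp add: mult_ac)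
    qed
    ultimately show ?thesis by (simp add: j0_def)
  next
    case False
    then have "moment f k j = 0" for j unfolding mom by auto
    then show ?thesis using False by (simp add: toeplitz_weight_def)
  qed
  with toeplitz_monomial_sums[OF int z, of k] show ?thesis by (rule sums_unique2)
qed

section \<open>Finite rank differences\<close>

text \<open>The coefficient of \<open>z ^ j\<close> in the image of the monomial \<open>w ^ i\<close> under the product of the two Toeplitz
operators.\<close>

definition product_coeff :: "real \<Rightarrow> real \<Rightarrow> int \<Rightarrow> int \<Rightarrow> nat \<Rightarrow> nat \<Rightarrow> complex" where
  "product_coeff p q m n i j =
     (if 0 \<le> int i + n \<and> int j = int i + n + m
      then toeplitz_weight q n i * toeplitz_weight p m (nat (int i + n)) else 0)"

lemma toeplitz_product_monomial:
  assumes p: "p > -2" and f: "quasihomogeneous f (\<lambda>r. of_real (r powr p)) m"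
    and q: "q > -2" and g: "quasihomogeneous g (\<lambda>r. of_real (r powr q)) n"
    and z: "norm z < 1" and fi: "integrable dA f"
  shows "(\<lambda>j. product_coeff p q m n i j * z ^ j) sums toeplitz f (toeplitz g (\<lambda>w. w ^ i)) z"
proof -
  define k where "k = nat (int i + n)"
  have "toeplitz f (toeplitz g (\<lambda>w. w ^ i)) z = toeplitz f (\<lambda>w. \<Sum>_\<in>{0::nat}. toeplitz_weight q n i * w ^ k) z"
    by (rule toeplitz_cong) (simp add: toeplitz_power_symbol[OF q g] k_def)
  also have "\<dots> = toeplitz_weight q n i * (toeplitz_weight p m k * z ^ nat (int k + m))"
    by (subst toeplitz_sum[OF fi z]) (simp add: toeplitz_power_symbol[OF p f z])
  finally have eq: "toeplitz f (toeplitz g (\<lambda>w. w ^ i)) z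
      = toeplitz_weight q n i * (toeplitz_weight p m k * z ^ nat (int k + m))" .
  show ?thesis
  proof (cases "0 \<le> int i + n \<and> 0 \<le> int i + n + m")
    case True
    define j0 where "j0 = nat (int i + n + m)"
    have k: "int k = int i + n" and j0: "int j0 = int i + n + m"
      using True by (auto simp: k_def j0_def)
    have "(\<lambda>j. product_coeff p q m n i j * z ^ j) sums (product_coeff p q m n i j0 * z ^ j0)"
      by (rule sums_finite[of "{j0}", simplified]) (use j0 in \<open>auto simp: product_coeff_def\<close>)
    then show ?thesis
      using True j0 k unfolding eq by (simp add: product_coeff_def k_def[symmetric] j0_def mult.assoc)
  next
    case False
    have "product_coeff p q m n i j = 0" for j
      using False by (auto simp: product_coeff_def)
    moreover have "toeplitz_weight q n i * toeplitz_weight p m k = 0"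
      using False by (auto simp: toeplitz_weight_def k_def)
    ultimately show ?thesis unfolding eq by auto
  qed
qed

lemma toeplitz_product_poly:
  assumes g: "quasihomogeneous g (\<lambda>r. of_real (r powr q)) n" and q: "q > -2"
    and gi: "integrable dA g" and fi: "integrable dA f" and z: "norm z < 1"
  shows "toeplitz f (toeplitz g (poly u)) z
    = (\<Sum>i\<le>degree u. coeff u i * toeplitz f (toeplitz g (\<lambda>w. w ^ i)) z)"
proof -
  define e where "e i = nat (int i + n)" for i
  have mono: "toeplitz g (\<lambda>w. w ^ i) w = toeplitz_weight q n i * w ^ e i" if "norm w < 1" for i w
    using toeplitz_power_symbol[OF q g that] by (simp add: e_def)
  have "toeplitz g (poly u) w = (\<Sum>i\<le>degree u. (coeff u i * toeplitz_weight q n i) * w ^ e i)"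
    if w: "norm w < 1" for w
    unfolding poly_altdef[abs_def] using toeplitz_sum[OF gi w] mono[OF w] by (simp add: mult.assoc)
  then have "toeplitz f (toeplitz g (poly u)) z
      = toeplitz f (\<lambda>w. \<Sum>i\<le>degree u. (coeff u i * toeplitz_weight q n i) * w ^ e i) z"
    by (rule toeplitz_cong)
  also have "\<dots> = (\<Sum>i\<le>degree u. coeff u i * toeplitz_weight q n i * toeplitz f (\<lambda>w. w ^ e i) z)"
    by (rule toeplitz_sum[OF fi z])
  also have "\<dots> = (\<Sum>i\<le>degree u. coeff u i * toeplitz f (toeplitz g (\<lambda>w. w ^ i)) z)"
  proof (intro sum.cong refl)
    fix i
    have "toeplitz f (toeplitz g (\<lambda>w. w ^ i)) z = toeplitz f (\<lambda>w. \<Sum>_\<in>{0::nat}. toeplitz_weight q n i * w ^ e i) z"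
      by (rule toeplitz_cong) (simp add: mono)
    also have "\<dots> = toeplitz_weight q n i * toeplitz f (\<lambda>w. w ^ e i) z"
      by (subst toeplitz_sum[OF fi z]) simp
    finally show "coeff u i * toeplitz_weight q n i * toeplitz f (\<lambda>w. w ^ e i) z
        = coeff u i * toeplitz f (toeplitz g (\<lambda>w. w ^ i)) z" by simp
  qed
  finally show ?thesis .
qed

text \<open>More vectors than the dimension of a space containing them are linearly dependent; the members of the
spanning set need not be independent or even holomorphic for this.\<close>

lemma finite_rank_dependent:
  assumes "finite_rank T"
  obtains N where "\<And>k :: nat \<Rightarrow> nat. \<exists>c. (\<exists>i<N. c i \<noteq> 0) \<and>
     (\<forall>z. norm z < 1 \<longrightarrow> (\<Sum>i<N. c i * T (\<lambda>w. w ^ k i) z) = 0)"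
proof -
  obtain B where B: "finite B"
    and T: "\<And>u. \<exists>c. \<forall>z\<in>ball 0 1. T (poly u) z = (\<Sum>b\<in>B. c b * b z)"
    using assms unfolding finite_rank_def by blast
  define M where "M = card B"
  obtain e where e: "bij_betw e {..<M} B"
    using ex_bij_betw_nat_finite[OF B] by (auto simp: M_def atLeast0LessThan)
  have poly_mon: "poly (Polynomial.monom 1 i) = (\<lambda>w::complex. w ^ i)" for i
    by (simp add: fun_eq_iff poly_monom)
  have "\<exists>c. \<forall>z. norm z < 1 \<longrightarrow> T (\<lambda>w. w ^ i) z = (\<Sum>b\<in>B. c b * b z)" for i
    using T[of "Polynomial.monom 1 i"] unfolding poly_mon by auto
  then obtain C where C: "\<And>i z. norm z < 1 \<Longrightarrow> T (\<lambda>w. w ^ i) z = (\<Sum>b\<in>B. C i b * b z)"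
    by metis
  show thesis
  proof (rule that[of "Suc M"])
    fix k :: "nat \<Rightarrow> nat"
    \<comment> \<open>The columns list the coordinates of \<open>M + 1\<close> images; a zero row makes the matrix square and singular.\<close>
    define A where "A s t = (if s < M then C (k t) (e s) else 0)" for s t
    have "det_fun (Suc M) (\<lambda>s t. A t s) = 0"
      unfolding det_fun_eq_0_iff
    proof (intro exI[of _ "\<lambda>t. if t = M then 1 else 0"] conjI allI impI)
      show "(\<Sum>t<Suc M. A t s * (if t = M then 1 else 0)) = 0" for s
        by (intro sum.neutral) (auto simp: A_def)
    qed auto
    then have "det_fun (Suc M) A = 0" using det_fun_transpose[of "Suc M" A] by simp
    then obtain v where v: "\<exists>t<Suc M. v t \<noteq> 0" "\<And>s. s < Suc M \<Longrightarrow> (\<Sum>t<Suc M. A s t * v t) = 0"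
      unfolding det_fun_eq_0_iff by blast
    have "(\<Sum>t<Suc M. v t * T (\<lambda>w. w ^ k t) z) = 0" if z: "norm z < 1" for z
    proof -
      have "(\<Sum>t<Suc M. v t * T (\<lambda>w. w ^ k t) z) = (\<Sum>t<Suc M. v t * (\<Sum>s<M. C (k t) (e s) * e s z))"
        unfolding C[OF z] sum.reindex_bij_betw[OF e, symmetric] ..
      also have "\<dots> = (\<Sum>s<M. (\<Sum>t<Suc M. A s t * v t) * e s z)"
        unfolding sum_distrib_left sum_distrib_right
        by (subst sum.swap) (intro sum.cong refl, simp add: A_def mult_ac)
      also have "\<dots> = 0" using v(2) by (intro sum.neutral) simp
      finally show ?thesis .
    qed
    with v(1) show "\<exists>c. (\<exists>i<Suc M. c i \<noteq> 0) \<and>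
        (\<forall>z. norm z < 1 \<longrightarrow> (\<Sum>i<Suc M. c i * T (\<lambda>w. w ^ k i) z) = 0)"
      by blast
  qed
qed

text \<open>Monomials whose images coincide are grouped together, because the span is formed over a set.\<close>

lemma finite_rank_if_finitely_many_monomials:
  assumes "\<And>u z. norm z < 1 \<Longrightarrow> T (poly u) z = (\<Sum>i<N. coeff u i * D i z)"
  shows "finite_rank T"
  unfolding finite_rank_def
proof (intro exI[of _ "D ` {..<N}"] conjI allI)
  fix u :: "complex poly"
  show "\<exists>c. \<forall>z\<in>ball 0 1. T (poly u) z = (\<Sum>b\<in>D ` {..<N}. c b * b z)"
  proof (intro exI ballI)
    fix z :: complex assume z: "z \<in> ball 0 1"
    have "T (poly u) z = (\<Sum>i<N. coeff u i * D i z)" using assms z by simp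
    also have "\<dots> = (\<Sum>b\<in>D ` {..<N}. \<Sum>i\<in>{i\<in>{..<N}. D i = b}. coeff u i * D i z)"
      by (rule sum.image_gen) simp
    also have "\<dots> = (\<Sum>b\<in>D ` {..<N}. (\<Sum>i\<in>{i\<in>{..<N}. D i = b}. coeff u i) * b z)"
      unfolding sum_distrib_right by (intro sum.cong refl) auto
    finally show "T (poly u) z = (\<Sum>b\<in>D ` {..<N}. (\<lambda>b. \<Sum>i\<in>{i\<in>{..<N}. D i = b}. coeff u i) b * b z)" .
  qed
qed simp

lemma power_series_zero_coeffs:
  fixes a :: "nat \<Rightarrow> complex"
  assumes "\<And>z. norm z < 1 \<Longrightarrow> (\<lambda>j. a j * z ^ j) sums 0"
  shows "a j = 0"
proof (rule ccontr)
  assume j: "a j \<noteq> 0"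
  have "a 0 = 0" using assms[of 0] by simp
  then have "j > 0" using j by (cases j) auto
  show False
  proof (rule powser_0_nonzero[of 1 "0::complex" a "\<lambda>_. 0" j])
    fix s :: real assume "0 < s" and nz: "\<And>z::complex. z \<in> cball 0 s - {0} \<Longrightarrow> (0::complex) \<noteq> 0"
    then have "complex_of_real s \<in> cball 0 s - {0}" by simp
    from nz[OF this] show False by simp
  qed (use assms j \<open>j > 0\<close> in simp_all)
qed

lemma nearly_integrable_if_mellin:
  assumes m: "\<phi> \<in> borel_measurable borel" and \<alpha>: "\<alpha> > 0" and ex: "mellin_exists \<phi> (of_real (\<alpha> + 1))"
  shows "nearly_integrable \<phi>"
  unfolding nearly_integrable_def
proof (intro conjI exI[of _ \<alpha>])
  show "\<phi> \<in> borel_measurable (lebesgue_on {0<..<1})" by (rule measurable_unit_interval_if_borel[OF m])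
  have eq: "\<phi> r * complex_of_real (r powr \<alpha>) = \<phi> r * complex_of_real r powr (of_real (\<alpha> + 1) - 1)"
    if "r \<in> space (lebesgue_on {0<..<1})" for r
    using that by (simp add: powr_of_real)
  show "integrable (lebesgue_on {0<..<1}) (\<lambda>r. \<phi> r * complex_of_real (r powr \<alpha>))"
    using ex unfolding mellin_exists_def by (subst Bochner_Integration.integrable_cong[OF refl eq])
qed (rule \<alpha>)

lemma nearly_integrable_powr:
  assumes "p > -2"
  shows "nearly_integrable (\<lambda>r. of_real (r powr p))"
  using assms by (intro nearly_integrable_if_mellin[of _ 2] mellin_powr(1)) auto

definition diamond_symbol :: "real \<Rightarrow> real \<Rightarrow> int \<Rightarrow> int \<Rightarrow> complex \<Rightarrow> complex" where
  "diamond_symbol p q m n w = of_real (diamond_radial p q m n (norm w)) * sgn w powi (m + n)"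

lemma quasihomogeneous_diamond_symbol:
  "quasihomogeneous (diamond_symbol p q m n) (\<lambda>r. of_real (diamond_radial p q m n r)) (m + n)"
  unfolding quasihomogeneous_def
proof (intro allI impI)
  fix r \<theta> :: real assume r: "0 < r \<and> r < 1"
  have "norm (rcis r \<theta>) = r" using r by simp
  moreover have "sgn (rcis r \<theta>) = cis \<theta>"
    using r by (simp add: sgn_eq rcis_def norm_mult)
  ultimately show "diamond_symbol p q m n (rcis r \<theta>) = of_real (diamond_radial p q m n r) * cis (of_int (m + n) * \<theta>)"
    unfolding diamond_symbol_def by (simp only: cis_power_int)
qed

lemma measurable_of_real_diamond_radial:
  "(\<lambda>r. complex_of_real (diamond_radial p q m n r)) \<in> borel_measurable (lebesgue_on {0<..<1})"
  by (rule measurable_unit_interval_if_borel) measurable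

text \<open>The convolution exists whatever the angular frequencies are: the definition only asks for a nearly
integrable radial part, and only integrability over the disk leads to the three conditions.\<close>

lemma is_diamond_diamond_symbol:
  assumes p: "p > -2" and f: "quasihomogeneous f (\<lambda>r. of_real (r powr p)) m"
    and q: "q > -2" and g: "quasihomogeneous g (\<lambda>r. of_real (r powr q)) n"
  shows "is_diamond f g (diamond_symbol p q m n)"
  unfolding is_diamond_def
proof (rule exI[of _ m], rule exI[of _ n], rule exI[of _ "\<lambda>r. complex_of_real (r powr p)"],
    rule exI[of _ "\<lambda>r. complex_of_real (r powr q)"], rule exI[of _ "\<lambda>r. complex_of_real (diamond_radial p q m n r)"],
    intro exI[of _ "\<bar>p + n\<bar> + \<bar>q - m\<bar>"] conjI allI impI)
  show "nearly_integrable (\<lambda>r. of_real (diamond_radial p q m n r))"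
  proof (rule nearly_integrable_if_mellin)
    show "\<bar>p + n\<bar> + \<bar>q - m\<bar> + 1 > 0" by simp
    show "mellin_exists (\<lambda>r. of_real (diamond_radial p q m n r)) (of_real (\<bar>p + n\<bar> + \<bar>q - m\<bar> + 1 + 1))"
      by (rule mellin_diamond_radial(1)) (unfold Re_complex_of_real, linarith+)
  qed measurable
  fix \<zeta> :: complex assume \<zeta>: "\<bar>p + n\<bar> + \<bar>q - m\<bar> < Re \<zeta>"
  have a: "Re \<zeta> + (p + n) > 0" and b: "Re \<zeta> + (q - m) > 0" using \<zeta> by linarith+
  then have a': "Re (\<zeta> + of_int n) + p > 0" and b': "Re (\<zeta> - of_int m) + q > 0" by simp_all
  show "mellin_exists (\<lambda>r. of_real (r powr p)) (\<zeta> + of_int n)" by (rule mellin_powr(1)[OF a'])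
  show "mellin_exists (\<lambda>r. of_real (r powr q)) (\<zeta> - of_int m)" by (rule mellin_powr(1)[OF b'])
  show "mellin_exists (\<lambda>r. of_real (diamond_radial p q m n r)) \<zeta>" by (rule mellin_diamond_radial(1)[OF a b])
  show "mellin (\<lambda>r. of_real (diamond_radial p q m n r)) \<zeta> = (\<zeta> - of_int m + of_int n)
      * mellin (\<lambda>r. of_real (r powr p)) (\<zeta> + of_int n) * mellin (\<lambda>r. of_real (r powr q)) (\<zeta> - of_int m)"
    unfolding mellin_diamond_radial(2)[OF a b] mellin_powr(2)[OF a'] mellin_powr(2)[OF b'] by simp
qed (rule f g quasihomogeneous_diamond_symbol nearly_integrable_powr[OF p] nearly_integrable_powr[OF q])+

text \<open>The defining equation of the convolution says exactly that, far enough along, the moments of any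
representative are the matrix coefficients of the product. The bound \<open>N\<close> moves the evaluation point
\<open>i + j + 2\<close> of the Mellin transforms into the half plane where the equation and the formulas for both
powers hold, and it excludes negative exponents.\<close>

lemma moment_diamond:
  assumes f: "quasihomogeneous f (\<lambda>r. of_real (r powr p)) m"
    and g: "quasihomogeneous g (\<lambda>r. of_real (r powr q)) n" and k: "is_diamond f g k"
  obtains N where "\<And>i j. i \<ge> N \<Longrightarrow> integrable dA (\<lambda>w. k w * w ^ i * cnj w ^ j)"
    "\<And>i j. i \<ge> N \<Longrightarrow> of_nat (Suc j) * moment k i j = product_coeff p q m n i j"
proof -
  obtain m' n' \<phi> \<psi> \<omega> c where d: "quasihomogeneous f \<phi> m'" "quasihomogeneous g \<psi> n'"
    "quasihomogeneous k \<omega> (m' + n')" "nearly_integrable \<omega>"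
    "\<And>\<zeta>. c < Re \<zeta> \<Longrightarrow> mellin_exists \<omega> \<zeta>"
    "\<And>\<zeta>. c < Re \<zeta> \<Longrightarrow> mellin \<omega> \<zeta> = (\<zeta> - of_int m' + of_int n')
              * mellin \<phi> (\<zeta> + of_int n') * mellin \<psi> (\<zeta> - of_int m')"
    using k unfolding is_diamond_def by blast
  have m': "m' = m" "\<And>r. 0 < r \<Longrightarrow> r < 1 \<Longrightarrow> \<phi> r = of_real (r powr p)"
    using quasihomogeneous_unique[OF f d(1)] by simp_all
  have n': "n' = n" "\<And>r. 0 < r \<Longrightarrow> r < 1 \<Longrightarrow> \<psi> r = of_real (r powr q)"
    using quasihomogeneous_unique[OF g d(2)] by simp_all
  have mel\<phi>: "mellin \<phi> \<zeta> = mellin (\<lambda>r. of_real (r powr p)) \<zeta>" for \<zeta>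
    unfolding mellin_def by (rule Bochner_Integration.integral_cong) (simp_all add: m'(2))
  have mel\<psi>: "mellin \<psi> \<zeta> = mellin (\<lambda>r. of_real (r powr q)) \<zeta>" for \<zeta>
    unfolding mellin_def by (rule Bochner_Integration.integral_cong) (simp_all add: n'(2))
  have \<omega>m: "\<omega> \<in> borel_measurable (lebesgue_on {0<..<1})"
    using d(4) by (simp add: nearly_integrable_def)
  obtain N :: nat where N: "\<bar>c\<bar> + \<bar>p\<bar> + \<bar>q\<bar> + \<bar>of_int m\<bar> + \<bar>of_int n\<bar> < real N"
    using reals_Archimedean2 by blast
  show thesis
  proof (rule that[of N])
    fix i j :: nat assume i: "i \<ge> N"
    define \<zeta> :: complex where "\<zeta> = of_nat (i + j + 2)"
    have iN: "\<bar>c\<bar> + \<bar>p\<bar> + \<bar>q\<bar> + \<bar>of_int m\<bar> + \<bar>of_int n\<bar> < real i" using N i by linarith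
    have Re: "Re \<zeta> = real i + real j + 2" by (simp add: \<zeta>_def)
    have c: "c < Re \<zeta>" unfolding Re using iN by linarith
    have ex: "mellin_exists \<omega> (of_nat (i + j + 2))" using d(5)[OF c] by (simp only: \<zeta>_def)
    show "integrable dA (\<lambda>w. k w * w ^ i * cnj w ^ j)"
      by (rule moment_quasihomogeneous(1)[OF d(3) \<omega>m ex])
    have mom: "moment k i j = (if m + n + int i = int j then 2 * mellin \<omega> \<zeta> else 0)"
      using moment_quasihomogeneous(2)[OF d(3) \<omega>m ex] by (simp only: \<zeta>_def m'(1) n'(1))
    have in0: "0 \<le> int i + n"
    proof -
      have "real_of_int (int i + n) \<ge> 0" using iN by simp
      then show ?thesis by linarith
    qed
    show "of_nat (Suc j) * moment k i j = product_coeff p q m n i j"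
    proof (cases "int j = int i + n + m")
      case False
      then show ?thesis unfolding mom product_coeff_def by auto
    next
      case True
      then have eq: "m + n + int i = int j" by simp
      define x :: complex where "x = of_int (int i + n + 1)"
      define y :: complex where "y = of_int (2 * (int i + n) + m + 2) + of_real p"
      define y' :: complex where "y' = of_int (2 * int i + n + 2) + of_real q"
      have j: "(of_nat j :: complex) = of_int (int i + n + m)"
        using True by (metis of_int_of_nat_eq)
      have \<zeta>: "\<zeta> = of_int (2 * int i + n + m + 2)" unfolding \<zeta>_def using j by simp
      have a: "Re (\<zeta> + of_int n) + p > 0" and b: "Re (\<zeta> - of_int m) + q > 0"
        unfolding plus_complex.simps minus_complex.simps Re using iN by auto
      have "mellin \<omega> \<zeta> = (\<zeta> - of_int m + of_int n) * (1 / (\<zeta> + of_int n + of_real p)) * (1 / (\<zeta> - of_int m + of_real q))"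
        using d(6)[OF c] unfolding m'(1) n'(1) mel\<phi> mel\<psi> mellin_powr(2)[OF a] mellin_powr(2)[OF b] .
      also have "\<zeta> - of_int m + of_int n = 2 * x" by (simp add: \<zeta> x_def)
      also have "\<zeta> + of_int n + of_real p = y" by (simp add: \<zeta> y_def)
      also have "\<zeta> - of_int m + of_real q = y'" by (simp add: \<zeta> y'_def)
      finally have mel: "mellin \<omega> \<zeta> = 2 * x * (1 / y) * (1 / y')" .
      have "product_coeff p q m n i j = (2 * x / y') * (2 * of_nat (Suc j) / y)"
      proof -
        have "int (nat (int i + n)) = int i + n" using in0 by simp
        moreover have "0 \<le> int i + n + m" using True by linarith
        moreover have "of_nat (Suc j) = (of_int (int i + n + m + 1) :: complex)" using j by simp
        ultimately show ?thesis
          using True in0 unfolding product_coeff_def toeplitz_weight_def x_def y_def y'_def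
          by (simp only: if_True simp_thms)
      qed
      then show ?thesis unfolding mom mel using eq by (simp add: mult_ac)
    qed
  qed
qed

text \<open>The difference \<open>h - k\<close> need not be integrable, but its product with \<open>norm w ^ (2 * M)\<close> is, and the
moments of this product form a submatrix of the matrix of the finite rank operator, up to sign and the
nonzero factors \<open>j + 1\<close>.\<close>

lemma finite_rank_difference_imp_diamond:
  assumes p: "p > -2" and f: "quasihomogeneous f (\<lambda>r. of_real (r powr p)) m"
    and q: "q > -2" and g: "quasihomogeneous g (\<lambda>r. of_real (r powr q)) n"
    and fi: "integrable dA f" and h: "integrable dA h"
    and fr: "finite_rank (\<lambda>u z. toeplitz f (toeplitz g u) z - toeplitz h u z)"
    and k: "is_diamond f g k"
  shows "AE w in dA. h w = k w"
proof -
  obtain M where ki: "\<And>i j. i \<ge> M \<Longrightarrow> integrable dA (\<lambda>w. k w * w ^ i * cnj w ^ j)"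
    and kmom: "\<And>i j. i \<ge> M \<Longrightarrow> of_nat (Suc j) * moment k i j = product_coeff p q m n i j"
    using moment_diamond[OF f g k] by blast
  define F where "F w = (h w - k w) * (w ^ M * cnj w ^ M)" for w
  have F_eq: "F w * w ^ i * cnj w ^ j = h w * w ^ (i + M) * cnj w ^ (j + M) - k w * w ^ (i + M) * cnj w ^ (j + M)" for w i j
    by (simp add: F_def algebra_simps power_add)
  have Fi: "integrable dA F"
  proof -
    have "integrable dA (\<lambda>w. F w * w ^ 0 * cnj w ^ 0)"
      unfolding F_eq by (intro Bochner_Integration.integrable_diff integrable_moment[OF h] ki) simp
    then show ?thesis by simp
  qed
  have Fmom: "moment F i j = moment h (i + M) (j + M) - moment k (i + M) (j + M)" for i j
    unfolding moment_def F_eq by (intro Bochner_Integration.integral_diff integrable_moment[OF h] ki) simp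
  define T where "T u z = toeplitz f (toeplitz g u) z - toeplitz h u z" for u z
  obtain N where N: "\<And>\<kappa> :: nat \<Rightarrow> nat. \<exists>c. (\<exists>i<N. c i \<noteq> 0) \<and>
     (\<forall>z. norm z < 1 \<longrightarrow> (\<Sum>i<N. c i * T (\<lambda>w. w ^ \<kappa> i) z) = 0)"
    using finite_rank_dependent[OF fr] unfolding T_def by blast
  have "AE w in dA. F w = 0"
  proof (rule finite_rank_moment_matrix_imp_zero[OF Fi, of N])
    fix \<kappa> :: "nat \<Rightarrow> nat"
    obtain c where c: "\<exists>i<N. c i \<noteq> 0" "\<And>z. norm z < 1 \<Longrightarrow> (\<Sum>i<N. c i * T (\<lambda>w. w ^ (\<kappa> i + M)) z) = 0"
      using N[of "\<lambda>i. \<kappa> i + M"] by blast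
    define a where "a j = (\<Sum>i<N. c i * (product_coeff p q m n (\<kappa> i + M) j - of_nat (Suc j) * moment h (\<kappa> i + M) j))" for j
    have "(\<lambda>j. a j * z ^ j) sums 0" if z: "norm z < 1" for z
    proof -
      have "(\<lambda>j. \<Sum>i<N. c i * (product_coeff p q m n (\<kappa> i + M) j * z ^ j - of_nat (Suc j) * moment h (\<kappa> i + M) j * z ^ j))
          sums (\<Sum>i<N. c i * T (\<lambda>w. w ^ (\<kappa> i + M)) z)"
        unfolding T_def
        by (intro sums_sum sums_mult sums_diff toeplitz_product_monomial[OF p f q g z fi] toeplitz_monomial_sums[OF h z])
      also have "(\<lambda>j. \<Sum>i<N. c i * (product_coeff p q m n (\<kappa> i + M) j * z ^ j - of_nat (Suc j) * moment h (\<kappa> i + M) j * z ^ j))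
          = (\<lambda>j. a j * z ^ j)"
        unfolding a_def sum_distrib_right by (simp only: left_diff_distrib mult.assoc)
      finally show ?thesis unfolding c(2)[OF z] .
    qed
    then have a0: "a j = 0" for j by (rule power_series_zero_coeffs)
    have "(\<Sum>i<N. c i * moment F (\<kappa> i) j) = 0" for j
    proof -
      have "of_nat (Suc (j + M)) * (\<Sum>i<N. c i * moment F (\<kappa> i) j) = - a (j + M)"
        unfolding a_def sum_distrib_left sum_negf[symmetric] Fmom
        by (intro sum.cong refl) (subst kmom[symmetric], simp, simp only: right_diff_distrib minus_diff_eq mult_ac)
      then show ?thesis unfolding a0 by (simp del: of_nat_Suc)
    qed
    with c(1) show "\<exists>c. (\<exists>i<N. c i \<noteq> 0) \<and> (\<forall>j. (\<Sum>i<N. c i * moment F (\<kappa> i) j) = 0)"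
      by blast
  qed
  then show ?thesis
    using AE_dA_nonzero by eventually_elim (auto simp: F_def)
qed

text \<open>If the convolution is integrable, then its Toeplitz operator agrees with the product on all but finitely
many monomials.\<close>

lemma finite_rank_diamond_symbol:
  assumes p: "p > -2" and f: "quasihomogeneous f (\<lambda>r. of_real (r powr p)) m"
    and q: "q > -2" and g: "quasihomogeneous g (\<lambda>r. of_real (r powr q)) n"
    and fi: "integrable dA f" and gi: "integrable dA g" and k: "is_diamond f g k" and ki: "integrable dA k"
  shows "finite_rank (\<lambda>u z. toeplitz f (toeplitz g u) z - toeplitz k u z)"
proof -
  obtain M where "\<And>i j. i \<ge> M \<Longrightarrow> integrable dA (\<lambda>w. k w * w ^ i * cnj w ^ j)"
    and kmom: "\<And>i j. i \<ge> M \<Longrightarrow> of_nat (Suc j) * moment k i j = product_coeff p q m n i j"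
    using moment_diamond[OF f g k] by blast
  define D where "D i z = toeplitz f (toeplitz g (\<lambda>w. w ^ i)) z - toeplitz k (\<lambda>w. w ^ i) z" for i z
  have D0: "D i z = 0" if "i \<ge> M" "norm z < 1" for i z
  proof -
    have "(\<lambda>j. product_coeff p q m n i j * z ^ j) sums toeplitz k (\<lambda>w. w ^ i) z"
      using toeplitz_monomial_sums[OF ki that(2), of i] unfolding kmom[OF that(1)] .
    from sums_unique2[OF toeplitz_product_monomial[OF p f q g that(2) fi] this]
    show ?thesis by (simp add: D_def)
  qed
  show ?thesis
  proof (rule finite_rank_if_finitely_many_monomials[where N = M and D = D])
    fix u :: "complex poly" and z :: complex assume z: "norm z < 1"
    have "toeplitz k (poly u) z = (\<Sum>i\<le>degree u. coeff u i * toeplitz k (\<lambda>w. w ^ i) z)"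
      unfolding poly_altdef[abs_def] by (rule toeplitz_sum[OF ki z])
    then have "toeplitz f (toeplitz g (poly u)) z - toeplitz k (poly u) z = (\<Sum>i\<le>degree u. coeff u i * D i z)"
      unfolding toeplitz_product_poly[OF g q gi fi z] D_def by (simp add: sum_subtractf right_diff_distrib)
    also have "\<dots> = (\<Sum>i<M. coeff u i * D i z)"
      by (rule sum.mono_neutral_cong) (auto simp: D0[OF _ z] coeff_eq_0 not_le not_less)
    finally show "toeplitz f (toeplitz g (poly u)) z - toeplitz k (poly u) z = (\<Sum>i<M. coeff u i * D i z)" .
  qed
qed

theorem corollary2p11:
  fixes m n :: int and p q :: real and f g :: "complex \<Rightarrow> complex"
  assumes "p > -2" and "q > -2"
    and f: "\<And>r \<theta>. 0 < r \<Longrightarrow> r < 1 \<Longrightarrow>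
              f (rcis r \<theta>) = complex_of_real (r powr p) * cis (of_int m * \<theta>)"
    and g: "\<And>r \<theta>. 0 < r \<Longrightarrow> r < 1 \<Longrightarrow>
              g (rcis r \<theta>) = complex_of_real (r powr q) * cis (of_int n * \<theta>)"
  shows "integrable dA f \<and> integrable dA g \<and>
    ((\<exists>h. integrable dA h \<and>
          finite_rank (\<lambda>u z. toeplitz f (toeplitz g u) z - toeplitz h u z))
     \<longleftrightarrow>
       (q - of_int m + 2 > 0 \<and> p + of_int n + 2 > 0) \<or>
       (of_int m + p = 0 \<and> q - of_int m + 2 > 0) \<or>
       (of_int n - q = 0 \<and> p + of_int n + 2 > 0)) \<and>
    (\<forall>h. integrable dA h \<and>
         finite_rank (\<lambda>u z. toeplitz f (toeplitz g u) z - toeplitz h u z)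
       \<longrightarrow> (\<exists>k. is_diamond f g k) \<and>
           (\<forall>k. is_diamond f g k \<longrightarrow> (AE z in dA. h z = k z)))"
proof -
  have fq: "quasihomogeneous f (\<lambda>r. of_real (r powr p)) m"
    and gq: "quasihomogeneous g (\<lambda>r. of_real (r powr q)) n"
    using f g unfolding quasihomogeneous_def by blast+
  have integrable_symbol: "integrable dA H"
    if "s > -2" "quasihomogeneous H (\<lambda>r. of_real (r powr s)) d" for H s d
  proof -
    have meas: "(\<lambda>r. complex_of_real (r powr s)) \<in> borel_measurable (lebesgue_on {0<..<1})"
      by (rule measurable_unit_interval_if_borel) measurable
    have "mellin_exists (\<lambda>r. complex_of_real (r powr s)) 2"
      using that(1) by (intro mellin_powr(1)) simp
    then show ?thesis
      unfolding quasihomogeneous_dA(1)[OF that(2) meas] mellin_exists_2_iff .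
  qed
  have fi: "integrable dA f" and gi: "integrable dA g"
    using integrable_symbol[OF assms(1) fq] integrable_symbol[OF assms(2) gq] .
  let ?k = "diamond_symbol p q m n"
  let ?fr = "\<lambda>h. finite_rank (\<lambda>u z. toeplitz f (toeplitz g u) z - toeplitz h u z)"
  let ?b = "(q - of_int m + 2 > 0 \<and> p + of_int n + 2 > 0) \<or>
       (of_int m + p = 0 \<and> q - of_int m + 2 > 0) \<or>
       (of_int n - q = 0 \<and> p + of_int n + 2 > 0)"
  have dk: "is_diamond f g ?k" by (rule is_diamond_diamond_symbol[OF assms(1) fq assms(2) gq])
  have k_iff: "integrable dA ?k \<longleftrightarrow> ?b"
    unfolding quasihomogeneous_dA(1)[OF quasihomogeneous_diamond_symbol measurable_of_real_diamond_radial]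
    by (rule integrable_diamond_radial_iff)
  have unique: "AE z in dA. h z = k z" if "integrable dA h" "?fr h" "is_diamond f g k" for h k
    by (rule finite_rank_difference_imp_diamond[OF assms(1) fq assms(2) gq fi that])
  have "?b" if h: "integrable dA h" "?fr h" for h
  proof -
    have "?k \<in> borel_measurable dA"
      unfolding diamond_symbol_def[abs_def]
      by (intro borel_measurable_dA_if_borel borel_measurable_times measurable_sgn_power_int
          measurable_compose[OF measurable_compose[OF borel_measurable_norm measurable_diamond_radial] borel_measurable_of_real])
    then have "integrable dA ?k"
      using integrable_cong_AE_imp[OF h(1) _ unique[OF h dk]] by blast
    then show ?thesis unfolding k_iff .
  qed
  moreover have "integrable dA ?k \<and> ?fr ?k" if "?b"
    using that k_iff finite_rank_diamond_symbol[OF assms(1) fq assms(2) gq fi gi dk] by blast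
  ultimately have "(\<exists>h. integrable dA h \<and> ?fr h) \<longleftrightarrow> ?b" by blast
  then show ?thesis using fi gi dk unique by blast
qed

end
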